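(* Let $k,d,n$ be positive integers. Let $K$ be an algebraically closed field of characteristic $0$ or $p>kd$. Let $W$ be a $K$-vector space with basis $w_0,\dots,w_n$ and dual basis $x_0,\dots,x_n$. Let $f\in\mathrm{Sym}^{kd}(W^* )$, and let $r=\dim_K(\mathrm{Sym}^d(W^* ))-1$. Assume that there exist $r+1$ covariants of order $d$ of $\mathrm{Sym}^{kd}(W^* )$ which are linearly independent at $f$, and let $q_0,\dots,q_r$ be such covariants. Define $$\varphi:\mathbb{P}^n\to\mathbb{P}^r,\qquad [x_0:\cdots:x_n]\mapsto[q_0(f):\cdots:q_r(f)].$$ Let $X_0,\dots,X_r$ be coordinates for $\mathbb{P}^r$. Define $$\tilde f=\sum_{0\le i_1,\dots,i_k\le r}\mathrm{D}(\Delta q_{i_1}^*\cdots\Delta q_{i_k}^*,\mathrm{Id})(f)\,X_{i_1}\cdots X_{i_k},$$ where $\mathrm{Id}$ is the identity covariant of $\mathrm{Sym}^{kd}(W^* )$, and let $Q_0,\dots,Q_s$ be a set of quadratic forms in the $X_i$ which define $\mathrm{Im}(\varphi)$. Then the coefficients of $\tilde f$ are invariants of $\mathrm{Sym}^{kd}(W^* )$ (evaluated at $f$), and the $Q_i$ can be chosen to have coefficients which can be computed in terms of invariants of $\mathrm{Sym}^{kd}(W^* )$. Moreover, the knowledge of $\tilde f$ and the $Q_i$ is enough to recover a form $f'\in\mathrm{Sym}^{kd}(W^* )$ which is $\mathrm{GL}_{n+1}$-equivalent to $f$.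
   Context: $\mathrm{GL}_{n+1}=\mathrm{GL}(W)$ acts on $W$ by left multiplication, on $W^*$ by the contragredient action, and on symmetric powers by the induced actions. Two forms in $\mathrm{Sym}^{kd}(W^* )$ are $\mathrm{GL}_{n+1}$-equivalent if one can be transformed into the other by an element of $\mathrm{GL}_{n+1}$. A covariant (resp. contravariant) of $\mathrm{Sym}^{m}(W^* )$ of order $e$ is an $\mathrm{SL}(W)$-equivariant homogeneous polynomial map $\mathrm{Sym}^{m}(W^* )\to\mathrm{Sym}^e(W^* )$ (resp. $\to\mathrm{Sym}^e(W)$). When $e=0$ it is called an invariant. Covariants $q_0,\dots,q_r$ of order $d$ are linearly independent at $f$ if the forms $q_0(f),\dots,q_r(f)$ are linearly independent over $K$. In the definition of $\varphi$ the forms $q_i(f)$ are evaluated at $(x_0,\dots,x_n)$. $\mathrm{D}:\mathrm{Sym}(W)\times\mathrm{Sym}(W^* )\to\mathrm{Sym}(W^* )$ is the $K$-bilinear map with $\mathrm{D}(w_0^{\alpha_0}\cdots w_n^{\alpha_n},P)=\frac{\partial^{\alpha_0+\cdots+\alpha_n}P}{\partial x_0^{\alpha_0}\cdots\partial x_n^{\alpha_n}}$. For a contravariant $p$ and a covariant $q$, $\mathrm{D}(p,q)$ is defined pointwise by $\mathrm{D}(p,q)(f)=\mathrm{D}(p(f),q(f))$; products of covariants or contravariants are also pointwise. For a basis $(e_i)$ of $\mathrm{Sym}^d(W^* )$, its dual basis is the basis $(e_i^* )$ of $\mathrm{Sym}^d(W)$ with $\mathrm{D}(e_i^*,e_j)=\delta_{i,j}$.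 Let $(b_i)_{0\le i\le r}$ be the monomial basis of $\mathrm{Sym}^d(W^* )$ in lexicographic order, with dual basis $(b_i^* )$. Let $S$ be the change of basis matrix from $(b_i)$ to $(q_i)$, i.e. the matrix whose $i$-th column consists of the coordinates of $q_i$ in the basis $(b_j)$ (its entries are polynomial functions on $\mathrm{Sym}^{kd}(W^* )$), and let $\Delta=\det S$. Then $\Delta q_i^*$ is the contravariant whose coordinates in the basis $(b_j^* )$ are given by the $i$-th column of $\Delta\,{}^tS^{-1}$; its value at $f$ is $\Delta(f)$ times the $i$-th element of the dual basis of $(q_0(f),\dots,q_r(f))$. *)

theory Defs
  imports
    "HOL-Library.Poly_Mapping"
    "HOL-Library.FuncSet"
    "HOL-Computational_Algebra.Polynomial"
    "Jordan_Normal_Form.Determinant"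
    "Jordan_Normal_Form.Gauss_Jordan_Elimination"
begin

section \<open>Polynomials and forms\<close>

text \<open>
  Polynomials with indeterminates indexed by a type of class \<open>type\<close> are finitely supported
  functions from exponents to coefficients. After the choice of the basis
  \<open>w\<^sub>0, \<dots>, w\<^sub>n\<close> of \<open>W\<close> and of its dual basis \<open>x\<^sub>0, \<dots>, x\<^sub>n\<close>, both \<open>Sym(W)\<close> and \<open>Sym(W*)\<close> are
  the polynomial ring in the indeterminates \<open>0, \<dots>, n\<close>; they differ by the action of \<open>GL(W)\<close>.
\<close>

type_synonym ('v, 'a) mpoly = "('v \<Rightarrow>\<^sub>0 nat) \<Rightarrow>\<^sub>0 'a"

definition mconst :: "'a::zero \<Rightarrow> ('v, 'a) mpoly" where
  "mconst c = Poly_Mapping.single 0 c"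

definition mvar :: "'v \<Rightarrow> ('v, 'a::zero_neq_one) mpoly" where
  "mvar i = Poly_Mapping.single (Poly_Mapping.single i 1) 1"

definition minsert ::
  "('a::zero \<Rightarrow> 'b) \<Rightarrow> ('v \<Rightarrow> 'b) \<Rightarrow> ('v, 'a) mpoly \<Rightarrow> 'b::comm_semiring_1" where
  "minsert h s P =
     (\<Sum>\<alpha>\<in>Poly_Mapping.keys P. h (Poly_Mapping.lookup P \<alpha>) *
        (\<Prod>i\<in>Poly_Mapping.keys \<alpha>. s i ^ Poly_Mapping.lookup \<alpha> i))"

abbreviation meval :: "('v \<Rightarrow> 'a) \<Rightarrow> ('v, 'a) mpoly \<Rightarrow> 'a::comm_semiring_1" where
  "meval \<equiv> minsert (\<lambda>c. c)"

abbreviation msubst ::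
  "('v \<Rightarrow> ('u, 'a) mpoly) \<Rightarrow> ('v, 'a) mpoly \<Rightarrow> ('u, 'a::comm_semiring_1) mpoly" where
  "msubst \<equiv> minsert mconst"

definition exps :: "'v set \<Rightarrow> nat \<Rightarrow> ('v \<Rightarrow>\<^sub>0 nat) set" where
  "exps V m = {\<alpha>. Poly_Mapping.keys \<alpha> \<subseteq> V \<and>
                  (\<Sum>i\<in>Poly_Mapping.keys \<alpha>. Poly_Mapping.lookup \<alpha> i) = m}"

definition forms :: "'v set \<Rightarrow> nat \<Rightarrow> ('v, 'a::zero) mpoly set" where
  "forms V m = {P. Poly_Mapping.keys P \<subseteq> exps V m}"

abbreviation Sym :: "nat \<Rightarrow> nat \<Rightarrow> (nat, 'a::zero) mpoly set" where
  "Sym n m \<equiv> forms {..n} m"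

definition mscale :: "'a \<Rightarrow> ('v, 'a) mpoly \<Rightarrow> ('v, 'a::comm_semiring_1) mpoly" where
  "mscale c P = mconst c * P"

lemma mconst_hom:
  "mconst (a + b) = mconst a + (mconst b :: ('v, 'a::comm_semiring_1) mpoly)"
  "mconst (a * b) = mconst a * (mconst b :: ('v, 'a::comm_semiring_1) mpoly)"
  "mconst 1 = (1 :: ('v, 'a::comm_semiring_1) mpoly)"
  by (simp_all add: mconst_def single_add mult_single)

interpretation mpoly: vector_space "mscale :: 'a \<Rightarrow> ('v, 'a::field) mpoly \<Rightarrow> ('v, 'a) mpoly"
  by unfold_locales (simp_all add: mscale_def mconst_hom algebra_simps)

section \<open>Group actions, covariants and contravariants\<close>

definition GL :: "nat \<Rightarrow> 'a::field mat set" where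
  "GL n = {A \<in> carrier_mat (n + 1) (n + 1). invertible_mat A}"

definition SL :: "nat \<Rightarrow> 'a::field mat set" where
  "SL n = {A \<in> carrier_mat (n + 1) (n + 1). det A = 1}"

text \<open>On \<open>W\<close>: the \<open>j\<close>-th basis vector is sent to the \<open>j\<close>-th column of \<open>A\<close>. On \<open>W*\<close>: a linear form
  \<open>l\<close> is sent to \<open>l \<circ> A\<inverse>\<close>, so that \<open>x\<^sub>i\<close> is sent to the \<open>i\<close>-th row of \<open>A\<inverse>\<close>.\<close>

definition act :: "nat \<Rightarrow> 'a mat \<Rightarrow> (nat, 'a) mpoly \<Rightarrow> (nat, 'a::field) mpoly" where
  "act n A = msubst (\<lambda>j. \<Sum>i\<le>n. mconst (A $$ (i, j)) * mvar i)"

definition act_dual :: "nat \<Rightarrow> 'a mat \<Rightarrow> (nat, 'a) mpoly \<Rightarrow> (nat, 'a::field) mpoly" where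
  "act_dual n A = msubst (\<lambda>i. \<Sum>j\<le>n. mconst (the (mat_inverse A) $$ (i, j)) * mvar j)"

definition GL_equivalent ::
  "nat \<Rightarrow> nat \<Rightarrow> (nat, 'a) mpoly \<Rightarrow> (nat, 'a::field) mpoly \<Rightarrow> bool" where
  "GL_equivalent n m f g \<longleftrightarrow> f \<in> Sym n m \<and> g \<in> Sym n m \<and> (\<exists>A\<in>GL n. act_dual n A f = g)"

text \<open>Each coordinate of the value is given by a homogeneous polynomial, of a common degree, in the
  coordinates of the argument; these coordinates are indexed by the exponents of degree \<open>m\<close>.
  Covariants, contravariants and invariants are functions on all polynomials of which only the
  restriction to \<open>Sym n m\<close> matters.\<close>

definition homogeneous_polynomial_map ::
  "nat \<Rightarrow> nat \<Rightarrow> nat \<Rightarrow> ((nat, 'a) mpoly \<Rightarrow> (nat, 'a::field) mpoly) \<Rightarrow> bool" where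
  "homogeneous_polynomial_map n m e F \<longleftrightarrow>
     (\<forall>f\<in>Sym n m. F f \<in> Sym n e) \<and>
     (\<exists>\<delta>. \<forall>\<beta>\<in>exps {..n} e. \<exists>P\<in>forms (exps {..n} m) \<delta>. \<forall>f\<in>Sym n m.
        Poly_Mapping.lookup (F f) \<beta> = meval (Poly_Mapping.lookup f) P)"

definition covariant ::
  "nat \<Rightarrow> nat \<Rightarrow> nat \<Rightarrow> ((nat, 'a) mpoly \<Rightarrow> (nat, 'a::field) mpoly) \<Rightarrow> bool" where
  "covariant n m e q \<longleftrightarrow> homogeneous_polynomial_map n m e q \<and>
     (\<forall>A\<in>SL n. \<forall>f\<in>Sym n m. q (act_dual n A f) = act_dual n A (q f))"

definition contravariant ::
  "nat \<Rightarrow> nat \<Rightarrow> nat \<Rightarrow> ((nat, 'a) mpoly \<Rightarrow> (nat, 'a::field) mpoly) \<Rightarrow> bool" where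
  "contravariant n m e p \<longleftrightarrow> homogeneous_polynomial_map n m e p \<and>
     (\<forall>A\<in>SL n. \<forall>f\<in>Sym n m. p (act_dual n A f) = act n A (p f))"

definition invariant :: "nat \<Rightarrow> nat \<Rightarrow> ((nat, 'a) mpoly \<Rightarrow> 'a::field) \<Rightarrow> bool" where
  "invariant n m I \<longleftrightarrow> covariant n m 0 (\<lambda>f. mconst (I f))"

definition polynomial_in_invariants ::
  "nat \<Rightarrow> nat \<Rightarrow> ((nat, 'a) mpoly \<Rightarrow> 'a::field) \<Rightarrow> bool" where
  "polynomial_in_invariants n m c \<longleftrightarrow>
     (\<exists>N I P. (\<forall>j<N. invariant n m (I j)) \<and>
        (\<forall>\<alpha>\<in>Poly_Mapping.keys P. Poly_Mapping.keys \<alpha> \<subseteq> {..<N}) \<and>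
        (\<forall>f\<in>Sym n m. c f = meval (\<lambda>j::nat. I j f) P))"

definition lin_indep_at ::
  "nat \<Rightarrow> (nat \<Rightarrow> (nat, 'a) mpoly \<Rightarrow> (nat, 'a::field) mpoly) \<Rightarrow> (nat, 'a) mpoly \<Rightarrow> bool" where
  "lin_indep_at r q f \<longleftrightarrow>
     inj_on (\<lambda>i. q i f) {..r} \<and> mpoly.independent ((\<lambda>i. q i f) ` {..r})"

section \<open>The differential pairing\<close>

definition pdiff :: "'v \<Rightarrow> ('v, 'a) mpoly \<Rightarrow> ('v, 'a::comm_semiring_1) mpoly" where
  "pdiff i P =
     (\<Sum>\<beta>\<in>Poly_Mapping.keys P. Poly_Mapping.single (\<beta> - Poly_Mapping.single i 1)
        (of_nat (Poly_Mapping.lookup \<beta> i) * Poly_Mapping.lookup P \<beta>))"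

definition pdiffs ::
  "('v::linorder \<Rightarrow>\<^sub>0 nat) \<Rightarrow> ('v, 'a) mpoly \<Rightarrow> ('v, 'a::comm_semiring_1) mpoly" where
  "pdiffs \<alpha> = fold (\<lambda>i. pdiff i ^^ Poly_Mapping.lookup \<alpha> i)
                 (sorted_list_of_set (Poly_Mapping.keys \<alpha>))"

definition DD :: "(nat, 'a) mpoly \<Rightarrow> (nat, 'a) mpoly \<Rightarrow> (nat, 'a::field) mpoly" where
  "DD p P = (\<Sum>\<alpha>\<in>Poly_Mapping.keys p. mscale (Poly_Mapping.lookup p \<alpha>) (pdiffs \<alpha> P))"

definition DD_map ::
  "((nat, 'a) mpoly \<Rightarrow> (nat, 'a) mpoly) \<Rightarrow> ((nat, 'a) mpoly \<Rightarrow> (nat, 'a) mpoly) \<Rightarrow>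
     (nat, 'a) mpoly \<Rightarrow> (nat, 'a::field) mpoly" where
  "DD_map p q = (\<lambda>f. DD (p f) (q f))"

section \<open>The contravariants attached to a family of covariants\<close>

text \<open>The order on exponents is lexicographic with larger exponents of \<open>x\<^sub>0\<close> being larger; the list
  is decreasing, so it runs from \<open>x\<^sub>0\<^sup>d\<close> to \<open>x\<^sub>n\<^sup>d\<close>.\<close>

definition lex_exps :: "nat \<Rightarrow> nat \<Rightarrow> (nat \<Rightarrow>\<^sub>0 nat) list" where
  "lex_exps n d = rev (sorted_list_of_set (exps {..n} d))"

definition mono_basis :: "nat \<Rightarrow> nat \<Rightarrow> nat \<Rightarrow> (nat, 'a::field) mpoly" where
  "mono_basis n d i = Poly_Mapping.single (lex_exps n d ! i) 1"

definition dual_basis ::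
  "nat \<Rightarrow> nat \<Rightarrow> nat \<Rightarrow> (nat \<Rightarrow> (nat, 'a) mpoly) \<Rightarrow> nat \<Rightarrow> (nat, 'a::field) mpoly" where
  "dual_basis n d r e i =
     (THE c. c \<in> Sym n d \<and> (\<forall>j\<le>r. DD c (e j) = (if i = j then 1 else 0)))"

definition S_mat ::
  "nat \<Rightarrow> nat \<Rightarrow> nat \<Rightarrow> (nat \<Rightarrow> (nat, 'a) mpoly \<Rightarrow> (nat, 'a::field) mpoly) \<Rightarrow>
     (nat, 'a) mpoly \<Rightarrow> 'a mat" where
  "S_mat n d r q f =
     mat (r + 1) (r + 1) (\<lambda>(j, i). Poly_Mapping.lookup (q i f) (lex_exps n d ! j))"

text \<open>As a matrix of polynomial functions, \<open>\<Delta> S\<inverse>\<close> is the adjugate of \<open>S\<close>; this also makes sense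
  where \<open>\<Delta>\<close> vanishes.\<close>

definition Delta_dual ::
  "nat \<Rightarrow> nat \<Rightarrow> nat \<Rightarrow> (nat \<Rightarrow> (nat, 'a) mpoly \<Rightarrow> (nat, 'a::field) mpoly) \<Rightarrow> nat \<Rightarrow>
     (nat, 'a) mpoly \<Rightarrow> (nat, 'a) mpoly" where
  "Delta_dual n d r q i f =
     (\<Sum>j\<le>r. mscale ((adj_mat (S_mat n d r q f))\<^sup>T $$ (j, i))
                  (dual_basis n d r (mono_basis n d) j))"

text \<open>The value of the pairing in \<open>ftilde\<close> lies in \<open>Sym\<^sup>0(W*)\<close>, hence the constant coefficient.\<close>

definition ftilde ::
  "nat \<Rightarrow> nat \<Rightarrow> nat \<Rightarrow> nat \<Rightarrow> (nat \<Rightarrow> (nat, 'a) mpoly \<Rightarrow> (nat, 'a::field) mpoly) \<Rightarrow>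
     (nat, 'a) mpoly \<Rightarrow> (nat, 'a) mpoly" where
  "ftilde n k d r q f =
     (\<Sum>\<iota>\<in>{1..k} \<rightarrow>\<^sub>E {..r}.
        mscale (Poly_Mapping.lookup
                  (DD_map (\<lambda>g. \<Prod>t\<in>{1..k}. Delta_dual n d r q (\<iota> t) g) id f) 0)
               (\<Prod>t\<in>{1..k}. mvar (\<iota> t)))"

section \<open>Projective spaces\<close>

definition proj_point :: "'a::field vec \<Rightarrow> 'a vec set" where
  "proj_point v = {c \<cdot>\<^sub>v v | c. c \<noteq> 0}"

definition proj_space :: "nat \<Rightarrow> 'a::field vec set set" where
  "proj_space N = proj_point ` (carrier_vec (N + 1) - {0\<^sub>v (N + 1)})"

text \<open>The union runs over the representatives \<open>x\<close> of the point \<open>p\<close>; since the \<open>q i f\<close> have the same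
  degree, all of them give the same point.\<close>

definition phi ::
  "nat \<Rightarrow> (nat \<Rightarrow> (nat, 'a) mpoly \<Rightarrow> (nat, 'a::field) mpoly) \<Rightarrow> (nat, 'a) mpoly \<Rightarrow>
     'a vec set \<Rightarrow> 'a vec set" where
  "phi r q f p = (\<Union>x\<in>p. proj_point (vec (r + 1) (\<lambda>i. meval (\<lambda>j. x $ j) (q i f))))"

definition zero_locus :: "nat \<Rightarrow> (nat, 'a) mpoly set \<Rightarrow> 'a::field vec set set" where
  "zero_locus r E = {p \<in> proj_space r. \<forall>Q\<in>E. \<forall>y\<in>p. meval (\<lambda>i. y $ i) Q = 0}"

definition quadrics_defining_image ::
  "nat \<Rightarrow> nat \<Rightarrow> (nat \<Rightarrow> (nat, 'a) mpoly \<Rightarrow> (nat, 'a::field) mpoly) \<Rightarrow> (nat, 'a) mpoly \<Rightarrow>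
     nat \<Rightarrow> (nat \<Rightarrow> (nat, 'a) mpoly) \<Rightarrow> bool" where
  "quadrics_defining_image n r q f s Q \<longleftrightarrow>
     (\<forall>l\<le>s. Q l \<in> forms {..r} 2) \<and>
     phi r q f ` proj_space n = zero_locus r (Q ` {..s})"

end

theory Submission
  imports Defs
begin

text \<open>
  Everything rests on the matrix \<open>S(f)\<close> of the \<open>q\<^sub>i(f)\<close>, which \<open>SL\<close> multiplies from the left by the matrices
  of its representation on forms; these have determinant \<open>1\<close>, because any multiplicative function of
  matrices is determined by its values on diagonal matrices. Hence the \<open>\<Delta> q\<^sub>i\<^sup>*\<close>, which come from the
  adjugate of \<open>S(f)\<close>, are contravariants, and their contractions with \<open>f\<close> are invariants. In the same way
  the quadratic relations between the \<open>q\<^sub>i(f)\<close>, written with maximal minors by Cramer's rule, have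
  invariant coefficients; no condition on the characteristic is needed for this. They define the image of
  \<open>\<phi>\<close>, since a functional \<open>u\<close> on forms of degree \<open>d\<close> for which \<open>u(P) u(P')\<close> depends only on \<open>P P'\<close> is a
  multiple of an evaluation.

  For the reconstruction, substituting the \<open>q\<^sub>i(f)\<close> into \<open>ftilde\<close> gives back \<open>f\<close> up to a nonzero factor. If \<open>f\<close>
  and \<open>f'\<close> have the same image of \<open>\<phi>\<close>, then the linear map sending \<open>q\<^sub>i(f)\<close> to \<open>q'\<^sub>i(f')\<close> preserves the
  Veronese variety, so it is a substitution by an invertible matrix up to a factor. If they also have the same
  \<open>ftilde\<close>, this substitution carries \<open>f\<close> to a multiple of \<open>f'\<close>, and a root of the factor can be absorbed into
  the matrix.
\<close>

section \<open>Insertion of values into polynomials\<close>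

text \<open>The bound on the characteristic enters through factorials: they make the pairing
  \<open>DD\<close> perfect and let powers of linear forms test functionals, so identities for the
  pairing reduce to evaluation at points. Two demands of uniformity shape the invariant half.
  Invariance must hold on all forms, also where the q_i become dependent, so adjugates stand where
  an inverse is meant. The quadrics must be fixed before \<open>f\<close>, whereas the products q_a
  q_b that form a basis in degree 2d depend on \<open>f\<close>; hence there is one quadric for
  every choice of products, and a vanishing minor still leaves a valid relation. In the
  reconstruction \<open>R\<close> picks some form with the given data, possibly belonging to other
  covariants; the content is that the data determine the orbit. The obstacle is to extract a matrix
  from a map known only to preserve the Veronese cone, with a factor that varies from point to
  point. Along a line the image curve has degree at most d, and its coefficients of order 0 and 1
  already fix its points; they depend affinely on the direction of the line, which yields the
  matrix.\<close>

abbreviation "lk \<equiv> Poly_Mapping.lookup"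
abbreviation "ks \<equiv> Poly_Mapping.keys"
abbreviation "sgl \<equiv> Poly_Mapping.single"

definition mon :: "('v \<Rightarrow> 'b) \<Rightarrow> ('v \<Rightarrow>\<^sub>0 nat) \<Rightarrow> 'b::comm_semiring_1" where
  "mon s \<alpha> = (\<Prod>i\<in>ks \<alpha>. s i ^ lk \<alpha> i)"

lemma mon_superset: "finite V \<Longrightarrow> ks \<alpha> \<subseteq> V \<Longrightarrow> mon s \<alpha> = (\<Prod>i\<in>V. s i ^ lk \<alpha> i)"
  unfolding mon_def by (rule prod.mono_neutral_left) (auto simp: in_keys_iff)

lemma mon_add: "mon s (\<alpha> + \<beta>) = mon s \<alpha> * mon s \<beta>"
proof -
  let ?V = "ks \<alpha> \<union> ks \<beta>"
  have "mon s \<gamma> = (\<Prod>i\<in>?V. s i ^ lk \<gamma> i)" if "\<gamma> \<in> {\<alpha>, \<beta>, \<alpha> + \<beta>}" for \<gamma>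
    by (rule mon_superset) (use that Poly_Mapping.keys_add[of \<alpha> \<beta>] in auto)
  then show ?thesis by (simp add: lookup_add power_add prod.distrib)
qed

lemma mon_0 [simp]: "mon s 0 = 1"
  by (simp add: mon_def)

lemma mon_single [simp]: "mon s (sgl i k) = s i ^ k"
  by (cases "k = 0") (simp_all add: mon_def)

lemma mon_cong: "(\<And>i. i \<in> ks \<alpha> \<Longrightarrow> s i = t i) \<Longrightarrow> mon s \<alpha> = mon t \<alpha>"
  unfolding mon_def by (rule prod.cong) auto

lemma minsert_mon: "minsert h s P = (\<Sum>\<alpha>\<in>ks P. h (lk P \<alpha>) * mon s \<alpha>)"
  by (simp add: minsert_def mon_def)

lemma minsert_cong:
  "(\<And>\<alpha> i. \<alpha> \<in> ks P \<Longrightarrow> i \<in> ks \<alpha> \<Longrightarrow> s i = t i) \<Longrightarrow> minsert h s P = minsert h t P"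
  unfolding minsert_mon by (rule sum.cong[OF refl]) (metis mon_cong)

lemma poly_mapping_sum_single: "P = (\<Sum>\<alpha>\<in>ks P. sgl \<alpha> (lk P \<alpha>))"
proof (rule poly_mapping_eqI)
  fix \<beta>
  show "lk P \<beta> = lk (\<Sum>\<alpha>\<in>ks P. sgl \<alpha> (lk P \<alpha>)) \<beta>"
    by (auto simp: lookup_sum lookup_single when_def in_keys_iff)
qed

lemma poly_mapping_sum_single':
  assumes "finite S" "ks P \<subseteq> S"
  shows "P = (\<Sum>\<alpha>\<in>S. sgl \<alpha> (lk P \<alpha>))"
  by (subst poly_mapping_sum_single, rule sum.mono_neutral_left) (use assms in \<open>auto simp: in_keys_iff\<close>)

text \<open>Evaluation at a point, substitution of polynomials and restriction to a line are
  \<open>minsert\<close> for three different coefficient maps; the homomorphism laws are proved once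
  for all of them.\<close>

locale coeff_hom =
  fixes h :: "'a::comm_semiring_1 \<Rightarrow> 'b::comm_semiring_1"
  assumes h0: "h 0 = 0" and h1: "h 1 = 1"
    and hadd: "h (a + b) = h a + h b" and hmult: "h (a * b) = h a * h b"
begin

context notes [simp] = h0 h1 begin

lemma minsert_superset:
  assumes "finite S" "ks P \<subseteq> S"
  shows "minsert h s P = (\<Sum>\<alpha>\<in>S. h (lk P \<alpha>) * mon s \<alpha>)"
  unfolding minsert_mon by (rule sum.mono_neutral_left) (use assms in \<open>auto simp: in_keys_iff\<close>)

lemma minsert_0 [simp]: "minsert h s 0 = 0"
  by (simp add: minsert_mon)

lemma minsert_single [simp]: "minsert h s (sgl \<alpha> c) = h c * mon s \<alpha>"
  by (cases "c = 0") (simp_all add: minsert_mon)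

lemma minsert_mconst [simp]: "minsert h s (mconst c) = h c"
  by (simp add: mconst_def)

lemma minsert_1 [simp]: "minsert h s 1 = 1"
  using minsert_mconst[of s 1] by (simp add: mconst_hom(3))

lemma minsert_mvar [simp]: "minsert h s (mvar i) = s i"
  by (simp add: mvar_def)

lemma minsert_add: "minsert h s (P + Q) = minsert h s P + minsert h s Q"
proof -
  let ?V = "ks P \<union> ks Q"
  have "minsert h s R = (\<Sum>\<alpha>\<in>?V. h (lk R \<alpha>) * mon s \<alpha>)" if "R \<in> {P, Q, P + Q}" for R
    by (rule minsert_superset) (use that Poly_Mapping.keys_add[of P Q] in auto)
  then show ?thesis by (simp add: lookup_add hadd algebra_simps sum.distrib)
qed

lemma minsert_sum: "minsert h s (\<Sum>x\<in>A. f x) = (\<Sum>x\<in>A. minsert h s (f x))"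
  by (induction A rule: infinite_finite_induct) (simp_all add: minsert_add)

lemma minsert_mult: "minsert h s (P * Q) = minsert h s P * minsert h s Q"
proof -
  have "P * Q = (\<Sum>\<alpha>\<in>ks P. \<Sum>\<beta>\<in>ks Q. sgl (\<alpha> + \<beta>) (lk P \<alpha> * lk Q \<beta>))"
    by (subst poly_mapping_sum_single[of P], subst poly_mapping_sum_single[of Q])
      (simp add: sum_product mult_single)
  then have "minsert h s (P * Q) =
      (\<Sum>\<alpha>\<in>ks P. \<Sum>\<beta>\<in>ks Q. h (lk P \<alpha>) * mon s \<alpha> * (h (lk Q \<beta>) * mon s \<beta>))"
    by (simp add: minsert_sum hmult mon_add mult_ac)
  then show ?thesis by (simp add: minsert_mon sum_product)
qed

lemma minsert_prod: "minsert h s (\<Prod>x\<in>A. f x) = (\<Prod>x\<in>A. minsert h s (f x))"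
  by (induction A rule: infinite_finite_induct) (simp_all add: minsert_mult)

lemma minsert_power: "minsert h s (P ^ k) = minsert h s P ^ k"
  by (induction k) (simp_all add: minsert_mult)

lemma minsert_mscale: "minsert h s (mscale c P) = h c * minsert h s P"
  by (simp add: mscale_def minsert_mult)

end

end

lemma coeff_hom_id: "coeff_hom (\<lambda>c::'a::comm_semiring_1. c)"
  by (rule coeff_hom.intro) (rule refl)+

lemma coeff_hom_mconst: "coeff_hom (mconst :: 'a::comm_semiring_1 \<Rightarrow> ('v, 'a) mpoly)"
  by (rule coeff_hom.intro) (simp_all add: mconst_hom, simp add: mconst_def)

interpretation meval: coeff_hom "\<lambda>c::'a::comm_semiring_1. c"
  by (rule coeff_hom_id)

interpretation msubst: coeff_hom "mconst :: 'a::comm_semiring_1 \<Rightarrow> ('v, 'a) mpoly"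
  by (rule coeff_hom_mconst)

lemma single_eq_mon: "sgl \<alpha> c = mscale c (mon mvar \<alpha>)"
proof -
  have "mon mvar \<alpha> = sgl (\<Sum>i\<in>ks \<alpha>. sgl i (lk \<alpha> i)) (1::'b)"
  proof -
    have "mvar i ^ k = sgl (sgl i k) (1::'b)" for i :: 'a and k
    proof (induction k)
      case (Suc k)
      have "mvar i ^ Suc k = sgl (sgl i 1 + sgl i k) (1::'b)"
        unfolding power_Suc Suc by (simp add: mvar_def mult_single)
      also have "sgl i 1 + sgl i k = sgl i (Suc k)" by (simp only: single_add[symmetric]) simp
      finally show ?case .
    qed simp
    moreover have "(\<Prod>i\<in>A. sgl (g i) (1::'b)) = sgl (\<Sum>i\<in>A. g i) 1"
      for g :: "'a \<Rightarrow> 'a \<Rightarrow>\<^sub>0 nat" and A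
      by (induction A rule: infinite_finite_induct) (simp_all add: mult_single)
    ultimately show ?thesis by (simp add: mon_def)
  qed
  then show ?thesis
    by (simp only: mscale_def mconst_def mult_single poly_mapping_sum_single[symmetric]) simp
qed

lemma mpoly_sum_mon: "P = (\<Sum>\<alpha>\<in>ks P. mscale (lk P \<alpha>) (mon mvar \<alpha>))"
  by (subst poly_mapping_sum_single) (simp add: single_eq_mon)

lemma minsert_comp:
  fixes h :: "('w, 'x::comm_semiring_1) mpoly \<Rightarrow> 'y::comm_semiring_1"
  assumes "coeff_hom h" "\<And>c. h (mconst c) = g c"
  shows "h (minsert mconst t P) = minsert g (\<lambda>i. h (t i)) P"
proof -
  interpret h: coeff_hom h by fact
  note [simp] = h.h0 h.h1
  have 1: "h (\<Sum>x\<in>A. f x) = (\<Sum>x\<in>A. h (f x))" for A and f :: "'z \<Rightarrow> ('w, 'x) mpoly"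
    by (induction A rule: infinite_finite_induct) (simp_all add: h.hadd)
  have 2: "h (\<Prod>x\<in>A. f x) = (\<Prod>x\<in>A. h (f x))" for A and f :: "'z \<Rightarrow> ('w, 'x) mpoly"
    by (induction A rule: infinite_finite_induct) (simp_all add: h.hmult)
  have 3: "h (a ^ m) = h a ^ m" for a m
    by (induction m) (simp_all add: h.hmult)
  show ?thesis by (simp add: minsert_def h.hmult assms(2) 1 2 3)
qed

lemma meval_msubst: "meval x (msubst t P) = meval (\<lambda>i. meval x (t i)) P"
  by (rule minsert_comp) (unfold_locales, simp_all add: meval.minsert_add meval.minsert_mult)

lemma lookup_mscale [simp]: "lk (mscale c P) \<alpha> = c * lk P \<alpha>"
proof -
  have "mscale c P = (\<Sum>\<beta>\<in>ks P. sgl \<beta> (c * lk P \<beta>))"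
    by (subst poly_mapping_sum_single[of P])
      (simp add: mscale_def mconst_def sum_distrib_left mult_single)
  then show ?thesis
    by (auto simp: lookup_sum lookup_single when_def in_keys_iff)
qed

lemma lookup_mconst: "lk (mconst c) \<alpha> = (if \<alpha> = 0 then c else 0)"
  by (auto simp: mconst_def lookup_single when_def)

lemma mscale_mult [simp]:
  "mscale c P * Q = mscale c (P * Q)" "P * mscale c Q = mscale c (P * Q)"
  by (simp_all add: mscale_def mult_ac)

lemma mscale_prod: "(\<Prod>i\<in>A. mscale (c i) (P i)) = mscale (\<Prod>i\<in>A. c i) (\<Prod>i\<in>A. P i)"
  by (induction A rule: infinite_finite_induct) (simp_all add: mscale_def mconst_hom mult_ac)

lemma mscale_power: "mscale c P ^ m = mscale (c ^ m) (P ^ m)"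
  by (induction m) (simp_all add: mscale_def mconst_hom mult_ac)

section \<open>Forms\<close>

definition total :: "('v \<Rightarrow>\<^sub>0 nat) \<Rightarrow> nat" where
  "total \<alpha> = (\<Sum>i\<in>ks \<alpha>. lk \<alpha> i)"

lemma total_superset: "finite V \<Longrightarrow> ks \<alpha> \<subseteq> V \<Longrightarrow> total \<alpha> = (\<Sum>i\<in>V. lk \<alpha> i)"
  unfolding total_def by (rule sum.mono_neutral_left) (auto simp: in_keys_iff)

lemma total_add: "total (\<alpha> + \<beta>) = total \<alpha> + total \<beta>"
proof -
  let ?V = "ks \<alpha> \<union> ks \<beta>"
  have "total \<gamma> = (\<Sum>i\<in>?V. lk \<gamma> i)" if "\<gamma> \<in> {\<alpha>, \<beta>, \<alpha> + \<beta>}" for \<gamma>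
    by (rule total_superset) (use that Poly_Mapping.keys_add[of \<alpha> \<beta>] in auto)
  then show ?thesis by (simp add: lookup_add sum.distrib)
qed

lemma total_single [simp]: "total (sgl i k) = k"
  by (cases "k = 0") (simp_all add: total_def)

lemma total_0 [simp]: "total 0 = 0"
  by (simp add: total_def)

lemma total_eq_0_iff [simp]: "total \<alpha> = 0 \<longleftrightarrow> \<alpha> = 0"
proof
  assume "total \<alpha> = 0"
  then have "\<forall>i\<in>ks \<alpha>. lk \<alpha> i = 0" by (simp add: total_def)
  then show "\<alpha> = 0" by (auto intro!: poly_mapping_eqI simp: in_keys_iff)
qed simp

lemma exps_iff: "\<alpha> \<in> exps V m \<longleftrightarrow> ks \<alpha> \<subseteq> V \<and> total \<alpha> = m"
  by (simp add: exps_def total_def)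

lemma keys_add_nat: "ks (\<alpha> + \<beta>) = ks \<alpha> \<union> ks (\<beta> :: 'v \<Rightarrow>\<^sub>0 nat)"
  by (auto simp: in_keys_iff lookup_add)

lemma exps_add: "\<alpha> \<in> exps V m \<Longrightarrow> \<beta> \<in> exps V m' \<Longrightarrow> \<alpha> + \<beta> \<in> exps V (m + m')"
  by (auto simp: exps_iff total_add keys_add_nat)

lemma exps_0 [simp]: "exps V 0 = {0}"
  by (auto simp: exps_iff)

lemma exps_single [simp]: "sgl i m \<in> exps V m \<longleftrightarrow> i \<in> V \<or> m = 0"
  by (simp add: exps_iff)

lemma lookup_le_total: "lk \<alpha> i \<le> total \<alpha>"
  by (cases "i \<in> ks \<alpha>") (auto simp: total_def in_keys_iff intro: member_le_sum)

lemma finite_exps [simp]: assumes "finite V" shows "finite (exps V m)"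
proof (rule inj_on_finite)
  show "inj_on lk (exps V m)" by (rule inj_onI) (simp only: poly_mapping_eq_iff)
  show "lk ` exps V m \<subseteq> {f. (\<forall>i\<in>V. f i \<in> {..m}) \<and> (\<forall>i. i \<notin> V \<longrightarrow> f i = 0)}"
  proof (clarsimp simp: exps_iff)
    fix \<alpha> :: "'a \<Rightarrow>\<^sub>0 nat" assume "ks \<alpha> \<subseteq> V"
    then show "(\<forall>i\<in>V. lk \<alpha> i \<le> total \<alpha>) \<and> (\<forall>i. i \<notin> V \<longrightarrow> lk \<alpha> i = 0)"
      by (auto simp: lookup_le_total in_keys_iff)
  qed
  show "finite {f. (\<forall>i\<in>V. f i \<in> {..m}) \<and> (\<forall>i. i \<notin> V \<longrightarrow> f i = (0::nat))}"
    using finite_set_of_finite_funs[OF assms, of "{..m}" 0]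
    by (rule rev_finite_subset) auto
qed

lemma forms_iff: "P \<in> forms V m \<longleftrightarrow> (\<forall>\<alpha>. lk P \<alpha> \<noteq> 0 \<longrightarrow> \<alpha> \<in> exps V m)"
  by (auto simp: forms_def in_keys_iff)

lemma forms_lookup: "P \<in> forms V m \<Longrightarrow> \<alpha> \<notin> exps V m \<Longrightarrow> lk P \<alpha> = 0"
  by (auto simp: forms_iff)

lemma forms_eqI:
  "P \<in> forms V m \<Longrightarrow> Q \<in> forms V m \<Longrightarrow> (\<And>\<alpha>. \<alpha> \<in> exps V m \<Longrightarrow> lk P \<alpha> = lk Q \<alpha>) \<Longrightarrow> P = Q"
  by (rule poly_mapping_eqI) (metis forms_lookup)

lemma forms_0 [simp]: "0 \<in> forms V m"
  by (simp add: forms_def)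

lemma forms_add: "P \<in> forms V m \<Longrightarrow> Q \<in> forms V m \<Longrightarrow> P + Q \<in> forms V m"
  for P :: "('v, 'a::monoid_add) mpoly"
  unfolding forms_iff lookup_add by (metis add_0)

lemma forms_sum: "(\<And>i. i \<in> A \<Longrightarrow> f i \<in> forms V m) \<Longrightarrow> (\<Sum>i\<in>A. f i) \<in> forms V m"
  for f :: "'i \<Rightarrow> ('v, 'a::comm_monoid_add) mpoly"
  by (induction A rule: infinite_finite_induct) (auto intro: forms_add)

lemma forms_mscale: "P \<in> forms V m \<Longrightarrow> mscale c P \<in> forms V m"
  unfolding forms_iff lookup_mscale by (metis mult_zero_right)

lemma forms_diff: "P \<in> forms V m \<Longrightarrow> Q \<in> forms V m \<Longrightarrow> P - Q \<in> forms V m"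
  for P :: "('v, 'a::ab_group_add) mpoly"
  unfolding forms_iff lookup_minus by (metis diff_0_right)

lemma forms_single [simp]: "\<alpha> \<in> exps V m \<Longrightarrow> sgl \<alpha> c \<in> forms V m"
  by (auto simp: forms_iff lookup_single when_def)

lemma forms_mvar [simp]: "i \<in> V \<Longrightarrow> mvar i \<in> forms V 1"
  by (simp add: mvar_def)

lemma forms_mult: "P \<in> forms V m \<Longrightarrow> Q \<in> forms V m' \<Longrightarrow> P * Q \<in> forms V (m + m')"
  for P :: "('v, 'a::comm_semiring_1) mpoly"
  unfolding forms_def using Poly_Mapping.keys_mult[of P Q] exps_add by fastforce

lemma forms_1 [simp]: "1 \<in> forms V 0"
  by (simp add: forms_iff lookup_one when_def)

lemma forms_mconst [simp]: "mconst c \<in> forms V 0"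
  by (simp add: forms_iff lookup_mconst)

lemma forms_prod: "(\<And>i. i \<in> A \<Longrightarrow> f i \<in> forms V (m i)) \<Longrightarrow> (\<Prod>i\<in>A. f i) \<in> forms V (\<Sum>i\<in>A. m i)"
  for f :: "'i \<Rightarrow> ('v, 'a::comm_semiring_1) mpoly"
  by (induction A rule: infinite_finite_induct) (auto intro: forms_mult)

lemma forms_power: "P \<in> forms V m \<Longrightarrow> P ^ k \<in> forms V (k * m)"
  for P :: "('v, 'a::comm_semiring_1) mpoly"
  by (induction k) (auto intro: forms_mult)

lemma forms_sum_single: "finite V \<Longrightarrow> P \<in> forms V m \<Longrightarrow> P = (\<Sum>\<alpha>\<in>exps V m. sgl \<alpha> (lk P \<alpha>))"
  by (rule poly_mapping_sum_single') (auto simp: forms_def)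

lemma lookup_mult_forms:
  fixes P Q :: "('v, 'a::comm_semiring_1) mpoly"
  assumes "finite V" "P \<in> forms V m" "Q \<in> forms V m'"
  shows "lk (P * Q) \<gamma> = (\<Sum>\<alpha>\<in>exps V m. \<Sum>\<beta>\<in>exps V m'. if \<alpha> + \<beta> = \<gamma> then lk P \<alpha> * lk Q \<beta> else 0)"
proof -
  have "P * Q = (\<Sum>\<alpha>\<in>exps V m. sgl \<alpha> (lk P \<alpha>)) * (\<Sum>\<beta>\<in>exps V m'. sgl \<beta> (lk Q \<beta>))"
    using assms by (simp flip: forms_sum_single)
  also have "\<dots> = (\<Sum>\<alpha>\<in>exps V m. \<Sum>\<beta>\<in>exps V m'. sgl (\<alpha> + \<beta>) (lk P \<alpha> * lk Q \<beta>))"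
    by (simp add: sum_product mult_single)
  finally show ?thesis by (simp add: lookup_sum lookup_single when_def)
qed

lemma (in coeff_hom) minsert_forms:
  "finite V \<Longrightarrow> P \<in> forms V m \<Longrightarrow> minsert h s P = (\<Sum>\<alpha>\<in>exps V m. h (lk P \<alpha>) * mon s \<alpha>)"
  by (rule minsert_superset) (auto simp: forms_def)

lemma mon_scaled: "mon (\<lambda>i. u * s i) \<alpha> = u ^ total \<alpha> * mon s \<alpha>"
  by (simp add: mon_def total_def power_mult_distrib prod.distrib power_sum)

lemma (in coeff_hom) minsert_scaled:
  "P \<in> forms V m \<Longrightarrow> minsert h (\<lambda>i. u * s i) P = u ^ m * minsert h s P"
  unfolding minsert_mon sum_distrib_left
  by (rule sum.cong) (auto simp: mon_scaled forms_def exps_iff mult_ac)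

lemma minsert_forms_cong:
  "P \<in> forms V m \<Longrightarrow> (\<And>i. i \<in> V \<Longrightarrow> s i = t i) \<Longrightarrow> minsert h s P = minsert h t P"
  by (rule minsert_cong) (auto simp: forms_def exps_iff subset_iff)

text \<open>Induction along the ring structure, made for properties governed by a product rule. Sums
  and products of arbitrary polynomials occur on the way, so \<open>T\<close> must make sense
  without a degree.\<close>

lemma mpoly_induct_forms [consumes 1, case_names const var add mult]:
  fixes P :: "('v, 'a::comm_semiring_1) mpoly"
  assumes "P \<in> forms V m" and "\<And>c. T (mconst c)" "\<And>i. i \<in> V \<Longrightarrow> T (mvar i)"
    and "\<And>P Q. T P \<Longrightarrow> T Q \<Longrightarrow> T (P + Q)" "\<And>P Q. T P \<Longrightarrow> T Q \<Longrightarrow> T (P * Q)"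
  shows "T P"
proof -
  have 1: "T 1" using assms(2)[of 1] by (simp add: mconst_hom)
  have 0: "T 0" using assms(2)[of 0] by (simp add: mconst_def)
  have pw: "T (mvar i ^ e)" if "i \<in> V" for i e
    by (induction e) (use 1 assms(3,5) that in auto)
  have "T (\<Prod>i\<in>A. mvar i ^ e i)" if "A \<subseteq> V" for A and e
    using that by (induction A rule: infinite_finite_induct) (use 1 assms(5) pw in auto)
  then have "T (mon mvar \<alpha>)" if "\<alpha> \<in> ks P" for \<alpha>
    using assms(1) that by (auto simp: mon_def forms_def exps_iff)
  then have "T (\<Sum>\<alpha>\<in>A. mscale (lk P \<alpha>) (mon mvar \<alpha>))" if "A \<subseteq> ks P" for A
    using that by (induction A rule: infinite_finite_induct)
      (use 0 assms(2,4,5) in \<open>auto simp: mscale_def\<close>)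
  from this[OF subset_refl] show ?thesis by (subst mpoly_sum_mon)
qed

section \<open>Polynomial functions over infinite fields\<close>

text \<open>Euclid's argument: over a finite field, 1 plus the product of all X - a has positive
  degree and no root.\<close>

lemma infinite_UNIV_alg_closed: "infinite (UNIV :: 'a::alg_closed_field set)"
proof
  assume fin: "finite (UNIV :: 'a set)"
  define p :: "'a poly" where "p = (\<Prod>a\<in>UNIV. [:- a, 1:]) + 1"
  have "degree (\<Prod>a\<in>(UNIV::'a set). [:- a, 1:]) = card (UNIV :: 'a set)"
    by (subst degree_prod_eq_sum_degree) auto
  moreover have "card (UNIV :: 'a set) > 0" using fin by (simp add: card_gt_0_iff)
  ultimately have "degree p > 0"
    unfolding p_def by (subst degree_add_eq_left) auto
  then obtain x where "poly p x = 0" using alg_closed_imp_poly_has_root by blast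
  moreover have "poly (\<Prod>a\<in>UNIV. [:- a, 1:]) x = 0"
    using fin by (simp add: poly_prod prod_zero_iff)
  ultimately show False by (simp add: p_def)
qed

lemma poly_eqI_infinite:
  fixes p q :: "'a::idom poly"
  assumes "infinite A" "\<And>x. x \<in> A \<Longrightarrow> poly p x = poly q x"
  shows "p = q"
proof (rule ccontr)
  assume "p \<noteq> q"
  then have "finite {x. poly (p - q) x = 0}" by (intro poly_roots_finite) simp
  then have "finite A" by (rule rev_finite_subset) (use assms in auto)
  with assms show False by simp
qed

text \<open>Uniqueness of digits in base \<open>B\<close>: the lower digits sum to less than the
  leading power, so division by that power reads off the top digit.\<close>

lemma sum_digits_inj:
  fixes a b :: "nat \<Rightarrow> nat"
  assumes "\<And>i. i \<le> n \<Longrightarrow> a i < B" "\<And>i. i \<le> n \<Longrightarrow> b i < B"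
    and "(\<Sum>i\<le>n. a i * B ^ i) = (\<Sum>i\<le>n. b i * B ^ i)"
  shows "\<forall>i\<le>n. a i = b i"
  using assms
proof (induction n)
  case (Suc n)
  have lt: "(\<Sum>i\<le>n. c i * B ^ i) < B ^ Suc n" if "\<And>i. i \<le> n \<Longrightarrow> c i < B" for c :: "nat \<Rightarrow> nat" and n
    using that
  proof (induction n)
    case (Suc n)
    have "(\<Sum>i\<le>Suc n. c i * B ^ i) < B ^ Suc n + c (Suc n) * B ^ Suc n"
      using Suc by simp
    also have "\<dots> = (c (Suc n) + 1) * B ^ Suc n" by simp
    also have "\<dots> \<le> B * B ^ Suc n" using Suc.prems[of "Suc n"] by (intro mult_right_mono) auto
    finally show ?case by simp
  qed auto
  let ?A = "\<Sum>i\<le>n. a i * B ^ i" and ?B = "\<Sum>i\<le>n. b i * B ^ i"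
  have l: "?A < B ^ Suc n" "?B < B ^ Suc n" by (rule lt, simp add: Suc.prems)+
  have e: "?A + a (Suc n) * B ^ Suc n = ?B + b (Suc n) * B ^ Suc n" using Suc.prems(3) by simp
  have dv: "(x + c * y) div y = c" if "x < y" for x c y :: nat
    using that by (subst div_mult_self1) auto
  have "(?A + a (Suc n) * B ^ Suc n) div B ^ Suc n = a (Suc n)"
    "(?B + b (Suc n) * B ^ Suc n) div B ^ Suc n = b (Suc n)"
    using l by (simp_all only: dv)
  with e have "a (Suc n) = b (Suc n)" by simp
  with e have "?A = ?B" by simp
  with Suc have "\<forall>i\<le>n. a i = b i" by simp
  with \<open>a (Suc n) = b (Suc n)\<close> show ?case by (auto simp: le_Suc_eq)
qed auto

text \<open>Kronecker substitution \<open>x\<^sub>i = t ^ (m + 1) ^ i\<close> separates the monomials of degree \<open>m\<close>.\<close>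

lemma forms_eq_0I:
  fixes P :: "(nat, 'a::idom) mpoly"
  assumes inf: "infinite (UNIV :: 'a set)" and P: "P \<in> Sym n m" and z: "\<And>x. meval x P = 0"
  shows "P = 0"
proof -
  define w :: "(nat \<Rightarrow>\<^sub>0 nat) \<Rightarrow> nat" where "w \<alpha> = (\<Sum>i\<le>n. lk \<alpha> i * (m + 1) ^ i)" for \<alpha>
  have inj: "inj_on w (exps {..n} m)"
  proof (rule inj_onI)
    fix \<alpha> \<beta> assume A: "\<alpha> \<in> exps {..n} m" "\<beta> \<in> exps {..n} m" "w \<alpha> = w \<beta>"
    have "\<forall>i\<le>n. lk \<alpha> i = lk \<beta> i"
    proof (rule sum_digits_inj[of n _ "m + 1"])
      show "lk \<alpha> i < m + 1" "lk \<beta> i < m + 1" for i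
        using A lookup_le_total[of \<alpha> i] lookup_le_total[of \<beta> i] by (auto simp: exps_iff)
      show "(\<Sum>i\<le>n. lk \<alpha> i * (m + 1) ^ i) = (\<Sum>i\<le>n. lk \<beta> i * (m + 1) ^ i)"
        using A by (simp add: w_def)
    qed
    moreover have "lk \<alpha> i = 0 \<and> lk \<beta> i = 0" if "i > n" for i
    proof -
      have "i \<notin> ks \<alpha>" "i \<notin> ks \<beta>" using A that by (auto simp: exps_iff)
      then show ?thesis by (simp add: in_keys_iff)
    qed
    ultimately show "\<alpha> = \<beta>" by (intro poly_mapping_eqI) (metis not_le)
  qed
  define p where "p = (\<Sum>\<alpha>\<in>exps {..n} m. Polynomial.monom (lk P \<alpha>) (w \<alpha>))"
  have "poly p t = 0" for t
  proof -
    have "mon (\<lambda>i. t ^ (m + 1) ^ i) \<alpha> = t ^ w \<alpha>" if "\<alpha> \<in> exps {..n} m" for \<alpha>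
      using that
      by (subst mon_superset[of "{..n}" \<alpha>]) (simp_all add: exps_iff w_def power_sum mult.commute flip: power_mult)
    then have "poly p t = meval (\<lambda>i. t ^ (m + 1) ^ i) P"
      using meval.minsert_forms[OF _ P] by (simp add: p_def poly_sum poly_monom)
    then show ?thesis using z by simp
  qed
  then have "p = 0" using poly_eqI_infinite[OF inf, of p 0] by simp
  show "P = 0"
  proof (rule forms_eqI[OF P])
    fix \<alpha> assume \<alpha>: "\<alpha> \<in> exps {..n} m"
    have "Polynomial.coeff p (w \<alpha>) = (\<Sum>\<beta>\<in>exps {..n} m. if \<beta> = \<alpha> then lk P \<beta> else 0)"
      unfolding p_def coeff_sum by (rule sum.cong) (use \<alpha> inj in \<open>auto dest: inj_onD\<close>)
    with \<alpha> show "lk P \<alpha> = lk 0 \<alpha>" by (simp add: \<open>p = 0\<close>)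
  qed auto
qed

lemma forms_eqI_meval:
  fixes P :: "(nat, 'a::idom) mpoly"
  assumes "infinite (UNIV :: 'a set)" "P \<in> Sym n m" "Q \<in> Sym n m" "\<And>x. meval x P = meval x Q"
  shows "P = Q"
proof -
  have "meval x (P - Q) = 0" for x
    using meval.minsert_add[of x "P - Q" Q] assms(4)[of x] by simp
  then show ?thesis using forms_eq_0I[OF assms(1) forms_diff[OF assms(2,3)]] by simp
qed

abbreviation "Exps n m \<equiv> exps {..n::nat} m"

section \<open>Linear substitutions\<close>

text \<open>Precomposition of polynomial functions with \<open>B\<close>, hence product-reversing.
  \<open>act_dual\<close> is the case of the inverse matrix, \<open>act\<close> that of the
  transpose.\<close>

definition mat_subst :: "nat \<Rightarrow> 'a mat \<Rightarrow> (nat, 'a) mpoly \<Rightarrow> (nat, 'a::field) mpoly" where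
  "mat_subst n B = msubst (\<lambda>i. \<Sum>j\<le>n. mconst (B $$ (i, j)) * mvar j)"

definition mat_pt :: "nat \<Rightarrow> 'a mat \<Rightarrow> (nat \<Rightarrow> 'a) \<Rightarrow> nat \<Rightarrow> 'a::field" where
  "mat_pt n B x i = (\<Sum>j\<le>n. B $$ (i, j) * x j)"

abbreviation inv_mat :: "'a::field mat \<Rightarrow> 'a mat" where
  "inv_mat A \<equiv> the (mat_inverse A)"

lemma act_dual_eq: "act_dual n A = mat_subst n (inv_mat A)"
  by (simp add: act_dual_def mat_subst_def)

lemma meval_mat_subst: "meval x (mat_subst n B P) = meval (mat_pt n B x) P"
  by (simp add: mat_subst_def meval_msubst meval.minsert_sum meval.minsert_mult mat_pt_def[abs_def]
    meval.minsert_mconst meval.minsert_mvar)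

lemma msubst_forms:
  assumes "P \<in> forms U m" "\<And>i. i \<in> U \<Longrightarrow> t i \<in> forms V 1"
  shows "msubst t P \<in> forms V m"
  unfolding minsert_mon
proof (rule forms_sum)
  fix \<alpha> assume \<alpha>: "\<alpha> \<in> ks P"
  then have U: "ks \<alpha> \<subseteq> U" "total \<alpha> = m" using assms(1) unfolding forms_def by (force simp: exps_iff)+
  have "(\<Prod>i\<in>ks \<alpha>. t i ^ lk \<alpha> i) \<in> forms V (\<Sum>i\<in>ks \<alpha>. lk \<alpha> i * 1)"
    by (intro forms_prod forms_power assms(2)) (use U in auto)
  then have "mscale (lk P \<alpha>) (mon t \<alpha>) \<in> forms V m"
    using U by (intro forms_mscale) (simp add: mon_def total_def)
  then show "mconst (lk P \<alpha>) * mon t \<alpha> \<in> forms V m" by (simp add: mscale_def)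
qed

lemma mat_subst_forms: "P \<in> Sym n m \<Longrightarrow> mat_subst n B P \<in> Sym n m"
  unfolding mat_subst_def
  by (erule msubst_forms) (auto intro!: forms_sum forms_mscale forms_mvar[unfolded One_nat_def] simp flip: mscale_def)

lemma mat_subst_mult: "mat_subst n B (P * Q) = mat_subst n B P * mat_subst n B Q"
  by (simp add: mat_subst_def msubst.minsert_mult)

lemma mat_subst_power: "mat_subst n B (P ^ k) = mat_subst n B P ^ k"
  by (simp add: mat_subst_def msubst.minsert_power)

lemma mat_subst_sum: "mat_subst n B (\<Sum>x\<in>A. f x) = (\<Sum>x\<in>A. mat_subst n B (f x))"
  by (simp add: mat_subst_def msubst.minsert_sum)

lemma mat_subst_prod: "mat_subst n B (\<Prod>x\<in>A. f x) = (\<Prod>x\<in>A. mat_subst n B (f x))"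
  by (simp add: mat_subst_def msubst.minsert_prod)

lemma mat_subst_mscale: "mat_subst n B (mscale c P) = mscale c (mat_subst n B P)"
  by (simp add: mat_subst_def msubst.minsert_mscale) (simp add: mscale_def)

lemma mat_subst_mconst: "mat_subst n B (mconst c) = mconst c"
  by (simp add: mat_subst_def msubst.minsert_mconst)

lemma mat_pt_mult:
  assumes "A \<in> carrier_mat (n + 1) (n + 1)" "B \<in> carrier_mat (n + 1) (n + 1)" "i \<le> n"
  shows "mat_pt n (A * B) x i = mat_pt n A (mat_pt n B x) i"
proof -
  have "(A * B) $$ (i, j) = (\<Sum>l\<le>n. A $$ (i, l) * B $$ (l, j))" if "j \<le> n" for j
    using assms that by (simp add: scalar_prod_def atLeast0LessThan lessThan_Suc_atMost)
  then have "mat_pt n (A * B) x i = (\<Sum>j\<le>n. \<Sum>l\<le>n. A $$ (i, l) * (B $$ (l, j) * x j))"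
    by (simp add: mat_pt_def sum_distrib_right mult.assoc)
  also have "\<dots> = (\<Sum>l\<le>n. \<Sum>j\<le>n. A $$ (i, l) * (B $$ (l, j) * x j))"
    by (rule sum.swap)
  finally show ?thesis by (simp add: mat_pt_def sum_distrib_left)
qed

lemma mat_pt_one: "i \<le> n \<Longrightarrow> mat_pt n (1\<^sub>m (n + 1)) x i = x i"
  by (simp add: mat_pt_def if_distrib[of "\<lambda>c. c * _"] cong: if_cong)

lemma meval_Sym_cong: "P \<in> Sym n m \<Longrightarrow> (\<And>i. i \<le> n \<Longrightarrow> x i = y i) \<Longrightarrow> meval x P = meval y P"
  by (erule minsert_forms_cong) auto

lemma meval_mat_pt_mult:
  assumes "A \<in> carrier_mat (n + 1) (n + 1)" "B \<in> carrier_mat (n + 1) (n + 1)" "P \<in> Sym n m"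
  shows "meval (mat_pt n (A * B) x) P = meval (mat_pt n A (mat_pt n B x)) P"
  by (rule meval_Sym_cong[OF assms(3)]) (use assms mat_pt_mult in auto)

lemma mat_subst_comp:
  fixes P :: "(nat, 'a::field) mpoly"
  assumes "infinite (UNIV :: 'a set)"
    "A \<in> carrier_mat (n + 1) (n + 1)" "B \<in> carrier_mat (n + 1) (n + 1)" "P \<in> Sym n m"
  shows "mat_subst n (A * B) P = mat_subst n B (mat_subst n A P)"
  by (rule forms_eqI_meval[OF assms(1), of _ n m])
    (use assms in \<open>simp_all add: mat_subst_forms meval_mat_subst meval_mat_pt_mult\<close>)

lemma mat_subst_one:
  fixes P :: "(nat, 'a::field) mpoly"
  assumes "infinite (UNIV :: 'a set)" "P \<in> Sym n m"
  shows "mat_subst n (1\<^sub>m (n + 1)) P = P"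
  by (rule forms_eqI_meval[OF assms(1), of _ n m])
    (use assms mat_pt_one in \<open>auto simp: mat_subst_forms meval_mat_subst intro!: meval_Sym_cong\<close>)

lemma inv_mat_props:
  fixes A :: "'a::field mat"
  assumes "A \<in> carrier_mat N N" "det A \<noteq> 0"
  shows "inv_mat A \<in> carrier_mat N N" "A * inv_mat A = 1\<^sub>m N" "inv_mat A * A = 1\<^sub>m N"
    "det (inv_mat A) = inverse (det A)"
proof -
  have "A \<in> Units (ring_mat TYPE('a) N ())" using det_non_zero_imp_unit[OF assms] .
  then obtain B where B: "mat_inverse A = Some B"
    using mat_inverse(1)[OF assms(1)] by (meson not_None_eq)
  from mat_inverse(2)[OF assms(1) this]
  show *: "inv_mat A \<in> carrier_mat N N" "A * inv_mat A = 1\<^sub>m N" "inv_mat A * A = 1\<^sub>m N"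
    using B by auto
  have "det A * det (inv_mat A) = 1" using det_mult[OF assms(1) *(1)] *(2) by simp
  then show "det (inv_mat A) = inverse (det A)" using assms(2) by (simp add: field_simps)
qed

lemma GL_I: "A \<in> carrier_mat (n + 1) (n + 1) \<Longrightarrow> det A \<noteq> 0 \<Longrightarrow> A \<in> GL n"
  using inv_mat_props[of A "n + 1"]
  unfolding GL_def invertible_mat_def inverts_mat_def by (auto intro!: exI[of _ "inv_mat A"])

lemma SL_D: "A \<in> SL n \<Longrightarrow> A \<in> carrier_mat (n + 1) (n + 1)" "A \<in> SL n \<Longrightarrow> det A = 1"
  by (auto simp: SL_def)

section \<open>The apolar pairing\<close>

definition mfact :: "('v \<Rightarrow>\<^sub>0 nat) \<Rightarrow> nat" where
  "mfact \<alpha> = (\<Prod>i\<in>ks \<alpha>. fact (lk \<alpha> i))"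

lemma mfact_superset: "finite V \<Longrightarrow> ks \<alpha> \<subseteq> V \<Longrightarrow> mfact \<alpha> = (\<Prod>i\<in>V. fact (lk \<alpha> i))"
  unfolding mfact_def by (rule prod.mono_neutral_left) (auto simp: in_keys_iff)

lemma mfact_minus:
  assumes "lk \<alpha> i > 0"
  shows "mfact \<alpha> = lk \<alpha> i * mfact (\<alpha> - sgl i 1)"
proof -
  have i: "i \<in> ks \<alpha>" using assms by (simp add: in_keys_iff)
  have "ks (\<alpha> - sgl i 1) \<subseteq> ks \<alpha>" by (auto simp: in_keys_iff lookup_minus)
  then have "mfact (\<alpha> - sgl i 1) = (\<Prod>j\<in>ks \<alpha>. fact (lk (\<alpha> - sgl i 1) j))"
    by (intro mfact_superset) auto
  also have "\<dots> = fact (lk \<alpha> i - 1) * (\<Prod>j\<in>ks \<alpha> - {i}. fact (lk \<alpha> j))"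
    by (subst prod.remove[of _ i])
      (use i in \<open>auto simp: lookup_minus lookup_single when_def intro!: prod.cong split: if_splits\<close>)
  finally show ?thesis
    unfolding mfact_def using i fact_reduce[OF assms, where 'a = nat] by (subst prod.remove[of _ i]) auto
qed

lemma mfact_nonzero:
  assumes "(of_nat (fact m) :: 'a::field) \<noteq> 0" "total \<alpha> \<le> m"
  shows "(of_nat (mfact \<alpha>) :: 'a) \<noteq> 0"
proof -
  have "(of_nat (fact (lk \<alpha> i)) :: 'a) \<noteq> 0" for i
  proof -
    have "lk \<alpha> i \<le> m" using lookup_le_total[of \<alpha> i] assms(2) by simp
    then obtain c where "fact m = fact (lk \<alpha> i) * (c::nat)" by (meson fact_dvd dvdE)
    with assms(1) show ?thesis by auto
  qed
  then show ?thesis by (simp add: mfact_def of_nat_prod)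
qed

text \<open>A prime that divides m! is at most m.\<close>

lemma fact_nonzero_CHAR:
  assumes "CHAR('a::field) = 0 \<or> CHAR('a) > m"
  shows "(of_nat (fact m) :: 'a) \<noteq> 0"
proof
  assume "(of_nat (fact m) :: 'a) = 0"
  then have d: "CHAR('a) dvd fact m" by (simp only: of_nat_eq_0_iff_char_dvd)
  then have "CHAR('a) \<noteq> 0" by (metis dvd_0_left fact_nonzero)
  moreover from this have "prime (CHAR('a))" by (intro prime_CHAR_semidom) simp
  ultimately show False using d assms prime_dvd_fact_iff by auto
qed

text \<open>The scalar value of \<open>DD\<close> in equal degrees; the weight of a monomial is the
  result of differentiating it by itself.\<close>

definition pairing :: "nat \<Rightarrow> nat \<Rightarrow> (nat, 'a) mpoly \<Rightarrow> (nat, 'a) mpoly \<Rightarrow> 'a::field" where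
  "pairing n m p f = (\<Sum>\<alpha>\<in>Exps n m. of_nat (mfact \<alpha>) * lk p \<alpha> * lk f \<alpha>)"

lemma lookup_pdiff: "lk (pdiff i P) \<gamma> = of_nat (lk \<gamma> i + 1) * lk P (\<gamma> + sgl i 1)"
proof -
  \<comment> \<open>Subtraction of exponents is truncated, so \<open>i\<close> has to occur in
    \<beta>; the remaining terms carry the factor 0.\<close>
  have eq: "\<beta> - sgl i 1 = \<gamma> \<longleftrightarrow> \<beta> = \<gamma> + sgl i 1" if "lk \<beta> i \<noteq> 0" for \<beta>
  proof
    assume "\<beta> - sgl i 1 = \<gamma>"
    with that show "\<beta> = \<gamma> + sgl i 1"
      by (intro poly_mapping_eqI) (auto simp: lookup_add lookup_minus lookup_single when_def)
  next
    assume "\<beta> = \<gamma> + sgl i 1"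
    then show "\<beta> - sgl i 1 = \<gamma>" by simp
  qed
  have "lk (pdiff i P) \<gamma> =
      (\<Sum>\<beta>\<in>ks P. if \<beta> - sgl i 1 = \<gamma> then of_nat (lk \<beta> i) * lk P \<beta> else 0)"
    by (simp add: pdiff_def lookup_sum lookup_single when_def)
  also have "\<dots> = (\<Sum>\<beta>\<in>ks P. if \<beta> = \<gamma> + sgl i 1 then of_nat (lk \<beta> i) * lk P \<beta> else 0)"
  proof (rule sum.cong[OF refl])
    fix \<beta>
    show "(if \<beta> - sgl i 1 = \<gamma> then of_nat (lk \<beta> i) * lk P \<beta> else 0) =
        (if \<beta> = \<gamma> + sgl i 1 then of_nat (lk \<beta> i) * lk P \<beta> else 0)"
    proof (cases "lk \<beta> i = 0")
      case False
      then show ?thesis by (simp only: eq[OF False])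
    qed simp
  qed
  also have "\<dots> = of_nat (lk \<gamma> i + 1) * lk P (\<gamma> + sgl i 1)"
    by (simp add: in_keys_iff lookup_add)
  finally show ?thesis .
qed

lemma lookup_pdiff_power:
  "lk ((pdiff i ^^ e) P) \<gamma> = of_nat (pochhammer (lk \<gamma> i + 1) e) * lk P (\<gamma> + sgl i e)"
proof (induction e arbitrary: \<gamma>)
  case (Suc e)
  have 1: "\<gamma> + sgl i 1 + sgl i e = \<gamma> + sgl i (Suc e)"
    using single_add[of i 1 e] by (simp add: add.assoc)
  have 2: "lk (\<gamma> + sgl i 1) i + 1 = lk \<gamma> i + 1 + 1" by (simp add: lookup_add)
  have "lk ((pdiff i ^^ Suc e) P) \<gamma> =
      of_nat (lk \<gamma> i + 1) * (of_nat (pochhammer (lk \<gamma> i + 1 + 1) e) * lk P (\<gamma> + sgl i (Suc e)))"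
    by (simp only: funpow.simps o_apply lookup_pdiff Suc 1 2)
  also have "\<dots> = of_nat (pochhammer (lk \<gamma> i + 1) (Suc e)) * lk P (\<gamma> + sgl i (Suc e))"
    by (simp only: pochhammer_rec of_nat_mult mult.assoc)
  finally show ?case .
qed simp

lemma lookup_fold_pdiff:
  assumes "distinct xs"
  shows "lk (fold (\<lambda>i. pdiff i ^^ lk \<alpha> i) xs P) \<gamma> =
    of_nat (\<Prod>i\<in>set xs. pochhammer (lk \<gamma> i + 1) (lk \<alpha> i)) * lk P (\<gamma> + (\<Sum>i\<in>set xs. sgl i (lk \<alpha> i)))"
  using assms
proof (induction xs arbitrary: P)
  case (Cons x xs)
  let ?s = "\<Sum>i\<in>set xs. sgl i (lk \<alpha> i)"
  \<comment> \<open>The other variables leave the exponent of \<open>x\<close> alone, so the rising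
    factorials do not interact.\<close>
  have "lk ?s x = 0" using Cons.prems by (simp add: lookup_sum lookup_single when_def)
  then have *: "lk (\<gamma> + ?s) x + 1 = lk \<gamma> x + 1" by (simp add: lookup_add)
  have **: "\<gamma> + ?s + sgl x (lk \<alpha> x) = \<gamma> + (\<Sum>i\<in>set (x # xs). sgl i (lk \<alpha> i))"
    using Cons.prems by (simp add: add_ac)
  have "lk (fold (\<lambda>i. pdiff i ^^ lk \<alpha> i) (x # xs) P) \<gamma> =
     of_nat (\<Prod>i\<in>set xs. pochhammer (lk \<gamma> i + 1) (lk \<alpha> i)) *
      (of_nat (pochhammer (lk \<gamma> x + 1) (lk \<alpha> x)) * lk P (\<gamma> + (\<Sum>i\<in>set (x # xs). sgl i (lk \<alpha> i))))"
    using Cons by (simp only: fold_simps o_apply distinct.simps lookup_pdiff_power * **)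
  then show ?case using Cons.prems by (simp add: mult_ac)
qed simp

lemma lookup_pdiffs:
  "lk (pdiffs \<alpha> P) \<gamma> =
    of_nat (\<Prod>i\<in>ks \<alpha>. pochhammer (lk \<gamma> i + 1) (lk \<alpha> i)) * lk P (\<gamma> + \<alpha>)"
  unfolding pdiffs_def by (subst lookup_fold_pdiff) (simp_all flip: poly_mapping_sum_single)

lemma lookup_pdiffs_0: "lk (pdiffs \<alpha> P) 0 = of_nat (mfact \<alpha>) * lk P \<alpha>"
  by (simp add: lookup_pdiffs mfact_def pochhammer_fact)

text \<open>Comparison of total degrees leaves only the constant coefficient.\<close>

lemma DD_eq_pairing:
  assumes "p \<in> Sym n m" "P \<in> Sym n m"
  shows "DD p P = mconst (pairing n m p P)"
proof (rule poly_mapping_eqI)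
  fix \<gamma>
  have ks: "ks p \<subseteq> Exps n m" using assms(1) by (simp add: forms_def)
  have "lk (DD p P) \<gamma> = (\<Sum>\<alpha>\<in>ks p. lk p \<alpha> * lk (pdiffs \<alpha> P) \<gamma>)"
    by (simp add: DD_def lookup_sum)
  also have "\<dots> = (\<Sum>\<alpha>\<in>Exps n m. lk p \<alpha> * lk (pdiffs \<alpha> P) \<gamma>)"
    by (rule sum.mono_neutral_left) (use ks in \<open>auto simp: in_keys_iff\<close>)
  also have "\<dots> = lk (mconst (pairing n m p P)) \<gamma>"
  proof (cases "\<gamma> = 0")
    case True
    then show ?thesis by (simp add: lookup_pdiffs_0 lookup_mconst pairing_def mult_ac)
  next
    case False
    have "lk P (\<gamma> + \<alpha>) = 0" if "\<alpha> \<in> Exps n m" for \<alpha>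
      by (rule forms_lookup[OF assms(2)]) (use that False in \<open>auto simp: exps_iff total_add\<close>)
    then show ?thesis using False by (simp add: lookup_pdiffs lookup_mconst)
  qed
  finally show "lk (DD p P) \<gamma> = lk (mconst (pairing n m p P)) \<gamma>" .
qed

lemma pairing_add_left: "pairing n m (p + p') f = pairing n m p f + pairing n m p' f"
  by (simp add: pairing_def lookup_add algebra_simps sum.distrib)

lemma pairing_mscale_left: "pairing n m (mscale c p) f = c * pairing n m p f"
  by (simp add: pairing_def sum_distrib_left mult_ac)

lemma pairing_sum_left: "pairing n m (\<Sum>x\<in>A. p x) f = (\<Sum>x\<in>A. pairing n m (p x) f)"
  by (induction A rule: infinite_finite_induct) (simp_all add: pairing_add_left, simp_all add: pairing_def)

lemma pairing_single_right:
  "\<alpha> \<in> Exps n m \<Longrightarrow> pairing n m p (sgl \<alpha> c) = of_nat (mfact \<alpha>) * lk p \<alpha> * c"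
  by (simp add: pairing_def lookup_single when_def if_distrib[of "\<lambda>c. _ * c"] cong: if_cong)

text \<open>Nondegeneracy: pairing with a monomial reads off a coefficient up to a factorial, which
  is invertible.\<close>

lemma pairing_eqI:
  fixes p p' :: "(nat, 'a::field) mpoly"
  assumes "(of_nat (fact m) :: 'a) \<noteq> 0" "p \<in> Sym n m" "p' \<in> Sym n m"
    and eq: "\<And>g. g \<in> Sym n m \<Longrightarrow> pairing n m p g = pairing n m p' g"
  shows "p = p'"
proof (rule forms_eqI[OF assms(2,3)])
  fix \<alpha> assume \<alpha>: "\<alpha> \<in> Exps n m"
  then have "(of_nat (mfact \<alpha>) :: 'a) \<noteq> 0" by (intro mfact_nonzero[OF assms(1)]) (simp add: exps_iff)
  with eq[of "sgl \<alpha> 1"] \<alpha> show "lk p \<alpha> = lk p' \<alpha>" by (simp add: pairing_single_right)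
qed

section \<open>Powers of linear forms and invariance of the pairing\<close>

definition lin_form :: "nat \<Rightarrow> (nat \<Rightarrow> 'a) \<Rightarrow> (nat, 'a::field) mpoly" where
  "lin_form n a = (\<Sum>i\<le>n. mscale (a i) (mvar i))"

lemma lin_form_forms: "lin_form n a \<in> Sym n 1"
  by (auto simp: lin_form_def intro!: forms_sum forms_mscale forms_mvar[unfolded One_nat_def])

lemma lin_form_power_forms: "lin_form n a ^ m \<in> Sym n m"
  using forms_power[OF lin_form_forms, of n a m] by simp

lemma lookup_mvar_mult:
  fixes P :: "('v, 'a::comm_semiring_1) mpoly"
  shows "lk (mvar i * P) \<alpha> = (if lk \<alpha> i = 0 then 0 else lk P (\<alpha> - sgl i 1))"
proof -
  have "mvar i * P = (\<Sum>\<beta>\<in>ks P. sgl (sgl i 1 + \<beta>) (lk P \<beta>))"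
    by (subst poly_mapping_sum_single[of P]) (simp add: mvar_def sum_distrib_left mult_single)
  then have "lk (mvar i * P) \<alpha> = (\<Sum>\<beta>\<in>ks P. if sgl i 1 + \<beta> = \<alpha> then lk P \<beta> else 0)"
    by (simp add: lookup_sum lookup_single when_def)
  also have "\<dots> = (\<Sum>\<beta>\<in>ks P. if \<beta> = \<alpha> - sgl i 1 then (if lk \<alpha> i = 0 then 0 else lk P \<beta>) else 0)"
  proof (rule sum.cong[OF refl])
    fix \<beta>
    have "sgl i 1 + \<beta> = \<alpha> \<longleftrightarrow> \<beta> = \<alpha> - sgl i 1 \<and> lk \<alpha> i \<noteq> 0"
    proof
      assume "\<beta> = \<alpha> - sgl i 1 \<and> lk \<alpha> i \<noteq> 0"
      then show "sgl i 1 + \<beta> = \<alpha>"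
        by (intro poly_mapping_eqI) (auto simp: lookup_add lookup_minus lookup_single when_def)
    qed (auto simp: lookup_add)
    then show "(if sgl i 1 + \<beta> = \<alpha> then lk P \<beta> else 0) =
        (if \<beta> = \<alpha> - sgl i 1 then (if lk \<alpha> i = 0 then 0 else lk P \<beta>) else 0)" by simp
  qed
  also have "\<dots> = (if lk \<alpha> i = 0 then 0 else lk P (\<alpha> - sgl i 1))"
    by (simp add: in_keys_iff)
  finally show ?thesis .
qed

text \<open>The multinomial theorem with denominators cleared, valid in every characteristic.
  Splitting off one factor \<open>mvar i\<close> contributes \<open>lk \<alpha> i\<close> times the
  same value for each \<open>i\<close>, and these exponents add up to the degree.\<close>

lemma lookup_lin_form_power:
  assumes "\<alpha> \<in> Exps n m"
  shows "of_nat (mfact \<alpha>) * lk (lin_form n a ^ m) \<alpha> = of_nat (fact m) * mon a \<alpha>"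
  using assms
proof (induction m arbitrary: \<alpha>)
  case 0
  then show ?case by (simp add: mfact_def lookup_one)
next
  case (Suc m)
  let ?P = "lin_form n a ^ m"
  have "of_nat (mfact \<alpha>) * (a i * lk (mvar i * ?P) \<alpha>) = of_nat (lk \<alpha> i) * (of_nat (fact m) * mon a \<alpha>)" if "i \<le> n" for i
  proof (cases "lk \<alpha> i = 0")
    case False
    let ?\<beta> = "\<alpha> - sgl i 1"
    have \<alpha>: "\<alpha> = ?\<beta> + sgl i 1"
      using False by (intro poly_mapping_eqI) (auto simp: lookup_add lookup_minus lookup_single when_def)
    have "total \<alpha> = total ?\<beta> + 1" by (subst \<alpha>) (simp only: total_add total_single)
    moreover have "ks ?\<beta> \<subseteq> ks \<alpha>" by (auto simp: in_keys_iff lookup_minus)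
    ultimately have \<beta>: "?\<beta> \<in> Exps n m" using Suc.prems by (auto simp: exps_iff)
    have mon: "mon a \<alpha> = a i * mon a ?\<beta>" by (subst \<alpha>) (simp only: mon_add mon_single power_one_right mult.commute)
    have "mfact \<alpha> = lk \<alpha> i * mfact ?\<beta>" using False by (intro mfact_minus) simp
    then have "of_nat (mfact \<alpha>) * (a i * lk (mvar i * ?P) \<alpha>) =
        of_nat (lk \<alpha> i) * a i * (of_nat (mfact ?\<beta>) * lk ?P ?\<beta>)"
      using False by (simp add: lookup_mvar_mult mult_ac)
    also have "\<dots> = of_nat (lk \<alpha> i) * (of_nat (fact m) * mon a \<alpha>)"
      by (simp only: Suc.IH[OF \<beta>] mon mult_ac)
    finally show ?thesis .
  qed (simp add: lookup_mvar_mult)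
  then have "(\<Sum>i\<le>n. of_nat (mfact \<alpha>) * (a i * lk (mvar i * ?P) \<alpha>)) =
      (\<Sum>i\<le>n. of_nat (lk \<alpha> i)) * (of_nat (fact m) * mon a \<alpha>)"
    by (simp add: sum_distrib_right)
  also have "(\<Sum>i\<le>n. of_nat (lk \<alpha> i)) = (of_nat (Suc m) :: 'a)"
    using Suc.prems total_superset[of "{..n}" \<alpha>] by (simp add: exps_iff flip: of_nat_sum)
  finally have "(\<Sum>i\<le>n. of_nat (mfact \<alpha>) * (a i * lk (mvar i * ?P) \<alpha>)) = of_nat (fact (Suc m)) * mon a \<alpha>"
    by (simp only: fact_Suc of_nat_mult mult_ac of_nat_id)
  moreover have "lin_form n a ^ Suc m = (\<Sum>i\<le>n. mscale (a i) (mvar i * ?P))"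
    by (simp add: lin_form_def sum_distrib_right)
  ultimately show ?case by (simp add: lookup_sum sum_distrib_left)
qed

text \<open>The reproducing property: a power of a linear form represents evaluation at its
  coefficient vector.\<close>

lemma pairing_lin_form_power:
  assumes "f \<in> Sym n m"
  shows "pairing n m (lin_form n a ^ m) f = of_nat (fact m) * meval a f"
  by (simp add: pairing_def lookup_lin_form_power meval.minsert_forms[OF _ assms] sum_distrib_left mult_ac)

text \<open>The coefficients of the \<open>m\<close>-th power of a linear form are the monomials in its coefficients, up
  to nonzero multinomial coefficients, so a functional killing all these powers is a form that vanishes
  identically.\<close>

lemma functional_eq_0I:
  fixes B :: "(nat \<Rightarrow>\<^sub>0 nat) \<Rightarrow> 'a::field"
  assumes inf: "infinite (UNIV :: 'a set)" and fm: "(of_nat (fact m) :: 'a) \<noteq> 0"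
    and z: "\<And>a. (\<Sum>\<alpha>\<in>Exps n m. lk (lin_form n a ^ m) \<alpha> * B \<alpha>) = 0"
    and \<alpha>: "\<alpha> \<in> Exps n m"
  shows "B \<alpha> = 0"
proof -
  define c where "c \<alpha> = of_nat (fact m) / of_nat (mfact \<alpha>) * B \<alpha>" for \<alpha>
  define Q where "Q = (\<Sum>\<alpha>\<in>Exps n m. sgl \<alpha> (c \<alpha>))"
  have nz: "(of_nat (mfact \<beta>) :: 'a) \<noteq> 0" if "\<beta> \<in> Exps n m" for \<beta>
    using that by (intro mfact_nonzero[OF fm]) (simp add: exps_iff)
  have Q: "Q \<in> Sym n m" unfolding Q_def by (intro forms_sum) auto
  have "lk (lin_form n a ^ m) \<beta> * B \<beta> = c \<beta> * mon a \<beta>" if "\<beta> \<in> Exps n m" for a \<beta>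
    using lookup_lin_form_power[OF that, of a] nz[OF that] by (simp add: c_def field_simps)
  then have "meval a Q = 0" for a
    using z[of a] by (simp add: Q_def meval.minsert_sum meval.minsert_single)
  then have "Q = 0" using forms_eq_0I[OF inf Q] by simp
  moreover have "lk Q \<alpha> = c \<alpha>" using \<alpha> by (simp add: Q_def lookup_sum lookup_single when_def)
  ultimately have "c \<alpha> = 0" by simp
  then show ?thesis using fm nz[OF \<alpha>] by (simp add: c_def)
qed

lemma mat_subst_lin_form:
  assumes "A \<in> carrier_mat (n + 1) (n + 1)"
  shows "mat_subst n A\<^sup>T (lin_form n a) = lin_form n (mat_pt n A a)"
proof -
  have "mat_subst n A\<^sup>T (lin_form n a) = (\<Sum>i\<le>n. \<Sum>j\<le>n. mscale (A $$ (j, i) * a i) (mvar j))"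
    using assms by (simp add: lin_form_def mat_subst_sum mat_subst_mscale)
      (simp add: mat_subst_def msubst.minsert_mvar mscale_def mconst_hom sum_distrib_left mult_ac)
  also have "\<dots> = (\<Sum>j\<le>n. \<Sum>i\<le>n. mscale (A $$ (j, i) * a i) (mvar j))" by (rule sum.swap)
  finally show ?thesis by (simp add: lin_form_def mat_pt_def mpoly.scale_sum_left)
qed

text \<open>The difference of the two sides is linear in \<open>p\<close>. On powers of linear forms
  both sides are evaluations of \<open>f\<close>, at the points \<open>B (A a)\<close> and
  \<open>a\<close>, so the difference vanishes there and hence everywhere by
  \<open>functional_eq_0I\<close>.\<close>

lemma pairing_invariant:
  fixes p f :: "(nat, 'a::field) mpoly"
  assumes inf: "infinite (UNIV :: 'a set)" and fm: "(of_nat (fact m) :: 'a) \<noteq> 0"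
    and A: "A \<in> carrier_mat (n + 1) (n + 1)" "B \<in> carrier_mat (n + 1) (n + 1)" "B * A = 1\<^sub>m (n + 1)"
    and p: "p \<in> Sym n m" and f: "f \<in> Sym n m"
  shows "pairing n m (mat_subst n A\<^sup>T p) (mat_subst n B f) = pairing n m p f"
proof -
  let ?g = "mat_subst n B f"
  define \<Phi> where "\<Phi> p = pairing n m (mat_subst n A\<^sup>T p) ?g - pairing n m p f" for p
  have lin: "\<Phi> p = (\<Sum>\<alpha>\<in>Exps n m. lk p \<alpha> * \<Phi> (sgl \<alpha> 1))" if "p \<in> Sym n m" for p
  proof -
    have "p = (\<Sum>\<alpha>\<in>Exps n m. mscale (lk p \<alpha>) (sgl \<alpha> 1))"
      by (subst forms_sum_single[OF _ that]) (simp_all add: mscale_def mconst_def mult_single)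
    then have "\<Phi> p = \<Phi> (\<Sum>\<alpha>\<in>Exps n m. mscale (lk p \<alpha>) (sgl \<alpha> 1))" by simp
    also have "\<dots> = (\<Sum>\<alpha>\<in>Exps n m. lk p \<alpha> * \<Phi> (sgl \<alpha> 1))"
      by (simp add: \<Phi>_def mat_subst_sum mat_subst_mscale pairing_sum_left pairing_mscale_left
        sum_subtractf algebra_simps)
    finally show ?thesis .
  qed
  have g: "?g \<in> Sym n m" using f by (rule mat_subst_forms)
  have "\<Phi> (lin_form n a ^ m) = 0" for a
  proof -
    have "meval (mat_pt n B (mat_pt n A a)) f = meval a f"
      using meval_mat_pt_mult[OF A(2,1) f, of a] A(3) mat_pt_one[of _ n a]
      by (metis meval_Sym_cong[OF f])
    then show ?thesis
      by (simp add: \<Phi>_def mat_subst_power mat_subst_lin_form[OF A(1)] pairing_lin_form_power[OF g]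
        pairing_lin_form_power[OF f] meval_mat_subst)
  qed
  then have "\<Phi> (sgl \<alpha> 1) = 0" if "\<alpha> \<in> Exps n m" for \<alpha>
    using that by (intro functional_eq_0I[OF inf fm, of n "\<lambda>\<alpha>. \<Phi> (sgl \<alpha> 1)"])
      (simp_all add: lin[symmetric] lin_form_power_forms)
  then have "\<Phi> p = 0" using lin[OF p] by simp
  then show ?thesis by (simp add: \<Phi>_def)
qed

section \<open>Coordinates\<close>

definition dimS :: "nat \<Rightarrow> nat \<Rightarrow> nat" where
  "dimS n m = card (Exps n m)"

abbreviation lex :: "nat \<Rightarrow> nat \<Rightarrow> nat \<Rightarrow> (nat \<Rightarrow>\<^sub>0 nat)" where
  "lex n m j \<equiv> lex_exps n m ! j"

lemma set_lex_exps: "set (lex_exps n m) = Exps n m"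
  by (simp add: lex_exps_def)

lemma distinct_lex_exps: "distinct (lex_exps n m)"
  by (simp add: lex_exps_def)

lemma length_lex_exps: "length (lex_exps n m) = dimS n m"
  by (simp add: lex_exps_def dimS_def)

lemma bij_lex: "bij_betw (lex n m) {..<dimS n m} (Exps n m)"
  using bij_betw_nth[OF distinct_lex_exps] by (simp add: set_lex_exps length_lex_exps)

lemma lex_exps: "j < dimS n m \<Longrightarrow> lex n m j \<in> Exps n m"
  using bij_betwE[OF bij_lex] by auto

lemma lex_eq_iff: "i < dimS n m \<Longrightarrow> j < dimS n m \<Longrightarrow> lex n m i = lex n m j \<longleftrightarrow> i = j"
  using bij_lex[of n m] by (auto simp: bij_betw_def inj_on_def)

lemma lex_cases:
  assumes "\<alpha> \<in> Exps n m"
  obtains j where "j < dimS n m" "\<alpha> = lex n m j"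
  using assms bij_lex[of n m] by (auto simp: bij_betw_def)

lemma sum_lex: "(\<Sum>\<alpha>\<in>Exps n m. F \<alpha>) = (\<Sum>j<dimS n m. F (lex n m j))"
  using sum.reindex_bij_betw[OF bij_lex, of F n m] by simp

lemma dimS_pos: "dimS n m > 0"
proof -
  have "sgl 0 m \<in> Exps n m" by simp
  then have "Exps n m \<noteq> {}" by blast
  then show ?thesis by (simp add: dimS_def card_gt_0_iff)
qed

lemma mono_basis_forms: "j < dimS n m \<Longrightarrow> mono_basis n m j \<in> Sym n m"
  by (simp add: mono_basis_def lex_exps)

lemma lookup_mono_basis:
  "i < dimS n m \<Longrightarrow> j < dimS n m \<Longrightarrow> lk (mono_basis n m i) (lex n m j) = (if i = j then 1 else 0)"
  by (auto simp: mono_basis_def lookup_single when_def lex_eq_iff)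

lemma forms_sum_mono:
  fixes P :: "(nat, 'a::field) mpoly"
  assumes "P \<in> Sym n m"
  shows "P = (\<Sum>j<dimS n m. mscale (lk P (lex n m j)) (mono_basis n m j))"
  by (subst forms_sum_single[OF _ assms])
    (simp_all add: sum_lex mono_basis_def mscale_def mconst_def mult_single)

lemma forms_eqI_lex:
  assumes "P \<in> Sym n m" "Q \<in> Sym n m" "\<And>j. j < dimS n m \<Longrightarrow> lk P (lex n m j) = lk Q (lex n m j)"
  shows "P = Q"
  by (rule forms_eqI[OF assms(1,2)]) (metis lex_cases assms(3))

definition cmat :: "nat \<Rightarrow> nat \<Rightarrow> nat \<Rightarrow> (nat \<Rightarrow> (nat, 'a) mpoly) \<Rightarrow> 'a::zero mat" where
  "cmat n m N g = mat (dimS n m) N (\<lambda>(j, i). lk (g i) (lex n m j))"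

definition cvec :: "nat \<Rightarrow> nat \<Rightarrow> (nat, 'a) mpoly \<Rightarrow> 'a::zero vec" where
  "cvec n m P = vec (dimS n m) (\<lambda>j. lk P (lex n m j))"

text \<open>The matrix of the m-th symmetric power of a substitution in the monomial basis; like
  \<open>mat_subst\<close> it reverses products.\<close>

definition tau :: "nat \<Rightarrow> nat \<Rightarrow> 'a::field mat \<Rightarrow> 'a mat" where
  "tau n m B = cmat n m (dimS n m) (\<lambda>i. mat_subst n B (mono_basis n m i))"

lemma cmat_carrier [simp]: "cmat n m N g \<in> carrier_mat (dimS n m) N"
  by (simp add: cmat_def)

lemma cmat_dims [simp]: "dim_row (cmat n m N g) = dimS n m" "dim_col (cmat n m N g) = N"
  by (simp_all add: cmat_def)

lemma cmat_index [simp]: "j < dimS n m \<Longrightarrow> i < N \<Longrightarrow> cmat n m N g $$ (j, i) = lk (g i) (lex n m j)"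
  by (simp add: cmat_def)

lemma cvec_carrier [simp]: "cvec n m P \<in> carrier_vec (dimS n m)"
  by (simp add: cvec_def)

lemma cvec_dim [simp]: "dim_vec (cvec n m P) = dimS n m"
  by (simp add: cvec_def)

lemma cvec_index [simp]: "j < dimS n m \<Longrightarrow> cvec n m P $ j = lk P (lex n m j)"
  by (simp add: cvec_def)

lemma tau_carrier [simp]: "tau n m B \<in> carrier_mat (dimS n m) (dimS n m)"
  by (simp add: tau_def)

lemma tau_dims [simp]: "dim_row (tau n m B) = dimS n m" "dim_col (tau n m B) = dimS n m"
  by (simp_all add: tau_def)

lemma lookup_mat_subst:
  assumes "P \<in> Sym n m"
  shows "lk (mat_subst n B P) \<gamma> =
    (\<Sum>j<dimS n m. lk (mat_subst n B (mono_basis n m j)) \<gamma> * lk P (lex n m j))"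
  by (subst forms_sum_mono[OF assms]) (simp add: mat_subst_sum mat_subst_mscale lookup_sum mult.commute)

lemma cmat_subst:
  assumes "\<And>i. i < N \<Longrightarrow> g i \<in> Sym n m"
  shows "cmat n m N (\<lambda>i. mat_subst n B (g i)) = tau n m B * cmat n m N g"
proof (rule eq_matI)
  fix j i assume "j < dim_row (tau n m B * cmat n m N g)" "i < dim_col (tau n m B * cmat n m N g)"
  then show "cmat n m N (\<lambda>i. mat_subst n B (g i)) $$ (j, i) = (tau n m B * cmat n m N g) $$ (j, i)"
    using assms by (simp add: lookup_mat_subst[of _ n m] scalar_prod_def tau_def atLeast0LessThan)
qed simp_all

lemma cvec_subst:
  assumes "P \<in> Sym n m"
  shows "cvec n m (mat_subst n B P) = tau n m B *\<^sub>v cvec n m P"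
  by (rule eq_vecI)
    (use assms in \<open>simp_all add: lookup_mat_subst[of _ n m] scalar_prod_def tau_def atLeast0LessThan\<close>)

lemma tau_mult:
  fixes A B :: "'a::field mat"
  assumes "infinite (UNIV :: 'a set)"
    "A \<in> carrier_mat (n + 1) (n + 1)" "B \<in> carrier_mat (n + 1) (n + 1)"
  shows "tau n m (A * B) = tau n m B * tau n m A"
proof -
  have "tau n m (A * B) = cmat n m (dimS n m) (\<lambda>i. mat_subst n B (mat_subst n A (mono_basis n m i)))"
    unfolding tau_def by (rule eq_matI) (simp_all add: mat_subst_comp[OF assms mono_basis_forms])
  also have "\<dots> = tau n m B * tau n m A"
    by (subst cmat_subst) (simp_all add: mat_subst_forms mono_basis_forms tau_def)
  finally show ?thesis .
qed

lemma tau_one: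
  assumes "infinite (UNIV :: 'a::field set)"
  shows "tau n m (1\<^sub>m (n + 1)) = (1\<^sub>m (dimS n m) :: 'a mat)"
  by (rule eq_matI)
    (auto simp: tau_def mat_subst_one[OF assms, of _ n m] mono_basis_forms lookup_mono_basis
      simp del: One_nat_def add_Suc_right)

section \<open>Independence, coordinates and dimension of families of forms\<close>

lemma independent_family:
  assumes "finite A" "inj_on g A" "mpoly.independent (g ` A)"
    and "(\<Sum>i\<in>A. mscale (c i) (g i)) = 0" "i \<in> A"
  shows "c i = (0::'a::field)"
proof -
  \<comment> \<open>Independence speaks of sets of vectors; injectivity lets a vector carry the
    coefficient of its index.\<close>
  let ?u = "\<lambda>v. c (the_inv_into A g v)"
  have "(\<Sum>v\<in>g ` A. mscale (?u v) v) = (\<Sum>i\<in>A. mscale (c i) (g i))"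
    using assms(2) by (subst sum.reindex) (auto simp: the_inv_into_f_f intro!: sum.cong)
  then have "(\<Sum>v\<in>g ` A. mscale (?u v) v) = 0" using assms(4) by simp
  then have "?u (g i) = 0"
    using mpoly.independentD[OF assms(3) _ subset_refl, of ?u "g i"] assms(1,5) by simp
  then show ?thesis using assms(2,5) by (simp add: the_inv_into_f_f)
qed

text \<open>A kernel vector of the coordinate matrix is a linear relation between the forms.\<close>

lemma det_cmat_nonzero:
  fixes g :: "nat \<Rightarrow> (nat, 'a::field) mpoly"
  assumes "\<And>i. i < dimS n m \<Longrightarrow> g i \<in> Sym n m"
    and "inj_on g {..<dimS n m}" "mpoly.independent (g ` {..<dimS n m})"
  shows "det (cmat n m (dimS n m) g) \<noteq> 0"
proof
  let ?N = "dimS n m"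
  assume "det (cmat n m ?N g) = 0"
  then obtain v where v: "v \<in> carrier_vec ?N" "v \<noteq> 0\<^sub>v ?N" "cmat n m ?N g *\<^sub>v v = 0\<^sub>v ?N"
    using det_0_iff_vec_prod_zero_field[OF cmat_carrier] by blast
  have "(\<Sum>i<?N. mscale (v $ i) (g i)) = 0"
  proof (rule forms_eqI_lex)
    fix j assume j: "j < ?N"
    have "lk (\<Sum>i<?N. mscale (v $ i) (g i)) (lex n m j) = (cmat n m ?N g *\<^sub>v v) $ j"
      using j v(1) by (simp add: lookup_sum scalar_prod_def atLeast0LessThan mult.commute)
    then show "lk (\<Sum>i<?N. mscale (v $ i) (g i)) (lex n m j) = lk 0 (lex n m j)"
      using v(3) j by simp
  qed (use assms(1) in \<open>auto intro: forms_sum forms_mscale\<close>)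
  then have "v $ i = 0" if "i < ?N" for i
    using independent_family[OF _ assms(2,3), of "\<lambda>i. v $ i" i] that by simp
  then show False using v(1,2) by (metis eq_vecI index_zero_vec carrier_vecD)
qed

lemma mono_basis_basis:
  fixes n m :: nat
  defines "b \<equiv> (mono_basis n m :: nat \<Rightarrow> (nat, 'a::field) mpoly) ` {..<dimS n m}"
  shows "b \<subseteq> Sym n m" "Sym n m \<subseteq> mpoly.span b" "mpoly.independent b" "card b = dimS n m"
proof -
  have inj: "inj_on (mono_basis n m :: nat \<Rightarrow> (nat, 'a) mpoly) {..<dimS n m}"
  proof (rule inj_onI)
    fix i j assume *: "i \<in> {..<dimS n m}" "j \<in> {..<dimS n m}"
      "mono_basis n m i = (mono_basis n m j :: (nat, 'a) mpoly)"
    then have "lk (mono_basis n m j :: (nat, 'a) mpoly) (lex n m i) = 1"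
      using lookup_mono_basis[of i n m i, where 'a = 'a] by simp
    then show "i = j" using *(1,2) lookup_mono_basis[of j n m i, where 'a = 'a] by (simp split: if_splits)
  qed
  show "b \<subseteq> Sym n m" by (auto simp: b_def mono_basis_forms)
  show "Sym n m \<subseteq> mpoly.span b"
  proof
    fix P :: "(nat, 'a) mpoly" assume "P \<in> Sym n m"
    then show "P \<in> mpoly.span b"
      by (subst forms_sum_mono) (assumption, intro mpoly.span_sum mpoly.span_scale, rule mpoly.span_base, simp add: b_def)
  qed
  show "mpoly.independent b"
  proof (rule mpoly.independent_if_scalars_zero)
    show "finite b" by (simp add: b_def)
  next
    fix u and x :: "(nat, 'a) mpoly" assume z: "(\<Sum>x\<in>b. mscale (u x) x) = 0" and "x \<in> b"
    then obtain j where j: "j < dimS n m" "x = mono_basis n m j" by (auto simp: b_def)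
    have "(\<Sum>i<dimS n m. mscale (u (mono_basis n m i)) (mono_basis n m i)) = (0 :: (nat, 'a) mpoly)"
      using z unfolding b_def by (subst (asm) sum.reindex[OF inj]) simp
    then have "lk (\<Sum>i<dimS n m. mscale (u (mono_basis n m i)) (mono_basis n m i :: (nat, 'a) mpoly)) (lex n m j) = 0"
      by simp
    then have "(\<Sum>i<dimS n m. u (mono_basis n m i) * (if i = j then 1 else 0)) = 0"
      using j(1) by (simp add: lookup_sum lookup_mono_basis)
    then show "u x = 0" using j by (simp add: if_distrib[of "\<lambda>c. _ * c"] cong: if_cong)
  qed
  show "card b = dimS n m" by (simp add: b_def card_image[OF inj])
qed

lemma dim_Sym: "mpoly.dim (Sym n m :: (nat, 'a::field) mpoly set) = dimS n m"
  by (rule mpoly.dim_unique[OF mono_basis_basis])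

text \<open>A form outside the span would enlarge the family to an independent set with more members
  than there are monomials.\<close>

lemma Sym_subset_span:
  fixes g :: "'i \<Rightarrow> (nat, 'a::field) mpoly"
  assumes "finite A" "card A = dimS n m" "\<And>i. i \<in> A \<Longrightarrow> g i \<in> Sym n m"
    and "inj_on g A" "mpoly.independent (g ` A)"
  shows "Sym n m \<subseteq> mpoly.span (g ` A)"
proof
  let ?b = "(mono_basis n m :: nat \<Rightarrow> (nat, 'a) mpoly) ` {..<dimS n m}"
  fix P :: "(nat, 'a) mpoly" assume P: "P \<in> Sym n m"
  show "P \<in> mpoly.span (g ` A)"
  proof (rule ccontr)
    assume *: "P \<notin> mpoly.span (g ` A)"
    then have ind: "mpoly.independent (insert P (g ` A))"
      using assms(5) by (simp add: mpoly.independent_insert)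
    have "insert P (g ` A) \<subseteq> mpoly.span ?b"
      using P assms(3) mono_basis_basis(2)[of n m] by auto
    from mpoly.independent_span_bound[OF _ ind this]
    have "card (insert P (g ` A)) \<le> dimS n m" using mono_basis_basis(4)[where 'a = 'a, of n m] by auto
    moreover have "P \<notin> g ` A" using * mpoly.span_base by blast
    ultimately show False using assms(1,2,4) by (simp add: card_image)
  qed
qed

section \<open>Multiplicative functions of matrices\<close>

text \<open>An identity matrix with one column exchanged. Treating a whole column at once makes the
  elimination of a column a single factor.\<close>

definition col_mat :: "nat \<Rightarrow> nat \<Rightarrow> (nat \<Rightarrow> 'a) \<Rightarrow> 'a::field mat" where
  "col_mat N k c = mat N N (\<lambda>(i, j). if j = k then c i else if i = j then 1 else 0)"

lemma col_mat_carrier [simp]: "col_mat N k c \<in> carrier_mat N N"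
  by (simp add: col_mat_def)

lemma col_mat_mult:
  assumes "M \<in> carrier_mat N N" "k < N" "i < N" "j < N"
  shows "(col_mat N k c * M) $$ (i, j) = (if i = k then 0 else M $$ (i, j)) + c i * M $$ (k, j)"
proof -
  have "(col_mat N k c * M) $$ (i, j) =
      (\<Sum>l\<in>{0..<N}. (if l = k then c i else if i = l then 1 else 0) * M $$ (l, j))"
    using assms by (auto simp: col_mat_def scalar_prod_def intro!: sum.cong)
  also have "\<dots> = (\<Sum>l\<in>{0..<N}. (if l = i then (if i = k then 0 else M $$ (i, j)) else 0) +
      (if l = k then c i * M $$ (k, j) else 0))"
    by (rule sum.cong) auto
  finally show ?thesis using assms by (simp add: sum.distrib)
qed

lemma multrow_mat_mult:
  assumes "M \<in> carrier_mat N N" "i < N" "j < N"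
  shows "(multrow_mat N k s * M) $$ (i, j) = (if i = k then s else 1) * (M $$ (i, j) :: 'a::field)"
  using assms by (subst multrow_mat[OF assms(1), symmetric]) auto

lemma col_mat_index:
  "i < N \<Longrightarrow> j < N \<Longrightarrow> col_mat N k c $$ (i, j) = (if j = k then c i else if i = j then 1 else 0)"
  "dim_row (col_mat N k c) = N" "dim_col (col_mat N k c) = N"
  by (simp_all add: col_mat_def)

text \<open>Two multiplicative functions are compared instead of one being computed; in
  \<open>det_tau\<close> they are the determinant of the symmetric power and a power of the
  determinant.\<close>

locale mult_funs =
  fixes N :: nat and F G :: "'a::field mat \<Rightarrow> 'a"
  assumes inf: "infinite (UNIV :: 'a set)"
    and Fm: "A \<in> carrier_mat N N \<Longrightarrow> B \<in> carrier_mat N N \<Longrightarrow> F (A * B) = F A * F B"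
    and Gm: "A \<in> carrier_mat N N \<Longrightarrow> B \<in> carrier_mat N N \<Longrightarrow> G (A * B) = G A * G B"
    and F1: "F (1\<^sub>m N) = 1" and G1: "G (1\<^sub>m N) = 1"
    and FG: "k < N \<Longrightarrow> s \<noteq> 0 \<Longrightarrow> F (multrow_mat N k s) = G (multrow_mat N k s)"
begin

text \<open>A transvection is a commutator with a diagonal matrix.\<close>

lemma col_mat_unipotent:
  fixes c :: "nat \<Rightarrow> 'a"
  assumes k: "k < N" and c: "c k = 1"
    and H: "\<And>A B. A \<in> carrier_mat N N \<Longrightarrow> B \<in> carrier_mat N N \<Longrightarrow> H (A * B) = H A * (H B :: 'a)"
    and H1: "H (1\<^sub>m N) = 1"
  shows "H (col_mat N k c) = 1"
proof -
  obtain s :: 'a where s: "s \<notin> {0, 1}"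
    using inf ex_new_if_finite[of "{0, 1 :: 'a}"] by auto
  \<comment> \<open>The commutator with the diagonal matrix has the entries
    \<open>e i * (1 / s - 1)\<close> in column \<open>k\<close>, and \<open>e\<close> is chosen to
    make them \<open>c i\<close>. This requires a scalar \<open>s\<close> other than 0 and 1;
    \<open>e'\<close> gives the inverse column.\<close>
  define e where "e i = (if i = k then 1 else c i * s / (1 - s))" for i
  define e' where "e' i = (if i = k then 1 else - e i)" for i
  let ?D = "multrow_mat N k s" and ?D' = "multrow_mat N k (inverse s)"
  let ?C = "col_mat N k e" and ?C' = "col_mat N k e'"
  have car: "?D \<in> carrier_mat N N" "?D' \<in> carrier_mat N N" "?C \<in> carrier_mat N N" "?C' \<in> carrier_mat N N"
    by simp_all
  have D: "?D * ?D' = 1\<^sub>m N" using multrow_mat_inv[OF k, of s] s by simp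
  have C: "?C * ?C' = 1\<^sub>m N"
    by (rule eq_matI) (use k in \<open>auto simp: col_mat_mult simp del: index_mult_mat(1)\<close>,
        auto simp: col_mat_def e'_def e_def)
  have "?C * (?D' * ?C') = col_mat N k (\<lambda>i. if i = k then inverse s else e i * inverse s - e i)"
  proof (rule eq_matI)
    fix i j assume "i < dim_row (col_mat N k (\<lambda>i. if i = k then inverse s else e i * inverse s - e i))"
      "j < dim_col (col_mat N k (\<lambda>i. if i = k then inverse s else e i * inverse s - e i))"
    then have ij: "i < N" "j < N" by (simp_all add: col_mat_def)
    have *: "(?D' * ?C') $$ (a, b) = (if a = k then inverse s * ?C' $$ (a, b) else ?C' $$ (a, b))"
      if "a < N" "b < N" for a b
      using multrow_mat_mult[OF car(4) that] by simp
    show "(?C * (?D' * ?C')) $$ (i, j) =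
        col_mat N k (\<lambda>i. if i = k then inverse s else e i * inverse s - e i) $$ (i, j)"
      using ij k by (subst col_mat_mult) (simp_all add: *, auto simp: col_mat_def e'_def e_def)
  qed (simp_all add: col_mat_def)
  moreover have "e i * inverse s - e i = c i" if "i \<noteq> k" for i
  proof -
    have "inverse s - 1 = (1 - s) / s" using s by (simp add: field_simps)
    moreover have "e i * inverse s - e i = e i * (inverse s - 1)" by (simp add: algebra_simps)
    ultimately have "e i * inverse s - e i = c i * s / (1 - s) * ((1 - s) / s)"
      using that by (simp only: e_def if_False)
    then show ?thesis using s by simp
  qed
  ultimately have "?D * (?C * (?D' * ?C')) = col_mat N k c"
    using k c s
    by (intro eq_matI) (simp_all add: multrow_mat_mult[where N = N] col_mat_index del: index_mult_mat(1))
  then have "H (col_mat N k c) = H ?D * (H ?C * (H ?D' * H ?C'))"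
    using H car by (metis mult_carrier_mat)
  also have "\<dots> = H (?D * ?D') * H (?C * ?C')" using H car by simp
  finally show ?thesis using D C H1 by simp
qed

lemma col_mat_eq:
  assumes k: "k < N" and c: "c k \<noteq> 0"
  shows "F (col_mat N k c) = G (col_mat N k c)"
proof -
  let ?C = "col_mat N k (\<lambda>i. if i = k then 1 else c i)"
  have "multrow_mat N k (c k) * ?C = col_mat N k c"
    using k by (intro eq_matI) (simp_all add: multrow_mat_mult[where N = N] col_mat_index del: index_mult_mat(1))
  moreover have "F ?C = 1" by (rule col_mat_unipotent[OF k _ Fm F1]) simp
  moreover have "G ?C = 1" by (rule col_mat_unipotent[OF k _ Gm G1]) simp
  ultimately show ?thesis using Fm[of "multrow_mat N k (c k)" ?C] Gm[of "multrow_mat N k (c k)" ?C] FG[OF k c]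
    by simp
qed

end

text \<open>Transposition reverses products, but the values lie in a field; so facts about columns
  carry over to rows.\<close>

lemma mult_funs_transpose:
  assumes "mult_funs N F G"
  shows "mult_funs N (\<lambda>A. F A\<^sup>T) (\<lambda>A. G A\<^sup>T)"
proof -
  interpret mult_funs N F G by fact
  have "(multrow_mat N k s)\<^sup>T = multrow_mat N k (s :: 'a)" for k s by (rule eq_matI) auto
  then show ?thesis
    by unfold_locales
      (use inf in \<open>simp_all add: Fm Gm F1 G1 FG transpose_mult[where n = N and nr = N and nc = N] mult.commute\<close>)
qed

context mult_funs
begin

lemma row_mat_eq: "k < N \<Longrightarrow> c k \<noteq> 0 \<Longrightarrow> F (col_mat N k c)\<^sup>T = G (col_mat N k c)\<^sup>T"
  using mult_funs.col_mat_eq[OF mult_funs_transpose[OF mult_funs_axioms]] .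

lemma mult_eq:
  "A \<in> carrier_mat N N \<Longrightarrow> B \<in> carrier_mat N N \<Longrightarrow> F A = G A \<Longrightarrow> F B = G B \<Longrightarrow> F (A * B) = G (A * B)"
  by (simp add: Fm Gm)

text \<open>Gaussian elimination, one index at a time: splitting off the row and the column of a nonzero
  diagonal entry leaves its Schur complement.\<close>

lemma invertible_eq_aux:
  assumes "A \<in> carrier_mat N N" "det A \<noteq> 0"
    and "\<And>i j. i < N \<Longrightarrow> j < N \<Longrightarrow> i < k \<or> j < k \<Longrightarrow> A $$ (i, j) = (if i = j then 1 else 0)"
    and "k \<le> N"
  shows "F A = G A"
  using assms(4,1-3)
\<comment> \<open>The induction runs down from \<open>N\<close>, where the hypothesis on the first
  \<open>k\<close> rows and columns says that \<open>A\<close> is the identity.\<close>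
proof (induction k arbitrary: A rule: inc_induct)
  case base
  then have "A = 1\<^sub>m N" by (intro eq_matI) auto
  then show ?case by (simp add: F1 G1)
next
  case (step k)
  have main: "F M = G M" if M: "M \<in> carrier_mat N N" "det M \<noteq> 0" "M $$ (k, k) \<noteq> 0"
    "\<And>i j. i < N \<Longrightarrow> j < N \<Longrightarrow> i < k \<or> j < k \<Longrightarrow> M $$ (i, j) = (if i = j then 1 else 0)" for M
  proof -
    define p where "p = M $$ (k, k)"
    \<comment> \<open>The factorisation is \<open>M = ?L * C * ?R\<close>. The pivot
      \<open>p\<close> must be counted once, so it stays in \<open>?L\<close> and is divided out of
      \<open>?R\<close>.\<close>
    define C where "C = mat N N (\<lambda>(i, j). if i \<le> k \<or> j \<le> k then (if i = j then 1 else 0)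
      else M $$ (i, j) - M $$ (i, k) * M $$ (k, j) / p)"
    let ?L = "col_mat N k (\<lambda>i. M $$ (i, k))" and ?R = "(col_mat N k (\<lambda>j. M $$ (k, j) / p))\<^sup>T"
    have car: "C \<in> carrier_mat N N" "?L \<in> carrier_mat N N" "?R \<in> carrier_mat N N" by (simp_all add: C_def)
    have CR: "(C * ?R) $$ (i, j) = (if j = k then 0 else C $$ (i, j)) + C $$ (i, k) * (M $$ (k, j) / p)"
      if "i < N" "j < N" for i j
    proof -
      have "(C * ?R) $$ (i, j) = (C * ?R)\<^sup>T $$ (j, i)"
        by (rule index_transpose_mat(1)[symmetric]) (use that in \<open>auto simp: C_def col_mat_index\<close>)
      also have "(C * ?R)\<^sup>T = col_mat N k (\<lambda>j. M $$ (k, j) / p) * C\<^sup>T"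
        using transpose_mult[OF car(1,3)] by simp
      finally show ?thesis using that car step.hyps by (simp add: col_mat_mult del: index_mult_mat(1))
    qed
    define X where "X = ?L * (C * ?R)"
    have MX: "M = X" unfolding X_def
    proof (rule eq_matI)
      fix i j assume "i < dim_row (?L * (C * ?R))" "j < dim_col (?L * (C * ?R))"
      then have ij: "i < N" "j < N" by (simp_all add: col_mat_index)
      show "M $$ (i, j) = (?L * (C * ?R)) $$ (i, j)"
        using ij step.hyps M(3) M(4)[of i j] M(4)[of i k] M(4)[of k j] car
        by (subst col_mat_mult) (auto simp: CR simp del: index_mult_mat(1), auto simp: C_def p_def)
    qed (use M in \<open>simp_all add: col_mat_index\<close>)
    have LR: "F ?L = G ?L" "F ?R = G ?R"
      using step.hyps M(3) by (auto intro!: col_mat_eq row_mat_eq simp: p_def)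
    have "F C = G C"
    proof (rule step.IH[OF car(1)])
      have "det X = det ?L * (det C * det ?R)"
        using car unfolding X_def by (simp add: det_mult[of _ N])
      with MX show "det C \<noteq> 0" using M(2) by auto
    qed (auto simp: C_def)
    then have "F X = G X" unfolding X_def using car LR by (intro mult_eq mult_carrier_mat)
    then show ?thesis using MX by simp
  qed
  show ?case
  proof (cases "A $$ (k, k) = 0")
    case True
    \<comment> \<open>Otherwise column \<open>k\<close> would vanish and the unit vector would lie
      in the kernel.\<close>
    have "\<exists>i<N. i > k \<and> A $$ (i, k) \<noteq> 0"
    proof (rule ccontr)
      assume no: "\<not> ?thesis"
      have "A *\<^sub>v unit_vec N k = 0\<^sub>v N"
      proof (rule eq_vecI)
        fix i assume "i < dim_vec (0\<^sub>v N :: 'a vec)"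
        then have i: "i < N" by simp
        have "A $$ (i, k) = 0"
          using no True step.prems(3)[of i k] step.hyps i by (metis nat_neq_iff)
        then show "(A *\<^sub>v unit_vec N k) $ i = 0\<^sub>v N $ i"
          using step.prems(1) step.hyps i by simp
      qed (use step.prems in simp)
      moreover have "unit_vec N k \<noteq> (0\<^sub>v N :: 'a vec)"
        using step.hyps by (metis index_unit_vec(2) index_zero_vec(1) one_neq_zero)
      ultimately have "det A = 0"
        using det_0_iff_vec_prod_zero_field[OF step.prems(1)] by (metis unit_vec_carrier)
      with step.prems(2) show False by simp
    qed
    then obtain i where i: "i < N" "i > k" "A $$ (i, k) \<noteq> 0" by blast
    \<comment> \<open>Adding a row, instead of exchanging two, keeps the correcting factor
      \<open>E\<close> a transposed \<open>col_mat\<close> with diagonal entry 1.\<close>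
    define M where "M = addrow 1 k i A"
    have M: "M \<in> carrier_mat N N" using step.prems by (simp add: M_def)
    have "det M = det A" using det_addrow[OF i(1) _ step.prems(1), of k 1] i by (simp add: M_def)
    moreover have "M $$ (k, k) \<noteq> 0" using i True step.prems step.hyps by (simp add: M_def)
    moreover have "M $$ (a, b) = (if a = b then 1 else 0)" if "a < N" "b < N" "a < k \<or> b < k" for a b
      using that step.prems(1,3) i by (auto simp: M_def)
    ultimately have "F M = G M" using M step.prems by (intro main) auto
    moreover define E where "E = (col_mat N k (\<lambda>j. if j = i then - 1 :: 'a else if j = k then 1 else 0))\<^sup>T"
    have "A = E * M"
    proof -
      have "E = addrow_mat N (- 1) k i"
        by (rule eq_matI) (use i in \<open>auto simp: E_def col_mat_def\<close>)
      then have "E * M = addrow (- 1) k i M" using addrow_mat[OF M i(1), of "- 1" k] by simp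
      also have "\<dots> = A" by (rule eq_matI) (use i step.prems(1) step.hyps in \<open>auto simp: M_def\<close>)
      finally show ?thesis by simp
    qed
    moreover have "F E = G E" unfolding E_def using step.hyps i by (intro row_mat_eq) auto
    moreover have "E \<in> carrier_mat N N" by (simp add: E_def)
    ultimately show ?thesis using M mult_eq by metis
  qed (use main step.prems in blast)
qed

lemma invertible_eq: "A \<in> carrier_mat N N \<Longrightarrow> det A \<noteq> 0 \<Longrightarrow> F A = G A"
  by (rule invertible_eq_aux[of A 0]) auto

end

section \<open>The determinant of a symmetric power\<close>

lemma sum_exps_lookup:
  fixes k n m :: nat
  shows "k \<le> n \<Longrightarrow> (\<Sum>\<alpha>\<in>Exps n m. lk \<alpha> k) = (\<Sum>\<alpha>\<in>Exps n m. lk \<alpha> 0)"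
proof -
  assume k: "k \<le> n"
  \<comment> \<open>The exchange of the variables \<open>0\<close> and \<open>k\<close> permutes the
    exponents of degree \<open>m\<close>.\<close>
  let ?t = "\<lambda>i. if i = 0 then k else if i = k then 0 else i"
  let ?s = "Poly_Mapping.map_key ?t :: (nat \<Rightarrow>\<^sub>0 nat) \<Rightarrow> _"
  have tt: "?t (?t i) = i" for i by auto
  have inj: "inj ?t"
    by (rule inj_on_inverseI[of _ ?t]) (rule tt)
  have lks: "lk (?s \<alpha>) i = lk \<alpha> (?t i)" for \<alpha> i using inj by (simp add: map_key.rep_eq)
  have ss: "?s (?s \<alpha>) = \<alpha>" for \<alpha> by (rule poly_mapping_eqI) (simp only: lks tt)
  have mem: "?s \<alpha> \<in> Exps n m" if "\<alpha> \<in> Exps n m" for \<alpha>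
  proof -
    have "bij_betw ?t {..n} {..n}"
      by (rule bij_betw_byWitness[of _ ?t]) (use k in auto)
    then have "(\<Sum>i\<le>n. lk (?s \<alpha>) i) = (\<Sum>i\<le>n. lk \<alpha> i)"
      unfolding lks by (rule sum.reindex_bij_betw)
    moreover have "ks (?s \<alpha>) \<subseteq> {..n}"
    proof
      fix i assume "i \<in> ks (?s \<alpha>)"
      then have "?t i \<in> ks \<alpha>" by (simp only: in_keys_iff lks not_False_eq_True)
      then have "?t i \<le> n" using that by (auto simp: exps_iff)
      then show "i \<in> {..n}" using k by (auto split: if_splits)
    qed
    moreover have "ks \<alpha> \<subseteq> {..n}" "total \<alpha> = m" using that by (simp_all add: exps_iff)
    ultimately show ?thesis
      using total_superset[of "{..n}" \<alpha>] total_superset[of "{..n}" "?s \<alpha>"] by (simp add: exps_iff)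
  qed
  have "bij_betw ?s (Exps n m) (Exps n m)"
    by (rule bij_betw_byWitness[of _ ?s]) (use ss mem in auto)
  from sum.reindex_bij_betw[OF this, of "\<lambda>\<alpha>. lk \<alpha> 0"]
  show ?thesis by (simp add: lks)
qed

text \<open>A diagonal matrix that scales the variable \<open>k\<close> has the monomials as
  eigenvectors, and its eigenvalues multiply to \<open>s\<close> to the sum of all
  \<open>lk \<alpha> k\<close>, which by symmetry does not depend on \<open>k\<close>. The
  consequence used later is that \<open>SL\<close> acts on forms with determinant 1.\<close>

lemma det_tau:
  fixes A :: "'a::field mat"
  assumes inf: "infinite (UNIV :: 'a set)" and A: "A \<in> carrier_mat (n + 1) (n + 1)" "det A \<noteq> 0"
  shows "det (tau n m A) = det A ^ (\<Sum>\<alpha>\<in>Exps n m. lk \<alpha> 0)"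
proof -
  let ?e = "\<Sum>\<alpha>\<in>Exps n m. lk \<alpha> 0"
  have "mult_funs (n + 1) (\<lambda>A. det (tau n m A)) (\<lambda>A :: 'a mat. det A ^ ?e)"
  proof
    fix A B :: "'a mat" assume *: "A \<in> carrier_mat (n + 1) (n + 1)" "B \<in> carrier_mat (n + 1) (n + 1)"
    show "det (tau n m (A * B)) = det (tau n m A) * det (tau n m B)"
      using tau_mult[OF inf *] by (simp add: det_mult[OF tau_carrier tau_carrier])
    show "det (A * B) ^ ?e = det A ^ ?e * det B ^ ?e"
      by (simp add: det_mult[OF *] power_mult_distrib)
  next
    show "det (tau n m (1\<^sub>m (n + 1)) :: 'a mat) = 1" by (simp only: tau_one[OF inf] det_one)
  next
    fix k and s :: 'a assume k: "k < n + 1"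
    let ?D = "multrow_mat (n + 1) k s"
    have pt: "mat_pt n ?D x i = (if i = k then s else 1) * x i" if "i \<le> n" for x i
    proof -
      have "mat_pt n ?D x i = (\<Sum>j\<le>n. if j = i then (if i = k then s else 1) * x i else 0)"
        unfolding mat_pt_def by (rule sum.cong) (use that in auto)
      then show ?thesis using that by simp
    qed
    have mono: "mat_subst n ?D (sgl \<alpha> 1) = sgl \<alpha> (s ^ lk \<alpha> k)" if \<alpha>: "\<alpha> \<in> Exps n m" for \<alpha>
    proof (rule forms_eqI_meval[OF inf, of _ n m])
      fix x
      have V: "ks \<alpha> \<subseteq> {..n}" using \<alpha> by (simp add: exps_iff)
      have "mon (mat_pt n ?D x) \<alpha> = (\<Prod>i\<le>n. ((if i = k then s else 1) * x i) ^ lk \<alpha> i)"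
        using V by (subst mon_superset[of "{..n}"]) (simp_all only: finite_atMost, rule prod.cong, simp_all only: pt atMost_iff)
      also have "\<dots> = (\<Prod>i\<le>n. (if i = k then s ^ lk \<alpha> i else 1)) * (\<Prod>i\<le>n. x i ^ lk \<alpha> i)"
        unfolding prod.distrib[symmetric] by (rule prod.cong) (auto simp: power_mult_distrib)
      also have "\<dots> = s ^ lk \<alpha> k * mon x \<alpha>"
        using V k by (simp add: mon_superset[of "{..n}"])
      finally show "meval x (mat_subst n ?D (sgl \<alpha> 1)) = meval x (sgl \<alpha> (s ^ lk \<alpha> k))"
        by (simp add: meval_mat_subst meval.minsert_single)
    qed (use \<alpha> in \<open>auto intro: mat_subst_forms\<close>)
    have ent: "tau n m ?D $$ (i, j) = (if i = j then s ^ lk (lex n m j) k else 0)"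
      if "i < dimS n m" "j < dimS n m" for i j
      using that by (auto simp: tau_def mono_basis_def mono lex_exps lookup_single when_def lex_eq_iff
        simp del: add_Suc_right One_nat_def)
    have "det (tau n m ?D) = prod_list (diag_mat (tau n m ?D))"
      by (rule det_upper_triangular[OF _ tau_carrier]) (auto simp: ent upper_triangular_def simp del: One_nat_def add_Suc_right)
    also have "\<dots> = (\<Prod>j<dimS n m. s ^ lk (lex n m j) k)"
      by (simp add: prod_list_diag_prod ent atLeast0LessThan del: One_nat_def add_Suc_right)
    also have "\<dots> = s ^ (\<Sum>\<alpha>\<in>Exps n m. lk \<alpha> k)" by (simp add: sum_lex power_sum)
    also have "\<dots> = det ?D ^ ?e" using k sum_exps_lookup[of k n m] by (simp add: det_multrow_mat[OF k] del: One_nat_def add_Suc_right)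
    finally show "det (tau n m ?D) = det ?D ^ ?e" .
  qed (use inf in simp_all)
  from mult_funs.invertible_eq[OF this A] show ?thesis .
qed

section \<open>Homogeneous polynomial functions of a form\<close>

text \<open>The degree is part of the predicate because invariants must be homogeneous while the
  given covariants may have different degrees.\<close>

definition hom_fun ::
  "nat \<Rightarrow> nat \<Rightarrow> nat \<Rightarrow> ((nat, 'a) mpoly \<Rightarrow> 'a::field) \<Rightarrow> bool" where
  "hom_fun n m \<delta> I \<longleftrightarrow> (\<exists>P\<in>forms (Exps n m) \<delta>. \<forall>f\<in>Sym n m. I f = meval (lk f) P)"

lemma hom_fun_cong: "hom_fun n m \<delta> I \<Longrightarrow> (\<And>f. f \<in> Sym n m \<Longrightarrow> J f = I f) \<Longrightarrow> hom_fun n m \<delta> J"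
  by (simp add: hom_fun_def)

lemma hom_fun_0: "hom_fun n m \<delta> (\<lambda>f. 0)"
  unfolding hom_fun_def by (rule bexI[of _ 0]) (auto simp: meval.minsert_0)

lemma hom_fun_const: "hom_fun n m 0 (\<lambda>f. c)"
  unfolding hom_fun_def by (rule bexI[of _ "mconst c"]) (auto simp: meval.minsert_mconst)

lemma hom_fun_add: "hom_fun n m \<delta> I \<Longrightarrow> hom_fun n m \<delta> J \<Longrightarrow> hom_fun n m \<delta> (\<lambda>f. I f + J f)"
  unfolding hom_fun_def
proof (elim bexE)
  fix P Q assume "P \<in> forms (Exps n m) \<delta>" "Q \<in> forms (Exps n m) \<delta>"
    "\<forall>f\<in>Sym n m. I f = meval (lk f) P" "\<forall>f\<in>Sym n m. J f = meval (lk f) Q"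
  then show "\<exists>P\<in>forms (Exps n m) \<delta>. \<forall>f\<in>Sym n m. I f + J f = meval (lk f) P"
    by (intro bexI[of _ "P + Q"]) (auto simp: meval.minsert_add forms_add)
qed

lemma hom_fun_mult:
  "hom_fun n m \<delta> I \<Longrightarrow> hom_fun n m \<delta>' J \<Longrightarrow> hom_fun n m (\<delta> + \<delta>') (\<lambda>f. I f * J f)"
  unfolding hom_fun_def
proof (elim bexE)
  fix P Q assume "P \<in> forms (Exps n m) \<delta>" "Q \<in> forms (Exps n m) \<delta>'"
    "\<forall>f\<in>Sym n m. I f = meval (lk f) P" "\<forall>f\<in>Sym n m. J f = meval (lk f) Q"
  then show "\<exists>P\<in>forms (Exps n m) (\<delta> + \<delta>'). \<forall>f\<in>Sym n m. I f * J f = meval (lk f) P"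
    by (intro bexI[of _ "P * Q"]) (auto simp: meval.minsert_mult forms_mult)
qed

lemma hom_fun_cmult: "hom_fun n m \<delta> I \<Longrightarrow> hom_fun n m \<delta> (\<lambda>f. c * I f)"
  using hom_fun_mult[OF hom_fun_const] by fastforce

lemma hom_fun_sum:
  "(\<And>x. x \<in> A \<Longrightarrow> hom_fun n m \<delta> (I x)) \<Longrightarrow> hom_fun n m \<delta> (\<lambda>f. \<Sum>x\<in>A. I x f)"
  by (induction A rule: infinite_finite_induct) (auto intro: hom_fun_0 hom_fun_add)

lemma hom_fun_prod:
  "(\<And>x. x \<in> A \<Longrightarrow> hom_fun n m (\<delta> x) (I x)) \<Longrightarrow> hom_fun n m (\<Sum>x\<in>A. \<delta> x) (\<lambda>f. \<Prod>x\<in>A. I x f)"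
  by (induction A rule: infinite_finite_induct) (auto intro: hom_fun_const hom_fun_mult)

lemma hom_fun_lookup: "\<alpha> \<in> Exps n m \<Longrightarrow> hom_fun n m 1 (\<lambda>f. lk f \<alpha>)"
  unfolding hom_fun_def
  by (rule bexI[of _ "mvar \<alpha>"]) (auto simp: meval.minsert_mvar intro: forms_mvar[unfolded One_nat_def])

text \<open>The degree depends on the column only, and each term of the Leibniz expansion meets
  every column once, so all terms have the same degree.\<close>

lemma hom_fun_det:
  assumes M: "\<And>f. M f \<in> carrier_mat N N"
    and h: "\<And>i j. i < N \<Longrightarrow> j < N \<Longrightarrow> hom_fun n m (\<delta> j) (\<lambda>f. M f $$ (i, j))"
  shows "hom_fun n m (\<Sum>j\<in>{0..<N}. \<delta> j) (\<lambda>f. det (M f))"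
  unfolding det_def'[OF M]
proof (rule hom_fun_sum, rule hom_fun_cmult)
  fix p assume "p \<in> {p. p permutes {0..<N}}"
  then have p: "p permutes {0..<N}" by simp
  have "hom_fun n m (\<Sum>i\<in>{0..<N}. \<delta> (p i)) (\<lambda>f. \<Prod>i = 0..<N. M f $$ (i, p i))"
    by (rule hom_fun_prod) (use permutes_in_image[OF p] h in auto)
  then show "hom_fun n m (\<Sum>j\<in>{0..<N}. \<delta> j) (\<lambda>f. \<Prod>i = 0..<N. M f $$ (i, p i))"
    using sum.permute[OF p, of \<delta>] by (simp add: o_def)
qed

text \<open>The coefficient condition ranges over all \<beta>: outside degree \<open>e\<close> the
  coefficient is zero, which is homogeneous of every degree.\<close>

definition hom_forms ::
  "nat \<Rightarrow> nat \<Rightarrow> nat \<Rightarrow> nat \<Rightarrow> ((nat, 'a) mpoly \<Rightarrow> (nat, 'a::field) mpoly) \<Rightarrow> bool" where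
  "hom_forms n m e \<delta> F \<longleftrightarrow> (\<forall>f\<in>Sym n m. F f \<in> Sym n e) \<and> (\<forall>\<beta>. hom_fun n m \<delta> (\<lambda>f. lk (F f) \<beta>))"

lemma hom_forms_of_map:
  assumes "homogeneous_polynomial_map n m e F"
  obtains \<delta> where "hom_forms n m e \<delta> F"
proof -
  from assms obtain \<delta> where F: "\<And>f. f \<in> Sym n m \<Longrightarrow> F f \<in> Sym n e"
    and \<delta>: "\<And>\<beta>. \<beta> \<in> Exps n e \<Longrightarrow> hom_fun n m \<delta> (\<lambda>f. lk (F f) \<beta>)"
    unfolding homogeneous_polynomial_map_def hom_fun_def by blast
  have "hom_fun n m \<delta> (\<lambda>f. lk (F f) \<beta>)" for \<beta>
  proof (cases "\<beta> \<in> Exps n e")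
    case False
    show ?thesis by (rule hom_fun_cong[OF hom_fun_0]) (use F False forms_lookup in blast)
  qed (rule \<delta>)
  then show ?thesis using that F unfolding hom_forms_def by blast
qed

lemma hom_forms_mult:
  assumes "hom_forms n m e \<delta> F" "hom_forms n m e' \<delta>' G"
  shows "hom_forms n m (e + e') (\<delta> + \<delta>') (\<lambda>f. F f * G f)"
  unfolding hom_forms_def
proof (intro conjI allI ballI)
  fix f :: "(nat, 'a) mpoly" assume "f \<in> Sym n m"
  then show "F f * G f \<in> Sym n (e + e')" using assms by (simp add: hom_forms_def forms_mult)
next
  fix \<gamma>
  have "hom_fun n m (\<delta> + \<delta>') (\<lambda>f. \<Sum>\<alpha>\<in>Exps n e. \<Sum>\<beta>\<in>Exps n e'.
      if \<alpha> + \<beta> = \<gamma> then lk (F f) \<alpha> * lk (G f) \<beta> else 0)"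
  proof (intro hom_fun_sum)
    fix \<alpha> \<beta>
    show "hom_fun n m (\<delta> + \<delta>') (\<lambda>f. if \<alpha> + \<beta> = \<gamma> then lk (F f) \<alpha> * lk (G f) \<beta> else 0)"
      using assms by (cases "\<alpha> + \<beta> = \<gamma>") (auto simp: hom_forms_def intro: hom_fun_mult hom_fun_0)
  qed
  then show "hom_fun n m (\<delta> + \<delta>') (\<lambda>f. lk (F f * G f) \<gamma>)"
    by (rule hom_fun_cong) (use assms in \<open>auto simp: hom_forms_def intro!: lookup_mult_forms\<close>)
qed

lemma hom_forms_1: "hom_forms n m 0 0 (\<lambda>f. 1)"
  by (simp add: hom_forms_def hom_fun_const)

lemma hom_forms_prod:
  assumes "finite A" "\<And>t. t \<in> A \<Longrightarrow> hom_forms n m e (\<delta> t) (F t)"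
  shows "hom_forms n m (card A * e) (\<Sum>t\<in>A. \<delta> t) (\<lambda>f. \<Prod>t\<in>A. F t f)"
  using assms
proof (induction A rule: finite_induct)
  case (insert x A)
  have "hom_forms n m (e + card A * e) (\<delta> x + (\<Sum>t\<in>A. \<delta> t)) (\<lambda>f. F x f * (\<Prod>t\<in>A. F t f))"
    by (rule hom_forms_mult) (use insert in auto)
  then show ?case using insert by simp
qed (simp add: hom_forms_1)

lemma invariantI:
  assumes "hom_fun n m \<delta> I"
    and "\<And>A f. A \<in> SL n \<Longrightarrow> f \<in> Sym n m \<Longrightarrow> I (act_dual n A f) = I f"
  shows "invariant n m I"
  unfolding invariant_def covariant_def homogeneous_polynomial_map_def
proof (intro conjI ballI exI)
  fix \<beta> :: "nat \<Rightarrow>\<^sub>0 nat" assume "\<beta> \<in> Exps n 0"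
  then show "\<exists>P\<in>forms (Exps n m) \<delta>. \<forall>f\<in>Sym n m. lk (mconst (I f) :: (nat, 'a) mpoly) \<beta> = meval (lk f) P"
    using assms(1) by (simp add: lookup_mconst hom_fun_def)
qed (use assms(2) in \<open>simp_all add: act_dual_eq mat_subst_mconst\<close>)

section \<open>Adjugates\<close>

text \<open>Cramer's rule without division: the expansion along the replaced column meets only
  cofactors of \<open>A\<close>.\<close>

lemma adj_mat_mult_vec:
  assumes A: "A \<in> carrier_mat N N" and b: "b \<in> carrier_vec N" and k: "k < N"
  shows "(adj_mat A *\<^sub>v b) $ k = det (replace_col A b k)"
proof -
  have Ab: "replace_col A b k \<in> carrier_mat N N" using A by (auto simp: replace_col_def)
  have "(adj_mat A *\<^sub>v b) $ k = (\<Sum>i\<in>{0..<N}. cofactor A i k * b $ i)"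
    using A b k by (simp add: adj_mat_def scalar_prod_def)
  also have "\<dots> = (\<Sum>i<N. replace_col A b k $$ (i, k) * cofactor (replace_col A b k) i k)"
    unfolding atLeast0LessThan
  proof (rule sum.cong[OF refl])
    fix i assume i: "i \<in> {..<N}"
    have "mat_delete (replace_col A b k) i k = mat_delete A i k"
      by (rule eq_matI) (use A k i in \<open>auto simp: mat_delete_def replace_col_def\<close>)
    moreover have "replace_col A b k $$ (i, k) = b $ i" using A k i by (simp add: replace_col_def)
    ultimately show "cofactor A i k * b $ i = replace_col A b k $$ (i, k) * cofactor (replace_col A b k) i k"
      by (simp add: cofactor_def)
  qed
  also have "\<dots> = det (replace_col A b k)" by (rule laplace_expansion_column[OF Ab k, symmetric])
  finally show ?thesis .
qed

lemma replace_col_mult: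
  assumes "T \<in> carrier_mat N N" "A \<in> carrier_mat N N" "b \<in> carrier_vec N" "k < N"
  shows "replace_col (T * A) (T *\<^sub>v b) k = T * replace_col A b k"
proof (rule eq_matI)
  fix i j assume "i < dim_row (T * replace_col A b k)" "j < dim_col (T * replace_col A b k)"
  then have ij: "i < N" "j < N" using assms by (auto simp: replace_col_def)
  then show "replace_col (T * A) (T *\<^sub>v b) k $$ (i, j) = (T * replace_col A b k) $$ (i, j)"
    using assms by (auto simp: replace_col_def scalar_prod_def intro!: sum.cong)
qed (use assms in \<open>auto simp: replace_col_def\<close>)

lemma replace_col_carrier [simp]: "A \<in> carrier_mat N N \<Longrightarrow> replace_col A b k \<in> carrier_mat N N"
  by (auto simp: replace_col_def)

text \<open>By Cramer's rule the entry is a determinant, all of whose columns are multiplied by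
  \<open>T\<close>. Phrased with the adjugate, this covers singular \<open>A\<close>.\<close>

lemma adj_mat_mult_tau:
  assumes "T \<in> carrier_mat N N" "A \<in> carrier_mat N N" "b \<in> carrier_vec N" "k < N" "det T = 1"
  shows "(adj_mat (T * A) *\<^sub>v (T *\<^sub>v b)) $ k = (adj_mat A *\<^sub>v b) $ k"
proof -
  have "T * A \<in> carrier_mat N N" "T *\<^sub>v b \<in> carrier_vec N" using assms by auto
  then have "(adj_mat (T * A) *\<^sub>v (T *\<^sub>v b)) $ k = det (replace_col (T * A) (T *\<^sub>v b) k)"
    using assms by (intro adj_mat_mult_vec)
  also have "\<dots> = det (replace_col A b k)"
    using assms by (simp add: replace_col_mult[where N = N] det_mult[of _ N])
  finally show ?thesis using adj_mat_mult_vec[OF assms(2,3,4)] by simp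
qed

lemma hom_fun_adj_mult_vec:
  assumes M: "\<And>f. M f \<in> carrier_mat N N" and b: "\<And>f. b f \<in> carrier_vec N" and k: "k < N"
    and h: "\<And>i j. i < N \<Longrightarrow> j < N \<Longrightarrow> hom_fun n m (\<delta> j) (\<lambda>f. M f $$ (i, j))"
    and hb: "\<And>i. i < N \<Longrightarrow> hom_fun n m \<epsilon> (\<lambda>f. b f $ i)"
  shows "hom_fun n m (\<Sum>j\<in>{0..<N}. if j = k then \<epsilon> else \<delta> j) (\<lambda>f. (adj_mat (M f) *\<^sub>v b f) $ k)"
proof -
  have "hom_fun n m (\<Sum>j\<in>{0..<N}. if j = k then \<epsilon> else \<delta> j) (\<lambda>f. det (replace_col (M f) (b f) k))"
  proof (rule hom_fun_det)
    fix i j assume ij: "i < N" "j < N"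
    have "replace_col (M f) (b f) k $$ (i, j) = (if j = k then b f $ i else M f $$ (i, j))" for f
      using ij carrier_matD[OF M[of f]] by (simp add: replace_col_def)
    then show "hom_fun n m (if j = k then \<epsilon> else \<delta> j) (\<lambda>f. replace_col (M f) (b f) k $$ (i, j))"
      using h[OF ij] hb[OF ij(1)] by (cases "j = k") simp_all
  qed (simp add: M)
  then show ?thesis by (simp add: adj_mat_mult_vec[OF M b k])
qed

section \<open>Contravariants attached to a family of covariants\<close>

text \<open>Distinct monomials of the same degree are orthogonal for \<open>DD\<close>, and a
  monomial paired with itself gives its factorial, whence the denominator.\<close>

lemma dual_basis_mono:
  assumes fd: "(of_nat (fact d) :: 'a::field) \<noteq> 0" and r: "r + 1 = dimS n d" and j: "j < dimS n d"
  shows "dual_basis n d r (mono_basis n d) j =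
    mscale (inverse (of_nat (mfact (lex n d j)))) (mono_basis n d j :: (nat, 'a) mpoly)"
proof -
  have nz: "(of_nat (mfact (lex n d i)) :: 'a) \<noteq> 0" if "i < dimS n d" for i
    by (intro mfact_nonzero[OF fd]) (use lex_exps[OF that] in \<open>simp add: exps_iff\<close>)
  have DD: "DD c (mono_basis n d i) = mconst (of_nat (mfact (lex n d i)) * lk c (lex n d i))"
    if "c \<in> Sym n d" "i < dimS n d" for c :: "(nat, 'a) mpoly" and i
    using that by (simp add: DD_eq_pairing[OF that(1) mono_basis_forms[OF that(2)]])
      (simp add: mono_basis_def pairing_single_right[OF lex_exps])
  have one: "mconst x = 1 \<longleftrightarrow> x = 1" and zero: "mconst x = 0 \<longleftrightarrow> x = 0" for x :: 'a
    by (metis lookup_mconst mconst_hom(3), metis lookup_mconst lookup_zero mconst_def single_zero)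
  let ?c = "mscale (inverse (of_nat (mfact (lex n d j)))) (mono_basis n d j :: (nat, 'a) mpoly)"
  have c: "?c \<in> Sym n d" using j by (intro forms_mscale mono_basis_forms)
  show ?thesis unfolding dual_basis_def
  proof (rule the_equality)
    show "?c \<in> Sym n d \<and> (\<forall>i\<le>r. DD ?c (mono_basis n d i) = (if j = i then 1 else 0))"
      using c r nz j by (auto simp: DD lookup_mono_basis one zero)
  next
    fix c :: "(nat, 'a) mpoly"
    assume *: "c \<in> Sym n d \<and> (\<forall>i\<le>r. DD c (mono_basis n d i) = (if j = i then 1 else 0))"
    show "c = ?c"
    proof (rule forms_eqI_lex)
      fix i assume i: "i < dimS n d"
      then have "i \<le> r" using r by simp
      with * have "DD c (mono_basis n d i) = (if j = i then 1 else 0)" by blast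
      then have "(mconst (of_nat (mfact (lex n d i)) * lk c (lex n d i)) :: (nat, 'a) mpoly) = (if j = i then 1 else 0)"
        using DD[of c i] * i by (simp only: simp_thms)
      then have "of_nat (mfact (lex n d i)) * lk c (lex n d i) = (if j = i then 1 else 0)"
        by (simp add: one zero split: if_splits)
      then show "lk c (lex n d i) = lk ?c (lex n d i)"
        using nz[OF i] i j by (auto simp: lookup_mono_basis field_simps split: if_splits)
    qed (use c * in auto)
  qed
qed

text \<open>The invariant-theoretic half sees the field only as infinite with (kd)! nonzero. No form
  is fixed, since invariance is a statement about all forms at once.\<close>

locale covariant_family =
  fixes n k d r :: nat and q :: "nat \<Rightarrow> (nat, 'a) mpoly \<Rightarrow> (nat, 'a::field) mpoly"
  assumes inf: "infinite (UNIV :: 'a set)"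
    and fm: "(of_nat (fact (k * d)) :: 'a) \<noteq> 0"
    and k: "k \<ge> 1"
    and r: "r + 1 = dimS n d"
    and cov: "i \<le> r \<Longrightarrow> covariant n (k * d) d (q i)"
begin

lemma fd: "(of_nat (fact d) :: 'a) \<noteq> 0"
proof -
  have "d \<le> k * d" using k by simp
  then obtain c where "fact (k * d) = fact d * (c::nat)" by (meson fact_dvd dvdE)
  with fm show ?thesis by auto
qed

lemma q_forms: "i \<le> r \<Longrightarrow> f \<in> Sym n (k * d) \<Longrightarrow> q i f \<in> Sym n d"
  using cov by (simp add: covariant_def homogeneous_polynomial_map_def)

lemma q_equivariant:
  "i \<le> r \<Longrightarrow> A \<in> SL n \<Longrightarrow> f \<in> Sym n (k * d) \<Longrightarrow> q i (act_dual n A f) = mat_subst n (inv_mat A) (q i f)"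
  using cov by (simp add: covariant_def act_dual_eq)

text \<open>A choice, because a covariant that vanishes identically is homogeneous of every
  degree.\<close>

definition qdeg :: "nat \<Rightarrow> nat" where
  "qdeg i = (SOME \<delta>. hom_forms n (k * d) d \<delta> (q i))"

lemma qdeg: "i \<le> r \<Longrightarrow> hom_forms n (k * d) d (qdeg i) (q i)"
  unfolding qdeg_def using cov[of i] hom_forms_of_map unfolding covariant_def
  by (metis (no_types, lifting) someI_ex)

abbreviation S :: "(nat, 'a) mpoly \<Rightarrow> 'a mat" where
  "S f \<equiv> cmat n d (dimS n d) (\<lambda>i. q i f)"

lemma S_mat_eq: "S_mat n d r q f = S f"
  using r by (simp add: S_mat_def cmat_def)

lemma act_dual_forms: "f \<in> Sym n m \<Longrightarrow> act_dual n A f \<in> Sym n m"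
  by (simp add: act_dual_eq mat_subst_forms)

lemma SL_inv:
  fixes A :: "'a mat"
  assumes "A \<in> SL n"
  shows "A \<in> carrier_mat (n + 1) (n + 1)" "inv_mat A \<in> carrier_mat (n + 1) (n + 1)"
    "inv_mat A * A = 1\<^sub>m (n + 1)" "A * inv_mat A = 1\<^sub>m (n + 1)" "det (tau n m (inv_mat A)) = 1"
proof -
  show A: "A \<in> carrier_mat (n + 1) (n + 1)" using assms by (rule SL_D)
  have "det A \<noteq> 0" using SL_D(2)[OF assms] by simp
  note * = inv_mat_props[OF A this]
  show "inv_mat A \<in> carrier_mat (n + 1) (n + 1)" "inv_mat A * A = 1\<^sub>m (n + 1)" "A * inv_mat A = 1\<^sub>m (n + 1)"
    using * by auto
  have "det (inv_mat A) = 1" using * SL_D(2)[OF assms] by simp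
  then show "det (tau n m (inv_mat A)) = 1" using det_tau[OF inf *(1)] by simp
qed

lemma S_equivariant:
  assumes "A \<in> SL n" "f \<in> Sym n (k * d)"
  shows "S (act_dual n A f) = tau n d (inv_mat A) * S f"
proof -
  have "S (act_dual n A f) = cmat n d (dimS n d) (\<lambda>i. mat_subst n (inv_mat A) (q i f))"
    by (rule eq_matI) (use r q_equivariant assms in auto)
  also have "\<dots> = tau n d (inv_mat A) * S f"
    by (rule cmat_subst) (use r q_forms assms in auto)
  finally show ?thesis .
qed

lemma Delta_dual_eq:
  "Delta_dual n d r q i f = (\<Sum>j<dimS n d. mscale ((adj_mat (S f))\<^sup>T $$ (j, i))
     (mscale (inverse (of_nat (mfact (lex n d j)))) (mono_basis n d j)))"
proof -
  have "{..r} = {..<dimS n d}" using r by auto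
  then show ?thesis
    unfolding Delta_dual_def S_mat_eq by (intro sum.cong) (simp_all add: dual_basis_mono[OF fd r])
qed

lemma Delta_dual_forms: "Delta_dual n d r q i f \<in> Sym n d"
  unfolding Delta_dual_eq by (intro forms_sum forms_mscale mono_basis_forms) simp

text \<open>The factorials in the dual basis cancel against the weights of the pairing, which leaves
  the adjugate applied to coordinates, a determinant by Cramer's rule.\<close>

lemma pairing_Delta_dual:
  assumes i: "i \<le> r" and g: "g \<in> Sym n d"
  shows "pairing n d (Delta_dual n d r q i f) g = (adj_mat (S f) *\<^sub>v cvec n d g) $ i"
proof -
  have nz: "(of_nat (mfact (lex n d j)) :: 'a) \<noteq> 0" if "j < dimS n d" for j
    by (intro mfact_nonzero[OF fd]) (use lex_exps[OF that] in \<open>simp add: exps_iff\<close>)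
  have mono: "pairing n d (mono_basis n d j) g = of_nat (mfact (lex n d j)) * lk g (lex n d j)"
    if "j < dimS n d" for j
    using lex_exps[OF that] by (simp add: pairing_def mono_basis_def lookup_single when_def
      if_distrib[of "\<lambda>c. _ * c * _"] if_distrib[of "\<lambda>c. _ * c"] if_distrib[of "\<lambda>c. c * _"] cong: if_cong)
  have adj: "adj_mat (S f) \<in> carrier_mat (dimS n d) (dimS n d)" by (rule adj_mat) simp
  have "pairing n d (Delta_dual n d r q i f) g =
      (\<Sum>j<dimS n d. (adj_mat (S f))\<^sup>T $$ (j, i) * lk g (lex n d j))"
    unfolding Delta_dual_eq pairing_sum_left pairing_mscale_left
    by (rule sum.cong) (use nz mono in auto)
  also have "\<dots> = (adj_mat (S f) *\<^sub>v cvec n d g) $ i"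
    using adj i r by (auto simp: scalar_prod_def atLeast0LessThan intro!: sum.cong)
  finally show ?thesis .
qed

text \<open>By nondegeneracy it suffices to pair with a form \<open>g\<close>. Writing
  \<open>g\<close> as the translate of \<open>g0\<close> multiplies \<open>S f\<close> and the
  coordinate vector by the same matrix of determinant 1, which the adjugate expression does not
  notice; \<open>pairing_invariant\<close> moves the action to the other side. The transpose of
  \<open>A\<close> is the action on Sym(W).\<close>

lemma Delta_dual_equivariant:
  assumes A: "A \<in> SL n" and f: "f \<in> Sym n (k * d)" and i: "i \<le> r"
  shows "Delta_dual n d r q i (act_dual n A f) = mat_subst n A\<^sup>T (Delta_dual n d r q i f)"
proof (rule pairing_eqI[OF fd])
  note SL = SL_inv[OF A]
  fix g :: "(nat, 'a) mpoly" assume g: "g \<in> Sym n d"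
  define g0 where "g0 = mat_subst n A g"
  have g0: "g0 \<in> Sym n d" using g by (simp add: g0_def mat_subst_forms)
  have gg: "g = mat_subst n (inv_mat A) g0"
    using mat_subst_comp[OF inf SL(1,2) g] mat_subst_one[OF inf g] SL(4) by (simp add: g0_def)
  have "pairing n d (Delta_dual n d r q i (act_dual n A f)) g =
      (adj_mat (tau n d (inv_mat A) * S f) *\<^sub>v (tau n d (inv_mat A) *\<^sub>v cvec n d g0)) $ i"
    unfolding pairing_Delta_dual[OF i g] S_equivariant[OF A f] cvec_subst[OF g0, symmetric] gg[symmetric] ..
  also have "\<dots> = (adj_mat (S f) *\<^sub>v cvec n d g0) $ i"
    by (rule adj_mat_mult_tau[where N = "dimS n d"]) (use SL i r in auto)
  also have "\<dots> = pairing n d (Delta_dual n d r q i f) g0" by (rule pairing_Delta_dual[OF i g0, symmetric])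
  also have "\<dots> = pairing n d (mat_subst n A\<^sup>T (Delta_dual n d r q i f)) (mat_subst n (inv_mat A) g0)"
    by (rule pairing_invariant[OF inf fd SL(1,2,3) Delta_dual_forms g0, symmetric])
  finally show "pairing n d (Delta_dual n d r q i (act_dual n A f)) g =
      pairing n d (mat_subst n A\<^sup>T (Delta_dual n d r q i f)) g" using gg by simp
qed (auto intro: Delta_dual_forms mat_subst_forms)

text \<open>The relevant minor has a constant unit vector in column \<open>i\<close>, hence the 0
  there.\<close>

definition ddeg :: "nat \<Rightarrow> nat" where
  "ddeg i = (\<Sum>j\<in>{0..<dimS n d}. if j = i then 0 else qdeg j)"

lemma Delta_dual_hom:
  assumes i: "i \<le> r"
  shows "hom_forms n (k * d) d (ddeg i) (Delta_dual n d r q i)"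
  unfolding hom_forms_def
proof (intro conjI ballI allI)
  fix \<beta>
  show "hom_fun n (k * d) (ddeg i) (\<lambda>f. lk (Delta_dual n d r q i f) \<beta>)"
    unfolding Delta_dual_eq lookup_sum lookup_mscale
  proof (rule hom_fun_sum)
    fix j assume "j \<in> {..<dimS n d}"
    then have j: "j < dimS n d" by simp
    have "hom_fun n (k * d) (ddeg i) (\<lambda>f. (adj_mat (S f) *\<^sub>v unit_vec (dimS n d) j) $ i)"
      unfolding ddeg_def
    proof (rule hom_fun_adj_mult_vec)
      fix a b assume ab: "a < dimS n d" "b < dimS n d"
      then have "b \<le> r" using r by simp
      with ab show "hom_fun n (k * d) (qdeg b) (\<lambda>f. S f $$ (a, b))"
        using qdeg by (simp add: hom_forms_def)
    qed (use i r in \<open>auto intro: hom_fun_const\<close>)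
    moreover have "(adj_mat (S f) *\<^sub>v unit_vec (dimS n d) j) $ i = (adj_mat (S f))\<^sup>T $$ (j, i)" for f
      using adj_mat(1)[of "S f" "dimS n d"] i j r by auto
    ultimately have "hom_fun n (k * d) (ddeg i) (\<lambda>f. (adj_mat (S f))\<^sup>T $$ (j, i))" by simp
    from hom_fun_cmult[OF this, of "inverse (of_nat (mfact (lex n d j))) * lk (mono_basis n d j) \<beta>"]
    show "hom_fun n (k * d) (ddeg i) (\<lambda>f. (adj_mat (S f))\<^sup>T $$ (j, i) *
        (inverse (of_nat (mfact (lex n d j))) * lk (mono_basis n d j) \<beta>))"
      by (simp only: mult.commute)
  qed
qed (rule Delta_dual_forms)

section \<open>Contractions with the form itself and the invariance of \<open>ftilde\<close>\<close>

definition contraction :: "(nat \<Rightarrow> nat) \<Rightarrow> (nat, 'a) mpoly \<Rightarrow> 'a" where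
  "contraction \<iota> f = pairing n (k * d) (\<Prod>t\<in>{1..k}. Delta_dual n d r q (\<iota> t) f) f"

lemma prod_Delta_dual_forms: "(\<Prod>t\<in>{1..k}. Delta_dual n d r q (\<iota> t) f) \<in> Sym n (k * d)"
  using forms_prod[of "{1..k}" "\<lambda>t. Delta_dual n d r q (\<iota> t) f" "{..n}" "\<lambda>_. d"] Delta_dual_forms by simp

lemma contraction_DD:
  "f \<in> Sym n (k * d) \<Longrightarrow>
    lk (DD_map (\<lambda>g. \<Prod>t\<in>{1..k}. Delta_dual n d r q (\<iota> t) g) id f) 0 = contraction \<iota> f"
  unfolding DD_map_def id_apply contraction_def
  by (subst DD_eq_pairing[OF prod_Delta_dual_forms]) (simp_all only: lookup_mconst refl if_True)

lemma contraction_hom: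
  assumes \<iota>: "\<And>t. t \<in> {1..k} \<Longrightarrow> \<iota> t \<le> r"
  shows "hom_fun n (k * d) (Suc (\<Sum>t\<in>{1..k}. ddeg (\<iota> t))) (contraction \<iota>)"
proof -
  have "hom_forms n (k * d) (card {1..k} * d) (\<Sum>t\<in>{1..k}. ddeg (\<iota> t))
      (\<lambda>f. \<Prod>t\<in>{1..k}. Delta_dual n d r q (\<iota> t) f)"
    by (rule hom_forms_prod) (use \<iota> Delta_dual_hom in auto)
  then have h: "hom_fun n (k * d) (\<Sum>t\<in>{1..k}. ddeg (\<iota> t))
      (\<lambda>f. lk (\<Prod>t\<in>{1..k}. Delta_dual n d r q (\<iota> t) f) \<alpha>)" for \<alpha>
    by (simp add: hom_forms_def)
  \<comment> \<open>The \<open>Suc\<close> in the degree counts the linear factor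
    \<open>lk f \<alpha>\<close>.\<close>
  show ?thesis
    unfolding contraction_def pairing_def Suc_eq_plus1
    by (intro hom_fun_sum hom_fun_mult hom_fun_cmult h hom_fun_lookup)
qed

lemma contraction_invariant:
  assumes \<iota>: "\<And>t. t \<in> {1..k} \<Longrightarrow> \<iota> t \<le> r" and A: "A \<in> SL n" and f: "f \<in> Sym n (k * d)"
  shows "contraction \<iota> (act_dual n A f) = contraction \<iota> f"
proof -
  note SL = SL_inv[OF A]
  have "(\<Prod>t\<in>{1..k}. Delta_dual n d r q (\<iota> t) (act_dual n A f)) =
      mat_subst n A\<^sup>T (\<Prod>t\<in>{1..k}. Delta_dual n d r q (\<iota> t) f)"
    unfolding mat_subst_prod by (rule prod.cong) (use \<iota> Delta_dual_equivariant[OF A f] in auto)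
  then show ?thesis
    unfolding contraction_def
    using pairing_invariant[OF inf fm SL(1,2,3) prod_Delta_dual_forms f] by (simp add: act_dual_eq)
qed

lemma prod_mvar: "(\<Prod>t\<in>T. mvar (\<iota> t)) = (sgl (\<Sum>t\<in>T. sgl (\<iota> t) 1) 1 :: (nat, 'a) mpoly)"
  by (induction T rule: infinite_finite_induct) (simp_all add: mvar_def mult_single)

theorem ftilde_invariant: "invariant n (k * d) (\<lambda>f. lk (ftilde n k d r q f) \<alpha>)"
proof -
  define J where "J = {\<iota> \<in> {1..k} \<rightarrow>\<^sub>E {..r}. (\<Sum>t\<in>{1..k}. sgl (\<iota> t) 1) = \<alpha>}"
  have fin: "finite ({1..k} \<rightarrow>\<^sub>E {..r})" by (intro finite_PiE) auto
  have eq: "lk (ftilde n k d r q f) \<alpha> = (\<Sum>\<iota>\<in>J. contraction \<iota> f)" if "f \<in> Sym n (k * d)" for f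
  proof -
    have "lk (ftilde n k d r q f) \<alpha> =
        (\<Sum>\<iota>\<in>{1..k} \<rightarrow>\<^sub>E {..r}. contraction \<iota> f * lk (sgl (\<Sum>t\<in>{1..k}. sgl (\<iota> t) 1) 1) \<alpha>)"
      unfolding ftilde_def lookup_sum lookup_mscale contraction_DD[OF that] prod_mvar ..
    also have "\<dots> = (\<Sum>\<iota>\<in>{1..k} \<rightarrow>\<^sub>E {..r}. if (\<Sum>t\<in>{1..k}. sgl (\<iota> t) 1) = \<alpha> then contraction \<iota> f else 0)"
      by (rule sum.cong) (auto simp: lookup_single when_def)
    also have "\<dots> = (\<Sum>\<iota>\<in>J. contraction \<iota> f)"
      unfolding J_def using fin by (rule sum.inter_filter[symmetric])
    finally show ?thesis .
  qed
  have J: "\<iota> t \<le> r" if "\<iota> \<in> J" "t \<in> {1..k}" for \<iota> t using that by (auto simp: J_def PiE_def)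
  \<comment> \<open>Words with the same monomial use each index equally often, so their contractions
    have a common degree although the \<open>ddeg i\<close> may differ.\<close>
  have deg: "(\<Sum>t\<in>{1..k}. ddeg (\<iota> t)) = (\<Sum>i\<le>r. lk \<alpha> i * ddeg i)" if "\<iota> \<in> J" for \<iota>
  proof -
    have "lk \<alpha> i = (\<Sum>t\<in>{1..k}. if \<iota> t = i then 1 else 0)" for i
      using that by (auto simp: J_def lookup_sum lookup_single when_def cong: if_cong)
    then have "(\<Sum>i\<le>r. lk \<alpha> i * ddeg i) = (\<Sum>i\<le>r. \<Sum>t\<in>{1..k}. if \<iota> t = i then ddeg i else 0)"
      by (simp add: sum_distrib_right if_distrib[of "\<lambda>c. c * _"] cong: if_cong)
    also have "\<dots> = (\<Sum>t\<in>{1..k}. \<Sum>i\<le>r. if \<iota> t = i then ddeg i else 0)" by (rule sum.swap)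
    also have "\<dots> = (\<Sum>t\<in>{1..k}. ddeg (\<iota> t))" using J[OF that] by (intro sum.cong) auto
    finally show ?thesis by simp
  qed
  show ?thesis
  proof (rule invariantI)
    have "hom_fun n (k * d) (Suc (\<Sum>i\<le>r. lk \<alpha> i * ddeg i)) (\<lambda>f. \<Sum>\<iota>\<in>J. contraction \<iota> f)"
      by (rule hom_fun_sum) (use contraction_hom[OF J] deg in fastforce)
    then show "hom_fun n (k * d) (Suc (\<Sum>i\<le>r. lk \<alpha> i * ddeg i)) (\<lambda>f. lk (ftilde n k d r q f) \<alpha>)"
      by (rule hom_fun_cong) (rule eq)
    show "lk (ftilde n k d r q (act_dual n A f)) \<alpha> = lk (ftilde n k d r q f) \<alpha>"
      if "A \<in> SL n" "f \<in> Sym n (k * d)" for A f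
      unfolding eq[OF that(2)] eq[OF act_dual_forms[OF that(2)]]
      by (rule sum.cong[OF refl]) (use contraction_invariant[OF J that] in auto)
  qed
qed

text \<open>The contravariants \<open>\<Delta> q\<^sub>i\<^sup>*\<close> are dual to the \<open>q\<^sub>i\<close>, so contracting with the values of the \<open>q\<^sub>i\<close> at a
  point gives the canonical element, which is a power of the linear form with these coordinates.\<close>

lemma sum_Delta_dual:
  assumes f: "f \<in> Sym n (k * d)"
  shows "(\<Sum>i\<le>r. mscale (meval x (q i f)) (Delta_dual n d r q i f)) =
    mscale (det (S f) / of_nat (fact d)) (lin_form n x ^ d)"
proof (rule pairing_eqI[OF fd])
  fix g :: "(nat, 'a) mpoly" assume g: "g \<in> Sym n d"
  let ?N = "dimS n d" and ?w = "adj_mat (S f) *\<^sub>v cvec n d g"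
  have adj: "adj_mat (S f) \<in> carrier_mat ?N ?N" by (rule adj_mat) simp
  then have w: "?w \<in> carrier_vec ?N" by simp
  have Sv: "(\<Sum>i<?N. c * (S f $$ (l, i) * v $ i)) = c * (S f *\<^sub>v v) $ l"
    if "v \<in> carrier_vec ?N" "l < ?N" for c v l
    using that by (simp add: sum_distrib_left scalar_prod_def atLeast0LessThan)
  have "pairing n d (\<Sum>i\<le>r. mscale (meval x (q i f)) (Delta_dual n d r q i f)) g =
      (\<Sum>i\<le>r. meval x (q i f) * ?w $ i)"
    unfolding pairing_sum_left pairing_mscale_left by (rule sum.cong) (simp_all add: pairing_Delta_dual[OF _ g])
  also have "\<dots> = (\<Sum>i<?N. meval x (q i f) * ?w $ i)" by (rule sum.cong) (use r in auto)
  \<comment> \<open>Evaluating q_i(f) through its coordinates, which form column \<open>i\<close> of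
    \<open>S f\<close>, lets \<open>S f\<close> meet its adjugate.\<close>
  also have "\<dots> = (\<Sum>i<?N. \<Sum>l<?N. mon x (lex n d l) * (S f $$ (l, i) * ?w $ i))"
  proof (rule sum.cong[OF refl])
    fix i assume "i \<in> {..<?N}"
    then have i: "i < ?N" "i \<le> r" using r by auto
    show "meval x (q i f) * ?w $ i = (\<Sum>l<?N. mon x (lex n d l) * (S f $$ (l, i) * ?w $ i))"
      using i by (simp add: meval.minsert_forms[OF _ q_forms[OF i(2) f]] sum_lex sum_distrib_left mult_ac)
  qed
  also have "\<dots> = (\<Sum>l<?N. \<Sum>i<?N. mon x (lex n d l) * (S f $$ (l, i) * ?w $ i))" by (rule sum.swap)
  also have "\<dots> = (\<Sum>l<?N. mon x (lex n d l) * (S f *\<^sub>v ?w) $ l)"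
    by (rule sum.cong) (simp_all only: Sv[OF w] lessThan_iff)
  also have "S f *\<^sub>v ?w = det (S f) \<cdot>\<^sub>v cvec n d g"
  proof -
    have "S f *\<^sub>v ?w = (S f * adj_mat (S f)) *\<^sub>v cvec n d g"
      by (rule assoc_mult_mat_vec[symmetric, OF cmat_carrier adj cvec_carrier])
    also have "\<dots> = (det (S f) \<cdot>\<^sub>m 1\<^sub>m ?N) *\<^sub>v cvec n d g" by (simp add: adj_mat(2)[of "S f" ?N])
    also have "\<dots> = det (S f) \<cdot>\<^sub>v cvec n d g"
      by (rule eq_vecI) (auto simp: scalar_prod_def if_distrib[of "\<lambda>c. c * _"] if_distrib[of "\<lambda>c. _ * c"] cong: if_cong)
    finally show ?thesis .
  qed
  also have "(\<Sum>l<?N. mon x (lex n d l) * (det (S f) \<cdot>\<^sub>v cvec n d g) $ l) = det (S f) * meval x g"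
    by (simp add: meval.minsert_forms[OF _ g] sum_lex sum_distrib_left mult_ac)
  also have "\<dots> = pairing n d (mscale (det (S f) / of_nat (fact d)) (lin_form n x ^ d)) g"
    using fd by (simp add: pairing_mscale_left pairing_lin_form_power[OF g])
  finally show "pairing n d (\<Sum>i\<le>r. mscale (meval x (q i f)) (Delta_dual n d r q i f)) g =
      pairing n d (mscale (det (S f) / of_nat (fact d)) (lin_form n x ^ d)) g" .
qed (auto intro!: forms_sum forms_mscale Delta_dual_forms lin_form_power_forms)

text \<open>The sum over words is the expansion of a k-th power. By \<open>sum_Delta_dual\<close>
  its base is a multiple of the d-th power of a linear form, and pairing the resulting (kd)-th power
  with \<open>f\<close> evaluates \<open>f\<close>.\<close>

theorem meval_ftilde:
  assumes f: "f \<in> Sym n (k * d)"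
  shows "meval (\<lambda>i. meval x (q i f)) (ftilde n k d r q f) =
    det (S f) ^ k * of_nat (fact (k * d)) / of_nat (fact d) ^ k * meval x f"
proof -
  let ?y = "\<lambda>i. meval x (q i f)" and ?D = "\<lambda>i. Delta_dual n d r q i f"
  have "meval ?y (ftilde n k d r q f) = (\<Sum>\<iota>\<in>{1..k} \<rightarrow>\<^sub>E {..r}. contraction \<iota> f * (\<Prod>t\<in>{1..k}. ?y (\<iota> t)))"
    unfolding ftilde_def contraction_DD[OF f]
    by (simp add: meval.minsert_sum meval.minsert_mscale meval.minsert_prod meval.minsert_mvar)
  also have "\<dots> = pairing n (k * d) (\<Sum>\<iota>\<in>{1..k} \<rightarrow>\<^sub>E {..r}. \<Prod>t\<in>{1..k}. mscale (?y (\<iota> t)) (?D (\<iota> t))) f"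
    by (simp add: pairing_sum_left mscale_prod pairing_mscale_left contraction_def mult.commute)
  also have "(\<Sum>\<iota>\<in>{1..k} \<rightarrow>\<^sub>E {..r}. \<Prod>t\<in>{1..k}. mscale (?y (\<iota> t)) (?D (\<iota> t))) =
      (\<Prod>t\<in>{1..k}. \<Sum>i\<in>{..r}. mscale (?y i) (?D i))"
    by (rule prod_sum_PiE[symmetric]) auto
  also have "\<dots> = mscale (det (S f) / of_nat (fact d)) (lin_form n x ^ d) ^ k"
    by (simp only: sum_Delta_dual[OF f] prod_constant card_atLeastAtMost add_diff_cancel_right' Suc_eq_plus1)
  also have "\<dots> = mscale ((det (S f) / of_nat (fact d)) ^ k) (lin_form n x ^ (k * d))"
    by (simp add: mscale_power mult.commute flip: power_mult)
  finally show ?thesis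
    by (simp only: pairing_mscale_left pairing_lin_form_power[OF f]) (simp add: power_divide)
qed

end

section \<open>Linear extension\<close>

text \<open>The target is left general: the field gives functionals, the polynomial ring gives the
  map between two families of covariants.\<close>

lemma linear_extension:
  fixes g :: "'i \<Rightarrow> ('v, 'a::field) mpoly" and h :: "'i \<Rightarrow> 'b::ab_group_add"
  assumes "vector_space s" "inj_on g A" "mpoly.independent (g ` A)"
  obtains l where "\<And>P Q. l (P + Q) = l P + l Q" "\<And>c P. l (mscale c P) = s c (l P)"
    "\<And>i. i \<in> A \<Longrightarrow> l (g i) = h i"
proof -
  interpret V: vector_space s by fact
  interpret vector_space_pair "mscale :: 'a \<Rightarrow> ('v, 'a) mpoly \<Rightarrow> ('v, 'a) mpoly" s ..
  obtain l where l: "Vector_Spaces.linear mscale s l" "\<forall>x\<in>g ` A. l x = h (the_inv_into A g x)"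
    using linear_independent_extend[OF assms(3), of "\<lambda>x. h (the_inv_into A g x)"] by blast
  show ?thesis
  proof (rule that[of l])
    show "l (g i) = h i" if "i \<in> A" for i using l(2) that assms(2) by (simp add: the_inv_into_f_f)
  qed (rule linear_add[OF l(1)], rule linear_scale[OF l(1)])
qed

lemma vector_space_field: "vector_space ((*) :: 'a::field \<Rightarrow> 'a \<Rightarrow> 'a)"
  by unfold_locales (simp_all add: algebra_simps)

section \<open>Points of the Veronese variety\<close>

lemma exp_eq_minus_plus: "lk \<alpha> i > 0 \<Longrightarrow> \<alpha> = (\<alpha> - sgl i 1) + sgl i (1::nat)"
  by (intro poly_mapping_eqI) (auto simp: lookup_add lookup_minus lookup_single when_def)

lemma exps_index: "\<alpha> \<in> exps V m \<Longrightarrow> lk \<alpha> i > 0 \<Longrightarrow> i \<in> V"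
  by (auto simp: exps_iff in_keys_iff subset_iff)

lemma exps_minus: "\<alpha> \<in> exps V (Suc m) \<Longrightarrow> lk \<alpha> i > 0 \<Longrightarrow> \<alpha> - sgl i 1 \<in> exps V m"
proof -
  assume \<alpha>: "\<alpha> \<in> exps V (Suc m)" "lk \<alpha> i > 0"
  let ?\<mu> = "\<alpha> - sgl i 1"
  have "total \<alpha> = total ?\<mu> + 1" by (subst exp_eq_minus_plus[OF \<alpha>(2)]) (simp only: total_add total_single)
  moreover have "ks ?\<mu> \<subseteq> ks \<alpha>" by (auto simp: in_keys_iff lookup_minus)
  ultimately show ?thesis using \<alpha>(1) by (auto simp: exps_iff)
qed

lemma exps_split:
  assumes "\<alpha> \<in> exps V (a + b)"
  obtains \<beta> \<gamma> where "\<beta> \<in> exps V a" "\<gamma> \<in> exps V b" "\<alpha> = \<beta> + \<gamma>"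
  using assms
proof (induction a arbitrary: \<alpha> thesis)
  case 0
  then show ?case by (metis add_0 exps_0 singletonI)
next
  case (Suc a)
  have \<alpha>: "\<alpha> \<in> exps V (Suc (a + b))" using Suc.prems(2) by simp
  then have "total \<alpha> \<noteq> 0" by (simp add: exps_iff)
  then obtain i where i: "i \<in> ks \<alpha>" "lk \<alpha> i > 0" unfolding total_def by (auto simp: sum_eq_0_iff)
  obtain \<beta> \<gamma> where *: "\<beta> \<in> exps V a" "\<gamma> \<in> exps V b" "\<alpha> - sgl i 1 = \<beta> + \<gamma>"
    using Suc.IH exps_minus[OF \<alpha> i(2)] by blast
  have "sgl i 1 + \<beta> \<in> exps V (1 + a)"
    by (rule exps_add) (use i \<alpha> * in \<open>auto simp: exps_iff\<close>)
  moreover have "\<alpha> = (sgl i 1 + \<beta>) + \<gamma>"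
    using exp_eq_minus_plus[OF i(2)] unfolding *(3) by (simp add: add_ac)
  ultimately show ?case using Suc.prems(1) *(2) by simp
qed

text \<open>The lexicographically largest monomial on which such a functional does not vanish is an extreme
  point of the simplex of exponents, hence a pure power.\<close>

lemma veronese_point:
  fixes L :: "(nat \<Rightarrow>\<^sub>0 nat) \<Rightarrow> 'a::field"
  assumes L: "\<And>\<alpha> \<beta> \<gamma> \<delta>. \<lbrakk>\<alpha> \<in> Exps n d; \<beta> \<in> Exps n d; \<gamma> \<in> Exps n d; \<delta> \<in> Exps n d;
      \<alpha> + \<beta> = \<gamma> + \<delta>\<rbrakk> \<Longrightarrow> L \<alpha> * L \<beta> = L \<gamma> * L \<delta>"
    and nz: "\<alpha>\<^sub>0 \<in> Exps n d" "L \<alpha>\<^sub>0 \<noteq> 0" and d: "d \<ge> 1"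
  obtains x c i where "i \<le> n" "x i = 1" "c \<noteq> 0" "\<And>\<alpha>. \<alpha> \<in> Exps n d \<Longrightarrow> L \<alpha> = c * mon x \<alpha>"
proof -
  define T where "T = {\<alpha> \<in> Exps n d. L \<alpha> \<noteq> 0}"
  have T: "finite T" "T \<noteq> {}" using nz by (auto simp: T_def)
  define \<alpha> where "\<alpha> = Max T"
  have \<alpha>T: "\<alpha> \<in> T" using T by (simp add: \<alpha>_def)
  then have \<alpha>: "\<alpha> \<in> Exps n d" "L \<alpha> \<noteq> 0" by (simp_all add: T_def)
  \<comment> \<open>The product of \<open>L \<beta>\<close> and \<open>L \<gamma>\<close> is the
    square of \<open>L \<alpha>\<close>, so neither is zero and both exponents are at most \<alpha>.
    As the order is compatible with addition, their sum can reach 2\<alpha> only by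
    equality.\<close>
  have extreme: "\<beta> = \<alpha>" if \<beta>: "\<beta> \<in> Exps n d" "\<gamma> \<in> Exps n d" "\<alpha> + \<alpha> = \<beta> + \<gamma>" for \<beta> \<gamma>
  proof -
    have "L \<beta> * L \<gamma> \<noteq> 0" using L[OF \<alpha>(1) \<alpha>(1) \<beta>] \<alpha>(2) by (metis mult_eq_0_iff)
    then have "\<beta> \<in> T" "\<gamma> \<in> T" using \<beta>(1,2) by (auto simp: T_def)
    then have "\<beta> \<le> \<alpha>" "\<gamma> \<le> \<alpha>" using T(1) by (auto simp: \<alpha>_def)
    then show ?thesis using \<beta>(3) add_less_le_mono[of \<beta> \<alpha> \<gamma> \<alpha>] by (auto simp: order_le_less)
  qed
  have "total \<alpha> = d" using \<alpha>(1) by (simp add: exps_iff)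
  then have "total \<alpha> \<noteq> 0" using d by simp
  then obtain i where i: "i \<in> ks \<alpha>" "lk \<alpha> i > 0" unfolding total_def by (auto simp: sum_eq_0_iff)
  then have in_n: "i \<le> n" using \<alpha>(1) by (auto simp: exps_iff)
  obtain e where de: "d = Suc e" using d by (cases d) auto
  have exs: "\<mu> + sgl j 1 \<in> Exps n d" if "\<mu> \<in> Exps n e" "j \<le> n" for \<mu> j
    using exps_add[OF that(1), of "sgl j 1" 1] that(2) by (simp add: de)
  \<comment> \<open>If two variables occurred, trading one for the other in either copy of \<alpha>
    would give a second decomposition of 2\<alpha>.\<close>
  have pure: "lk \<alpha> j = 0" if "j \<noteq> i" for j
  proof (rule ccontr)
    assume "lk \<alpha> j \<noteq> 0"
    then have j: "lk \<alpha> j > 0" by simp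
    then have jn: "j \<le> n" using exps_index[OF \<alpha>(1)] by simp
    let ?\<mu> = "\<alpha> - sgl i 1" and ?\<nu> = "\<alpha> - sgl j 1"
    have \<mu>: "?\<mu> \<in> Exps n e" "?\<nu> \<in> Exps n e" using exps_minus[OF _ i(2)] exps_minus[OF _ j] \<alpha>(1) de by auto
    have "\<alpha> + \<alpha> = (?\<mu> + sgl i 1) + (?\<nu> + sgl j 1)"
      using exp_eq_minus_plus[OF i(2)] exp_eq_minus_plus[OF j] by metis
    then have "\<alpha> + \<alpha> = (?\<mu> + sgl j 1) + (?\<nu> + sgl i 1)" by (simp only: add_ac)
    then have "?\<mu> + sgl j 1 = \<alpha>" using extreme exs \<mu> jn in_n by blast
    then have "lk (?\<mu> + sgl j 1) i = lk \<alpha> i" by simp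
    then show False using i(2) that by (simp add: lookup_add lookup_minus lookup_single)
  qed
  have \<alpha>_eq: "\<alpha> = sgl i d"
  proof (rule poly_mapping_eqI)
    have "total \<alpha> = lk \<alpha> i"
      unfolding total_def by (subst sum.remove[OF _ i(1)]) (auto simp: pure intro!: sum.neutral)
    then show "lk \<alpha> j = lk (sgl i d) j" for j
      using \<open>total \<alpha> = d\<close> pure by (auto simp: lookup_single when_def)
  qed
  define c where "c = L (sgl i d)"
  have c: "c \<noteq> 0" using \<alpha>(2) by (simp add: c_def \<alpha>_eq)
  \<comment> \<open>At a multiple of an evaluation these values are \<open>x i ^ e * x j\<close>, up
    to the factor; dividing by \<open>c\<close> normalises the \<open>i\<close>-th coordinate to
    1.\<close>
  define x where "x j = L (sgl i e + sgl j 1) / c" for j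
  have "sgl i e + sgl i 1 = sgl i d" using single_add[of i e 1] de by simp
  then have xi: "x i = 1" using c unfolding x_def c_def by simp
  have main: "L \<beta> = c * mon x \<beta>" if "\<beta> \<in> Exps n d" for \<beta>
    using that
  \<comment> \<open>The induction is on the degree in the variables other than \<open>i\<close>:
    against the pure power, one x_j in \<beta> is traded for an x_i.\<close>
  proof (induction "d - lk \<beta> i" arbitrary: \<beta> rule: less_induct)
    case less
    show ?case
    proof (cases "\<exists>j. j \<noteq> i \<and> lk \<beta> j > 0")
      case False
      then have pure: "lk \<beta> j = 0" if "j \<noteq> i" for j using that by auto
      have "total \<beta> = lk \<beta> i"
      proof (cases "i \<in> ks \<beta>")
        case True
        then show ?thesis
          unfolding total_def by (subst sum.remove[OF _ True]) (auto simp: pure intro!: sum.neutral)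
      next
        case False
        then have "\<beta> = 0" using pure by (intro poly_mapping_eqI) (metis in_keys_iff lookup_zero)
        then show ?thesis by simp
      qed
      then have "\<beta> = sgl i d"
        using less.prems pure by (intro poly_mapping_eqI) (auto simp: exps_iff lookup_single when_def)
      then show ?thesis by (simp add: c_def xi)
    next
      case True
      then obtain j where j: "j \<noteq> i" "lk \<beta> j > 0" by blast
      then have jn: "j \<le> n" using exps_index[OF less.prems] by simp
      define \<mu> where "\<mu> = \<beta> - sgl j 1"
      have \<beta>: "\<beta> = \<mu> + sgl j 1" unfolding \<mu>_def by (rule exp_eq_minus_plus[OF j(2)])
      have \<mu>: "\<mu> \<in> Exps n e" unfolding \<mu>_def using exps_minus[OF _ j(2)] less.prems de by auto
      have m1: "lk (\<mu> + sgl i 1) i = Suc (lk \<beta> i)" using j by (simp add: \<beta> lookup_add lookup_single)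
      moreover have "lk (\<mu> + sgl i 1) i \<le> d"
        using lookup_le_total[of "\<mu> + sgl i 1" i] exs[OF \<mu> in_n] by (simp add: exps_iff)
      ultimately have IH: "L (\<mu> + sgl i 1) = c * mon x (\<mu> + sgl i 1)"
        using less.hyps exs[OF \<mu> in_n] by simp
      have ed: "sgl i e + sgl j 1 \<in> Exps n d" "sgl i d \<in> Exps n d"
        using exs[of "sgl i e" j] in_n jn by auto
      have "sgl i d = sgl i e + sgl i 1" using single_add[of i e 1] de by simp
      then have "\<beta> + sgl i d = (\<mu> + sgl i 1) + (sgl i e + sgl j 1)" by (simp only: \<beta> add_ac)
      then have "L \<beta> * c = L (\<mu> + sgl i 1) * L (sgl i e + sgl j 1)"
        unfolding c_def using L[OF less.prems ed(2) exs[OF \<mu> in_n] ed(1)] by blast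
      also have "\<dots> = c * mon x \<mu> * (c * x j)"
        using IH c xi by (simp add: x_def mon_add)
      also have "\<dots> = c * mon x \<beta> * c" by (simp add: \<beta> mon_add)
      finally show ?thesis using c by simp
    qed
  qed
  show ?thesis using that[of i x c] in_n xi c main by blast
qed

section \<open>The image of the Veronese map\<close>

definition uvec :: "nat \<Rightarrow> (nat \<Rightarrow> (nat, 'a) mpoly \<Rightarrow> (nat, 'a::field) mpoly) \<Rightarrow> (nat, 'a) mpoly \<Rightarrow>
    'a vec \<Rightarrow> 'a vec" where
  "uvec r q f x = vec (r + 1) (\<lambda>i. meval (\<lambda>j. x $ j) (q i f))"

lemma proj_point_smult:
  assumes "c \<noteq> 0" shows "proj_point (c \<cdot>\<^sub>v v) = proj_point (v :: 'a::field vec)"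
proof -
  have "a \<cdot>\<^sub>v v = (a / c) \<cdot>\<^sub>v (c \<cdot>\<^sub>v v)" "a \<cdot>\<^sub>v (c \<cdot>\<^sub>v v) = (a * c) \<cdot>\<^sub>v v" for a
    using assms by (simp_all add: smult_smult_assoc)
  then show ?thesis using assms unfolding proj_point_def
    by (auto intro: exI[of _ "_ / c"] exI[of _ "_ * c"])
qed

lemma mem_proj_point: "(v :: 'a::field vec) \<in> proj_point v"
  unfolding proj_point_def by (auto intro!: exI[of _ 1])

lemma uvec_smult:
  assumes "\<And>i. i \<le> r \<Longrightarrow> q i f \<in> Sym n d" "x \<in> carrier_vec (n + 1)"
  shows "uvec r q f (c \<cdot>\<^sub>v x) = c ^ d \<cdot>\<^sub>v uvec r q f x"
proof (rule eq_vecI)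
  fix i assume "i < dim_vec (c ^ d \<cdot>\<^sub>v uvec r q f x)"
  then have i: "i \<le> r" by (simp add: uvec_def)
  have "meval (\<lambda>j. (c \<cdot>\<^sub>v x) $ j) (q i f) = meval (\<lambda>j. c * x $ j) (q i f)"
    by (rule meval_Sym_cong[OF assms(1)[OF i]]) (use assms(2) in auto)
  then show "uvec r q f (c \<cdot>\<^sub>v x) $ i = (c ^ d \<cdot>\<^sub>v uvec r q f x) $ i"
    using i meval.minsert_scaled[OF assms(1)[OF i], of c "\<lambda>j. x $ j"] by (simp add: uvec_def)
qed (simp add: uvec_def)

text \<open>Representatives of one point have proportional values, so the union in the definition of
  \<open>phi\<close> is a single point.\<close>

lemma phi_proj_point:
  assumes "\<And>i. i \<le> r \<Longrightarrow> q i f \<in> Sym n d" "x \<in> carrier_vec (n + 1)"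
  shows "phi r q f (proj_point x) = proj_point (uvec r q f x)"
proof -
  have "proj_point (uvec r q f (c \<cdot>\<^sub>v x)) = proj_point (uvec r q f x)" if "c \<noteq> 0" for c
    using that proj_point_smult[of "c ^ d"] by (simp add: uvec_smult[where r = r and q = q and f = f, OF assms])
  then show ?thesis
    unfolding phi_def uvec_def[symmetric] using mem_proj_point[of x]
    by (auto simp: proj_point_def) blast+
qed

lemma lin_indep_atD:
  assumes "lin_indep_at r q f" "r + 1 = dimS n d"
  shows "inj_on (\<lambda>i. q i f) {..<dimS n d}" "mpoly.independent ((\<lambda>i. q i f) ` {..<dimS n d})"
proof -
  have "{..r} = {..<dimS n d}" using assms(2) by auto
  then show "inj_on (\<lambda>i. q i f) {..<dimS n d}" "mpoly.independent ((\<lambda>i. q i f) ` {..<dimS n d})"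
    using assms(1) by (auto simp: lin_indep_at_def)
qed

context covariant_family
begin

lemma q_span:
  assumes "f \<in> Sym n (k * d)" "lin_indep_at r q f"
  shows "Sym n d \<subseteq> mpoly.span ((\<lambda>i. q i f) ` {..<dimS n d})"
  by (rule Sym_subset_span) (use lin_indep_atD[OF assms(2) r] q_forms[OF _ assms(1)] r in auto)

lemma det_S_nonzero:
  assumes "f \<in> Sym n (k * d)" "lin_indep_at r q f"
  shows "det (S f) \<noteq> 0"
  by (rule det_cmat_nonzero) (use lin_indep_atD[OF assms(2) r] q_forms[OF _ assms(1)] r in auto)

text \<open>The q_i(f) span all forms of degree d, among them the pure powers. This makes
  \<open>phi\<close> take values in projective space.\<close>

lemma q_common_zero:
  assumes f: "f \<in> Sym n (k * d)" "lin_indep_at r q f"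
    and z: "\<And>i. i \<le> r \<Longrightarrow> meval x (q i f) = 0" and d: "d \<ge> 1" and j: "j \<le> n"
  shows "x j = 0"
proof -
  have "sgl j d \<in> Exps n d" using j by simp
  then have "sgl (sgl j d) 1 \<in> Sym n d" by (rule forms_single)
  then have "(sgl (sgl j d) 1 :: (nat, 'a) mpoly) \<in> mpoly.span ((\<lambda>i. q i f) ` {..<dimS n d})"
    using q_span[OF f] by blast
  then have "meval x (sgl (sgl j d) 1) = 0"
  proof (induction rule: mpoly.span_induct_alt)
    case (step c p P)
    then show ?case using z r by (auto simp: meval.minsert_add meval.minsert_mscale)
  qed (simp add: meval.minsert_0)
  then show ?thesis using d by (simp add: meval.minsert_single)
qed

section \<open>Quadrics with invariant coefficients\<close>

definition qq :: "nat \<times> nat \<Rightarrow> (nat, 'a) mpoly \<Rightarrow> (nat, 'a) mpoly" where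
  "qq p f = q (fst p) f * q (snd p) f"

abbreviation dim2 :: nat where
  "dim2 \<equiv> dimS n (d + d)"

abbreviation pairs :: "(nat \<times> nat) set" where
  "pairs \<equiv> {..r} \<times> {..r}"

definition relmat :: "(nat \<Rightarrow> nat \<times> nat) \<Rightarrow> (nat, 'a) mpoly \<Rightarrow> 'a mat" where
  "relmat c f = cmat n (d + d) dim2 (\<lambda>j. qq (c j) f)"

text \<open>The numerator in Cramer's rule: the minor with column \<open>j\<close> replaced by the
  coordinates of \<open>qq p f\<close>.\<close>

definition relcoef :: "(nat \<Rightarrow> nat \<times> nat) \<Rightarrow> nat \<times> nat \<Rightarrow> nat \<Rightarrow> (nat, 'a) mpoly \<Rightarrow> 'a" where
  "relcoef c p j f = (adj_mat (relmat c f) *\<^sub>v cvec n (d + d) (qq p f)) $ j"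

text \<open>Cramer's rule expresses a product \<open>q\<^sub>a q\<^sub>b\<close> in terms of \<open>dim Sym\<^bsup>2d\<^esup>\<close> chosen ones. The coefficients
  are maximal minors of a matrix on whose rows \<open>SL\<close> acts by matrices of determinant \<open>1\<close>.\<close>

definition quadric :: "(nat \<Rightarrow> nat \<times> nat) \<Rightarrow> nat \<times> nat \<Rightarrow> (nat, 'a) mpoly \<Rightarrow> (nat, 'a) mpoly" where
  "quadric c p f = mscale (det (relmat c f)) (mvar (fst p) * mvar (snd p)) -
     (\<Sum>j<dim2. mscale (relcoef c p j f) (mvar (fst (c j)) * mvar (snd (c j))))"

lemma qq_forms: "p \<in> pairs \<Longrightarrow> f \<in> Sym n (k * d) \<Longrightarrow> qq p f \<in> Sym n (d + d)"
  unfolding qq_def by (rule forms_mult) (auto intro: q_forms)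

lemma relmat_carrier: "relmat c f \<in> carrier_mat dim2 dim2"
  by (simp add: relmat_def)

lemma qq_equivariant:
  "p \<in> pairs \<Longrightarrow> A \<in> SL n \<Longrightarrow> f \<in> Sym n (k * d) \<Longrightarrow> qq p (act_dual n A f) = mat_subst n (inv_mat A) (qq p f)"
  by (auto simp: qq_def q_equivariant mat_subst_mult)

lemma relmat_equivariant:
  assumes "A \<in> SL n" "f \<in> Sym n (k * d)" "\<And>j. j < dim2 \<Longrightarrow> c j \<in> pairs"
  shows "relmat c (act_dual n A f) = tau n (d + d) (inv_mat A) * relmat c f"
proof -
  have "relmat c (act_dual n A f) = cmat n (d + d) dim2 (\<lambda>j. mat_subst n (inv_mat A) (qq (c j) f))"
    unfolding relmat_def by (rule eq_matI) (use qq_equivariant[OF assms(3) assms(1,2)] in auto)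
  also have "\<dots> = tau n (d + d) (inv_mat A) * relmat c f"
    unfolding relmat_def by (rule cmat_subst) (use qq_forms[OF assms(3) assms(2)] in auto)
  finally show ?thesis .
qed

lemma qq_hom: "p \<in> pairs \<Longrightarrow> hom_forms n (k * d) (d + d) (qdeg (fst p) + qdeg (snd p)) (qq p)"
  unfolding qq_def by (rule hom_forms_mult) (auto intro: qdeg)

lemma det_relmat_invariant:
  assumes c: "\<And>j. j < dim2 \<Longrightarrow> c j \<in> pairs"
  shows "invariant n (k * d) (\<lambda>f. a * det (relmat c f))"
proof (rule invariantI, rule hom_fun_cmult, rule hom_fun_det)
  show "hom_fun n (k * d) (qdeg (fst (c j)) + qdeg (snd (c j))) (\<lambda>f. relmat c f $$ (i, j))"
    if "i < dim2" "j < dim2" for i j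
    using qq_hom[OF c] that by (simp add: relmat_def hom_forms_def)
next
  fix A :: "'a mat" and f :: "(nat, 'a) mpoly" assume A: "A \<in> SL n" "f \<in> Sym n (k * d)"
  show "a * det (relmat c (act_dual n A f)) = a * det (relmat c f)"
    using relmat_equivariant[where c = c, OF A c] SL_inv(5)[OF A(1), of "d + d"]
    by (simp add: det_mult[OF tau_carrier relmat_carrier])
qed (rule relmat_carrier)

lemma relcoef_invariant:
  assumes c: "\<And>j. j < dim2 \<Longrightarrow> c j \<in> pairs" and p: "p \<in> pairs" and j: "j < dim2"
  shows "invariant n (k * d) (\<lambda>f. a * relcoef c p j f)"
proof (rule invariantI, rule hom_fun_cmult, unfold relcoef_def, rule hom_fun_adj_mult_vec)
  show "hom_fun n (k * d) (qdeg (fst (c j)) + qdeg (snd (c j))) (\<lambda>f. relmat c f $$ (i, j))"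
    if "i < dim2" "j < dim2" for i j
    using qq_hom[OF c] that by (simp add: relmat_def hom_forms_def)
  show "hom_fun n (k * d) (qdeg (fst p) + qdeg (snd p)) (\<lambda>f. cvec n (d + d) (qq p f) $ i)"
    if "i < dim2" for i
    using qq_hom[OF p] that by (simp add: hom_forms_def)
next
  fix A :: "'a mat" and f :: "(nat, 'a) mpoly" assume A: "A \<in> SL n" "f \<in> Sym n (k * d)"
  have 1: "relmat c (act_dual n A f) = tau n (d + d) (inv_mat A) * relmat c f"
    by (rule relmat_equivariant[OF A]) (rule c)
  have 2: "cvec n (d + d) (qq p (act_dual n A f)) = tau n (d + d) (inv_mat A) *\<^sub>v cvec n (d + d) (qq p f)"
    unfolding qq_equivariant[OF p A] by (rule cvec_subst[OF qq_forms[OF p A(2)]])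
  show "a * (adj_mat (relmat c (act_dual n A f)) *\<^sub>v cvec n (d + d) (qq p (act_dual n A f))) $ j =
      a * (adj_mat (relmat c f) *\<^sub>v cvec n (d + d) (qq p f)) $ j"
    unfolding 1 2
    by (subst adj_mat_mult_tau[OF tau_carrier relmat_carrier cvec_carrier j SL_inv(5)[OF A(1)]]) (rule refl)
qed (use j relmat_carrier in auto)

lemma polynomial_in_invariants_sum:
  fixes I :: "nat \<Rightarrow> (nat, 'a) mpoly \<Rightarrow> 'a"
  assumes "\<And>j. j < N \<Longrightarrow> invariant n m (I j)" "\<And>f. f \<in> Sym n m \<Longrightarrow> c f = (\<Sum>j<N. I j f)"
  shows "polynomial_in_invariants n m c"
  unfolding polynomial_in_invariants_def
proof (intro exI conjI allI impI ballI)
  let ?P = "\<Sum>j<N. mvar j :: (nat, 'a) mpoly"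
  have "?P \<in> forms {..<N} 1" by (rule forms_sum) (rule forms_mvar)
  then have P: "\<alpha> \<in> exps {..<N} 1" if "\<alpha> \<in> ks ?P" for \<alpha> using that unfolding forms_def by blast
  show "ks \<alpha> \<subseteq> {..<N}" if "\<alpha> \<in> ks ?P" for \<alpha> using P[OF that] by (simp add: exps_iff)
  show "c f = meval (\<lambda>j. I j f) ?P" if "f \<in> Sym n m" for f
    using assms(2)[OF that] by (simp add: meval.minsert_sum meval.minsert_mvar)
qed (use assms(1) in auto)

lemma quadric_invariants:
  assumes c: "\<And>j. j < dim2 \<Longrightarrow> c j \<in> pairs" and p: "p \<in> pairs"
  shows "polynomial_in_invariants n (k * d) (\<lambda>f. lk (quadric c p f) \<alpha>)"
proof (rule polynomial_in_invariants_sum)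
  let ?m = "\<lambda>p. lk (mvar (fst p) * mvar (snd p) :: (nat, 'a) mpoly) \<alpha>"
  \<comment> \<open>The index \<open>dim2\<close> holds the leading term, the smaller ones the
    subtracted terms.\<close>
  let ?I = "\<lambda>j f. if j < dim2 then - ?m (c j) * relcoef c p j f else ?m p * det (relmat c f)"
  show "invariant n (k * d) (?I j)" for j
    using relcoef_invariant[where c = c and j = j and a = "- ?m (c j)", OF c p]
      det_relmat_invariant[where c = c and a = "?m p", OF c]
    by (cases "j < dim2") simp_all
  show "lk (quadric c p f) \<alpha> = (\<Sum>j<Suc dim2. ?I j f)" for f
    by (simp add: quadric_def lookup_minus lookup_sum sum_negf mult.commute)
qed

lemma quadric_forms:
  assumes "\<And>j. j < dim2 \<Longrightarrow> c j \<in> pairs" "p \<in> pairs"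
  shows "quadric c p f \<in> forms {..r} 2"
proof -
  have "(mvar a * mvar b :: (nat, 'a) mpoly) \<in> forms {..r} 2" if "a \<le> r" "b \<le> r" for a b
    using forms_mult[OF forms_mvar forms_mvar, of a "{..r}" b] that by (simp add: numeral_2_eq_2)
  then show ?thesis
    unfolding quadric_def using assms
    by (intro forms_diff forms_sum forms_mscale) (auto simp: mem_Times_iff)
qed

section \<open>The quadrics cut out exactly the image\<close>

lemma meval_quadric:
  "meval y (quadric c p f) = det (relmat c f) * (y (fst p) * y (snd p)) -
    (\<Sum>j<dim2. relcoef c p j f * (y (fst (c j)) * y (snd (c j))))"
proof -
  let ?Q = "mscale (det (relmat c f)) (mvar (fst p) * mvar (snd p)) :: (nat, 'a) mpoly"
  let ?R = "\<Sum>j<dim2. mscale (relcoef c p j f) (mvar (fst (c j)) * mvar (snd (c j))) :: (nat, 'a) mpoly"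
  have "meval y (quadric c p f) + meval y ?R = meval y ?Q"
    by (simp add: quadric_def flip: meval.minsert_add)
  then show ?thesis
    by (simp add: meval.minsert_sum meval.minsert_mscale meval.minsert_mult meval.minsert_mvar algebra_simps)
qed

text \<open>A matrix times its adjugate is its determinant times the identity, so the relation holds
  for every choice \<open>c\<close>, also where the minor vanishes.\<close>

lemma cramer_relation:
  assumes f: "f \<in> Sym n (k * d)" and c: "\<And>j. j < dim2 \<Longrightarrow> c j \<in> pairs" and p: "p \<in> pairs"
  shows "mscale (det (relmat c f)) (qq p f) = (\<Sum>j<dim2. mscale (relcoef c p j f) (qq (c j) f))"
proof (rule forms_eqI_lex)
  fix l assume l: "l < dim2"
  let ?M = "relmat c f" and ?v = "cvec n (d + d) (qq p f)"
  have adj: "adj_mat ?M \<in> carrier_mat dim2 dim2" by (rule adj_mat(1)[OF relmat_carrier])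
  have "?M *\<^sub>v (adj_mat ?M *\<^sub>v ?v) = (?M * adj_mat ?M) *\<^sub>v ?v"
    by (rule assoc_mult_mat_vec[symmetric, OF relmat_carrier adj cvec_carrier])
  also have "\<dots> = (det ?M \<cdot>\<^sub>m 1\<^sub>m dim2) *\<^sub>v ?v" by (simp add: adj_mat(2)[OF relmat_carrier])
  also have "\<dots> $ l = det ?M * ?v $ l"
    using l by (simp add: scalar_prod_def if_distrib[of "\<lambda>c. c * _"] if_distrib[of "\<lambda>c. _ * c"] cong: if_cong)
  finally have *: "(?M *\<^sub>v (adj_mat ?M *\<^sub>v ?v)) $ l = det ?M * ?v $ l" .
  have "(?M *\<^sub>v w) $ l = (\<Sum>j<dim2. w $ j * lk (qq (c j) f) (lex n (d + d) l))"
    if "w \<in> carrier_vec dim2" for w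
    using that l by (simp add: relmat_def scalar_prod_def atLeast0LessThan mult.commute)
  with * show "lk (mscale (det ?M) (qq p f)) (lex n (d + d) l) =
      lk (\<Sum>j<dim2. mscale (relcoef c p j f) (qq (c j) f)) (lex n (d + d) l)"
    using adj l by (simp add: lookup_sum relcoef_def)
qed (use qq_forms[OF c f] qq_forms[OF p f] in \<open>auto intro!: forms_sum forms_mscale\<close>)

text \<open>A monomial of degree 2d splits into two of degree d, each a combination of the
  q_i(f).\<close>

lemma qq_span:
  assumes f: "f \<in> Sym n (k * d)" "lin_indep_at r q f"
  shows "Sym n (d + d) \<subseteq> mpoly.span ((\<lambda>p. qq p f) ` pairs)"
proof -
  let ?V = "mpoly.span ((\<lambda>p. qq p f) ` pairs)" and ?q = "(\<lambda>i. q i f) ` {..<dimS n d}"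
  have 1: "P * q b f \<in> ?V" if "P \<in> mpoly.span ?q" "b \<le> r" for P b
    using that(1)
  proof (induction rule: mpoly.span_induct_alt)
    case (step c p P)
    then obtain a where "p = q a f" "a \<le> r" using r by auto
    then have "p * q b f \<in> ?V" using that(2) by (intro mpoly.span_base) (auto simp: qq_def intro!: image_eqI[of _ _ "(a, b)"])
    with step show ?case by (simp add: distrib_right mpoly.span_add mpoly.span_scale)
  qed (simp add: mpoly.span_zero)
  have 2: "P * P' \<in> ?V" if P: "P \<in> mpoly.span ?q" and P': "P' \<in> mpoly.span ?q" for P P'
    using P'
  proof (induction rule: mpoly.span_induct_alt)
    case (step c p P')
    then have "P * p \<in> ?V" using 1[OF P] r by auto
    with step show ?case by (simp add: distrib_left mpoly.span_add mpoly.span_scale)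
  qed (simp add: mpoly.span_zero)
  have mono: "sgl \<alpha> c \<in> ?V" if "\<alpha> \<in> Exps n (d + d)" for \<alpha> c
  proof -
    obtain \<beta> \<gamma> where *: "\<beta> \<in> Exps n d" "\<gamma> \<in> Exps n d" "\<alpha> = \<beta> + \<gamma>" using exps_split[OF \<open>\<alpha> \<in> _\<close>] by blast
    then have "sgl \<alpha> c = sgl \<beta> c * sgl \<gamma> 1" by (simp add: mult_single)
    moreover have "sgl \<beta> c \<in> mpoly.span ?q" "sgl \<gamma> 1 \<in> mpoly.span ?q"
      using q_span[OF f] * by auto
    ultimately show ?thesis using 2 by simp
  qed
  show ?thesis
  proof
    fix P :: "(nat, 'a) mpoly" assume P: "P \<in> Sym n (d + d)"
    have "(\<Sum>\<alpha>\<in>Exps n (d + d). sgl \<alpha> (lk P \<alpha>)) \<in> ?V" by (intro mpoly.span_sum mono)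
    then show "P \<in> ?V" using forms_sum_single[OF _ P] by simp
  qed
qed

text \<open>A basis is extracted from the spanning products. The choice \<open>c\<close> depends on
  \<open>f\<close>, which is why quadrics are kept for all choices.\<close>

lemma relmat_basis:
  assumes f: "f \<in> Sym n (k * d)" "lin_indep_at r q f"
  obtains c where "\<And>j. j < dim2 \<Longrightarrow> c j \<in> pairs" "det (relmat c f) \<noteq> 0"
    "inj_on (\<lambda>j. qq (c j) f) {..<dim2}" "mpoly.independent ((\<lambda>j. qq (c j) f) ` {..<dim2})"
proof -
  obtain B where B: "B \<subseteq> (\<lambda>p. qq p f) ` pairs" "mpoly.independent B" "(\<lambda>p. qq p f) ` pairs \<subseteq> mpoly.span B"
    using mpoly.maximal_independent_subset by blast
  have BS: "B \<subseteq> Sym n (d + d)" using B(1) qq_forms[OF _ f(1)] by blast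
  moreover have "Sym n (d + d) \<subseteq> mpoly.span B"
    using qq_span[OF f] mpoly.span_minimal[OF B(3)] by auto
  ultimately have card: "card B = dim2"
    using mpoly.basis_card_eq_dim[OF _ _ B(2)] dim_Sym[where 'a = 'a, of n "d + d"] by simp
  have "finite B" by (rule finite_subset[OF B(1)]) auto
  then obtain h where h: "bij_betw h {0..<dim2} B" using ex_bij_betw_nat_finite card by metis
  define c where "c j = (SOME p. p \<in> pairs \<and> qq p f = h j)" for j
  have c: "c j \<in> pairs \<and> qq (c j) f = h j" if "j < dim2" for j
  proof -
    have "h j \<in> B" using h that by (auto simp: bij_betw_def)
    then have "\<exists>p. p \<in> pairs \<and> qq p f = h j" using B(1) by force
    then show ?thesis unfolding c_def by (rule someI_ex)
  qed
  have "inj_on (\<lambda>j. qq (c j) f) {..<dim2} \<longleftrightarrow> inj_on h {..<dim2}"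
    by (rule inj_on_cong) (use c in auto)
  then have inj: "inj_on (\<lambda>j. qq (c j) f) {..<dim2}" using h by (simp add: bij_betw_def atLeast0LessThan)
  have "(\<lambda>j. qq (c j) f) ` {..<dim2} = h ` {..<dim2}"
    by (rule image_cong) (use c in auto)
  then have im: "(\<lambda>j. qq (c j) f) ` {..<dim2} = B" using h by (simp add: bij_betw_def atLeast0LessThan)
  have "det (relmat c f) \<noteq> 0"
    unfolding relmat_def
  proof (rule det_cmat_nonzero)
    show "qq (c j) f \<in> Sym n (d + d)" if "j < dim2" for j
      by (rule qq_forms[OF conjunct1[OF c[OF that]] f(1)])
  qed (use inj im B(2) in auto)
  moreover have "c j \<in> pairs" if "j < dim2" for j by (rule conjunct1[OF c[OF that]])
  ultimately show ?thesis using that[of c] inj im B(2) by simp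
qed

text \<open>A zero \<open>y\<close> of the quadrics prescribes a functional \<open>u\<close> on
  degree d with values \<open>y i\<close> on the q_i(f). The quadrics provide a functional
  \<open>l\<close> on degree 2d such that \<open>u P * u P'\<close> is \<open>l (P * P')\<close>,
  and \<open>veronese_point\<close> makes \<open>u\<close> a multiple of an evaluation.\<close>

lemma quadrics_point:
  assumes f: "f \<in> Sym n (k * d)" "lin_indep_at r q f" and d: "d \<ge> 1"
    and y: "\<exists>i\<le>r. y i \<noteq> 0"
    and Q: "\<And>c p. (\<And>j. j < dim2 \<Longrightarrow> c j \<in> pairs) \<Longrightarrow> p \<in> pairs \<Longrightarrow> meval y (quadric c p f) = 0"
  obtains x a i where "a \<noteq> 0" "i \<le> n" "x i \<noteq> 0" "\<And>i. i \<le> r \<Longrightarrow> y i = a * meval x (q i f)"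
proof -
  obtain c where c: "\<And>j. j < dim2 \<Longrightarrow> c j \<in> pairs" "det (relmat c f) \<noteq> 0"
    "inj_on (\<lambda>j. qq (c j) f) {..<dim2}" "mpoly.independent ((\<lambda>j. qq (c j) f) ` {..<dim2})"
    using relmat_basis[OF f] by blast
  obtain l where l: "\<And>P Q. l (P + Q) = l P + l Q" "\<And>a P. l (mscale a P) = a * l P"
    "\<And>j. j \<in> {..<dim2} \<Longrightarrow> l (qq (c j) f) = y (fst (c j)) * y (snd (c j))"
    using linear_extension[OF vector_space_field c(3,4), of "\<lambda>j. y (fst (c j)) * y (snd (c j))"] by blast
  have l0: "l 0 = 0" using l(2)[of 0 0] by (simp add: mscale_def)
  have lsum: "l (\<Sum>x\<in>A. g x) = (\<Sum>x\<in>A. l (g x))" for A and g :: "nat \<Rightarrow> _"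
    by (induction A rule: infinite_finite_induct) (simp_all add: l0 l(1))
  \<comment> \<open>So far \<open>l\<close> is prescribed on a basis of products only; the Cramer
    relation and the vanishing quadric determine it on the others.\<close>
  have lqq: "l (qq p f) = y (fst p) * y (snd p)" if p: "p \<in> pairs" for p
  proof -
    have "det (relmat c f) * l (qq p f) = (\<Sum>j<dim2. relcoef c p j f * l (qq (c j) f))"
      using arg_cong[where f = l, OF cramer_relation[where c = c, OF f(1) c(1) p]] by (simp add: lsum l(2))
    also have "\<dots> = det (relmat c f) * (y (fst p) * y (snd p))"
      using Q[OF c(1) p] by (simp add: meval_quadric l(3))
    finally show ?thesis using c(2) by simp
  qed
  obtain u where u: "\<And>P Q. u (P + Q) = u P + u Q" "\<And>a P. u (mscale a P) = a * u P"
    "\<And>i. i \<in> {..<dimS n d} \<Longrightarrow> u (q i f) = y i"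
    using linear_extension[OF vector_space_field lin_indep_atD[OF f(2) r], of y] by blast
  have u0: "u 0 = 0" using u(2)[of 0 0] by (simp add: mscale_def)
  have usum: "u (\<Sum>x\<in>A. g x) = (\<Sum>x\<in>A. u (g x))" for A and g :: "(nat \<Rightarrow>\<^sub>0 nat) \<Rightarrow> _"
    by (induction A rule: infinite_finite_induct) (simp_all add: u0 u(1))
  let ?q = "(\<lambda>i. q i f) ` {..<dimS n d}"
  have 1: "u P * y b = l (P * q b f)" if "P \<in> mpoly.span ?q" "b \<le> r" for P b
    using that(1)
  proof (induction rule: mpoly.span_induct_alt)
    case (step e p P)
    then obtain a where a: "p = q a f" "a \<le> r" using r by auto
    then show ?case
      using step lqq[of "(a, b)"] that(2) u(3)[of a] r by (simp add: distrib_right u l qq_def)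
  qed (simp add: u0 l0)
  have 2: "u P * u P' = l (P * P')" if P: "P \<in> mpoly.span ?q" and P': "P' \<in> mpoly.span ?q" for P P'
    using P'
  proof (induction rule: mpoly.span_induct_alt)
    case (step e p P')
    then obtain a where a: "p = q a f" "a \<le> r" using r by auto
    then show ?case using step 1[OF P a(2)] u(3)[of a] r by (simp add: distrib_left u l)
  qed (simp add: u0 l0)
  define L where "L \<alpha> = u (sgl \<alpha> 1)" for \<alpha>
  \<comment> \<open>The right side depends on \<alpha> + \<beta> only, as
    \<open>veronese_point\<close> demands.\<close>
  have LL: "L \<alpha> * L \<beta> = l (sgl (\<alpha> + \<beta>) 1)" if "\<alpha> \<in> Exps n d" "\<beta> \<in> Exps n d" for \<alpha> \<beta>
  proof -
    have "sgl \<alpha> 1 \<in> mpoly.span ?q" "sgl \<beta> 1 \<in> mpoly.span ?q" using q_span[OF f] that by auto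
    from 2[OF this] show ?thesis by (simp add: L_def mult_single)
  qed
  have uL: "u P = (\<Sum>\<alpha>\<in>Exps n d. lk P \<alpha> * L \<alpha>)" if "P \<in> Sym n d" for P
  proof -
    have "P = (\<Sum>\<alpha>\<in>Exps n d. mscale (lk P \<alpha>) (sgl \<alpha> 1))"
      by (subst forms_sum_single[OF _ that]) (simp_all add: mscale_def mconst_def mult_single)
    from arg_cong[OF this, of u] show ?thesis by (simp add: usum u(2) L_def)
  qed
  have yq: "y i = u (q i f)" if "i \<le> r" for i using u(3)[of i] that r by simp
  obtain i0 where i0: "i0 \<le> r" "y i0 \<noteq> 0" using y by blast
  then have "(\<Sum>\<alpha>\<in>Exps n d. lk (q i0 f) \<alpha> * L \<alpha>) \<noteq> 0"
    using yq[OF i0(1)] uL[OF q_forms[OF i0(1) f(1)]] by simp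
  then obtain \<alpha>\<^sub>0 where \<alpha>0: "\<alpha>\<^sub>0 \<in> Exps n d" "L \<alpha>\<^sub>0 \<noteq> 0"
    by (auto elim: sum.not_neutral_contains_not_neutral)
  obtain x a i where x: "i \<le> n" "x i = 1" "a \<noteq> 0" "\<And>\<alpha>. \<alpha> \<in> Exps n d \<Longrightarrow> L \<alpha> = a * mon x \<alpha>"
  proof (rule veronese_point[where L = L, OF _ \<alpha>0 d])
    show "L \<alpha> * L \<beta> = L \<gamma> * L \<delta>"
      if "\<alpha> \<in> Exps n d" "\<beta> \<in> Exps n d" "\<gamma> \<in> Exps n d" "\<delta> \<in> Exps n d" "\<alpha> + \<beta> = \<gamma> + \<delta>"
      for \<alpha> \<beta> \<gamma> \<delta> using that by (simp add: LL)
  qed blast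
  have "y i = a * meval x (q i f)" if i: "i \<le> r" for i
  proof -
    note qi = q_forms[OF i f(1)]
    have "y i = (\<Sum>\<alpha>\<in>Exps n d. lk (q i f) \<alpha> * (a * mon x \<alpha>))"
      unfolding yq[OF i] uL[OF qi] by (rule sum.cong) (simp_all add: x(4))
    then show ?thesis by (simp add: meval.minsert_forms[OF _ qi] sum_distrib_left mult_ac)
  qed
  then show ?thesis using that[of a i x] x(1-3) by simp
qed

lemma quadric_at_image:
  assumes "f \<in> Sym n (k * d)" "\<And>j. j < dim2 \<Longrightarrow> c j \<in> pairs" "p \<in> pairs"
  shows "meval (\<lambda>i. a * meval x (q i f)) (quadric c p f) = 0"
proof -
  have "meval x (qq p' f) = meval x (q (fst p') f) * meval x (q (snd p') f)" for p'
    by (simp add: qq_def meval.minsert_mult)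
  then have "det (relmat c f) * (meval x (q (fst p) f) * meval x (q (snd p) f)) =
      (\<Sum>j<dim2. relcoef c p j f * (meval x (q (fst (c j)) f) * meval x (q (snd (c j)) f)))"
    using arg_cong[where f = "meval x", OF cramer_relation[where c = c, OF assms]] by (simp add: meval.minsert_sum meval.minsert_mscale)
  from arg_cong[OF this, of "\<lambda>t. a * a * t"] show ?thesis
    by (simp add: meval_quadric sum_distrib_left mult_ac)
qed

theorem quadrics_exist:
  assumes d: "d \<ge> 1"
  shows "\<exists>s Q. (\<forall>l\<le>s. \<forall>\<alpha>. polynomial_in_invariants n (k * d) (\<lambda>f. lk (Q l f) \<alpha>)) \<and>
    (\<forall>f\<in>Sym n (k * d). lin_indep_at r q f \<longrightarrow> quadrics_defining_image n r q f s (\<lambda>l. Q l f))"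
proof -
  \<comment> \<open>All choices of products at once, independently of \<open>f\<close>; extensional
    functions keep the set finite.\<close>
  define I where "I = ({..<dim2} \<rightarrow>\<^sub>E pairs) \<times> pairs"
  have "finite I" by (auto simp: I_def intro!: finite_PiE)
  then obtain h where h: "bij_betw h {0..<card I} I" using ex_bij_betw_nat_finite by blast
  have "(\<lambda>j\<in>{..<dim2}. (0, 0), (0, 0)) \<in> I" by (auto simp: I_def)
  then have I0: "card I > 0" using \<open>finite I\<close> by (auto simp: card_gt_0_iff)
  define s where "s = card I - 1"
  have h': "h ` {..s} = I" using h I0 by (simp add: bij_betw_def s_def atLeast0LessThan lessThan_Suc_atMost[symmetric])
  define Q where "Q l = quadric (fst (h l)) (snd (h l))" for l
  have hI: "fst (h l) j \<in> pairs" "snd (h l) \<in> pairs" if "l \<le> s" "j < dim2" for l j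
  proof -
    have "h l \<in> I" using that h' by auto
    then show "fst (h l) j \<in> pairs" "snd (h l) \<in> pairs"
      using that(2) unfolding I_def by (auto simp: mem_Times_iff PiE_def Pi_def)
  qed
  have hI2: "snd (h l) \<in> pairs" if "l \<le> s" for l using hI(2)[OF that dimS_pos] .
  have "quadrics_defining_image n r q f s (\<lambda>l. Q l f)"
    if f: "f \<in> Sym n (k * d)" "lin_indep_at r q f" for f
    unfolding quadrics_defining_image_def
  proof (intro conjI allI impI equalityI subsetI)
    fix l assume "l \<le> s"
    then show "Q l f \<in> forms {..r} 2" unfolding Q_def using hI hI2 by (intro quadric_forms) auto
  next
    have qf: "q i f \<in> Sym n d" if "i \<le> r" for i using q_forms[OF that f(1)] .
    {
      fix P assume "P \<in> phi r q f ` proj_space n"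
      then obtain x where x: "x \<in> carrier_vec (n + 1)" "x \<noteq> 0\<^sub>v (n + 1)" and P: "P = phi r q f (proj_point x)"
        by (auto simp: proj_space_def)
      have P: "P = proj_point (uvec r q f x)" unfolding P by (rule phi_proj_point[where r = r and q = q and f = f, OF qf x(1)])
      have "uvec r q f x \<noteq> 0\<^sub>v (r + 1)"
      proof
        assume z: "uvec r q f x = 0\<^sub>v (r + 1)"
        have "meval (\<lambda>j. x $ j) (q i f) = 0" if "i \<le> r" for i
          using arg_cong[OF z, of "\<lambda>v. v $ i"] that by (simp add: uvec_def)
        then have "x $ j = 0" if "j \<le> n" for j using q_common_zero[OF f _ d that] by blast
        then have "x = 0\<^sub>v (n + 1)" using x(1) by (intro eq_vecI) auto
        with x(2) show False by simp
      qed
      then have "P \<in> proj_space r" unfolding P proj_space_def by (auto simp: uvec_def)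
      moreover have "meval (\<lambda>i. y $ i) (Q l f) = 0" if y: "y \<in> P" and l: "l \<le> s" for y l
      proof -
        obtain a where a: "y = a \<cdot>\<^sub>v uvec r q f x" using y by (auto simp: P proj_point_def)
        have "meval (\<lambda>i. y $ i) (Q l f) = meval (\<lambda>i. a * meval (\<lambda>j. x $ j) (q i f)) (Q l f)"
          by (rule minsert_forms_cong[of _ "{..r}" 2])
            (use l hI hI2 in \<open>auto simp: Q_def a uvec_def intro!: quadric_forms\<close>)
        also have "\<dots> = 0" unfolding Q_def using l hI hI2 by (intro quadric_at_image f(1)) auto
        finally show ?thesis .
      qed
      ultimately show "P \<in> zero_locus r ((\<lambda>l. Q l f) ` {..s})" by (auto simp: zero_locus_def)
    next
      fix P assume P: "P \<in> zero_locus r ((\<lambda>l. Q l f) ` {..s})"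
      then obtain y where y: "y \<in> carrier_vec (r + 1)" "y \<noteq> 0\<^sub>v (r + 1)" "P = proj_point y"
        by (auto simp: zero_locus_def proj_space_def)
      have Qy: "meval (\<lambda>i. y $ i) (Q l f) = 0" if "l \<le> s" for l
        using P that y(3) mem_proj_point[of y] by (auto simp: zero_locus_def)
      have yi: "\<exists>i\<le>r. y $ i \<noteq> 0"
      proof (rule ccontr)
        assume "\<not> ?thesis"
        then have "y = 0\<^sub>v (r + 1)" using y(1) by (intro eq_vecI) auto
        with y(2) show False by simp
      qed
      have "meval (\<lambda>i. y $ i) (quadric c p f) = 0" if c: "\<And>j. j < dim2 \<Longrightarrow> c j \<in> pairs" and p: "p \<in> pairs" for c p
      proof -
        \<comment> \<open>Only extensional choices are numbered, and a quadric sees only the values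
          of \<open>c\<close> below \<open>dim2\<close>.\<close>
        let ?c = "restrict c {..<dim2}"
        have "(?c, p) \<in> I" using c p by (auto simp: I_def)
        then obtain l where l: "l \<le> s" "h l = (?c, p)" using h' by (metis imageE atMost_iff)
        have rm: "relmat ?c f = relmat c f"
          unfolding relmat_def by (rule eq_matI) auto
        have "quadric ?c p f = quadric c p f"
          unfolding quadric_def relcoef_def rm by (intro arg_cong2[of _ _ _ _ "(-)"] refl sum.cong) auto
        then show ?thesis using Qy[OF l(1)] l(2) by (simp add: Q_def)
      qed
      from quadrics_point[OF f d yi this]
      obtain x a i where x: "a \<noteq> 0" "i \<le> n" "x i \<noteq> 0" "\<And>i. i \<le> r \<Longrightarrow> y $ i = a * meval x (q i f)"
        by metis
      define v where "v = vec (n + 1) x"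
      have v: "v \<in> carrier_vec (n + 1)" by (simp add: v_def)
      have "v $ i \<noteq> 0" using x(2,3) by (simp add: v_def)
      then have "v \<noteq> 0\<^sub>v (n + 1)" using x(2) by auto
      then have "proj_point v \<in> proj_space n" using v by (auto simp: proj_space_def)
      moreover have "y = a \<cdot>\<^sub>v uvec r q f v"
      proof (rule eq_vecI)
        fix i assume "i < dim_vec (a \<cdot>\<^sub>v uvec r q f v)"
        then have i: "i \<le> r" by (simp add: uvec_def)
        have "meval (\<lambda>j. v $ j) (q i f) = meval x (q i f)"
          by (rule meval_Sym_cong[OF qf[OF i]]) (simp add: v_def)
        then show "y $ i = (a \<cdot>\<^sub>v uvec r q f v) $ i" using i x(4) by (simp add: uvec_def)
      qed (use y(1) in \<open>simp add: uvec_def\<close>)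
      then have "P = phi r q f (proj_point v)"
        using y(3) proj_point_smult[OF x(1)] phi_proj_point[where r = r and q = q and f = f, OF qf v] by metis
      ultimately show "P \<in> phi r q f ` proj_space n" by blast
    }
  qed
  moreover have "polynomial_in_invariants n (k * d) (\<lambda>f. lk (Q l f) \<alpha>)" if "l \<le> s" for l \<alpha>
    unfolding Q_def using that hI hI2 by (intro quadric_invariants) auto
  ultimately show ?thesis by blast
qed

end

section \<open>Restriction of a form to a line\<close>

abbreviation line_subst :: "(nat \<Rightarrow> 'a) \<Rightarrow> (nat \<Rightarrow> 'a) \<Rightarrow> (nat, 'a) mpoly \<Rightarrow> 'a::field poly" where
  "line_subst e y \<equiv> minsert (\<lambda>c. [:c:]) (\<lambda>j. [:e j, y j:])"

lemma coeff_hom_const: "coeff_hom (\<lambda>c::'a::comm_semiring_1. [:c:])"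
  by (rule coeff_hom.intro) (simp_all add: ac_simps)

interpretation line_subst: coeff_hom "\<lambda>c::'a::field. [:c:]"
  by (rule coeff_hom_const)

lemma poly_line_subst: "poly (line_subst e y P) t = meval (\<lambda>j. e j + t * y j) P"
  by (simp add: minsert_def poly_sum poly_prod)

lemma degree_line_subst:
  assumes "P \<in> Sym n m"
  shows "degree (line_subst e y P) \<le> m"
  unfolding minsert_mon
proof (rule degree_sum_le)
  fix \<alpha> assume "\<alpha> \<in> ks P"
  then have \<alpha>: "total \<alpha> = m" using assms unfolding forms_def by (auto simp: exps_iff)
  have "degree (mon (\<lambda>j. [:e j, y j:]) \<alpha>) \<le> (\<Sum>i\<in>ks \<alpha>. degree ([:e i, y i:] ^ lk \<alpha> i))"
    unfolding mon_def using degree_prod_sum_le[OF finite_keys] by (simp add: o_def)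
  also have "\<dots> \<le> (\<Sum>i\<in>ks \<alpha>. lk \<alpha> i)"
  proof (rule sum_mono)
    fix i
    have "degree ([:e i, y i:] ^ lk \<alpha> i) \<le> degree [:e i, y i:] * lk \<alpha> i" by (rule degree_power_le)
    also have "\<dots> \<le> 1 * lk \<alpha> i" by (intro mult_right_mono) auto
    finally show "degree ([:e i, y i:] ^ lk \<alpha> i) \<le> lk \<alpha> i" by simp
  qed
  finally have "degree (mon (\<lambda>j. [:e j, y j:]) \<alpha>) \<le> m" using \<alpha> by (simp add: total_def)
  then show "degree ([:lk P \<alpha>:] * mon (\<lambda>j. [:e j, y j:]) \<alpha>) \<le> m"
    using degree_mult_le[of "[:lk P \<alpha>:]" "mon (\<lambda>j. [:e j, y j:]) \<alpha>"] by simp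
qed simp

lemma coeff_line_subst_0: "poly.coeff (line_subst e y P) 0 = meval e P"
  using poly_line_subst[of e y P 0] by (simp add: poly_0_coeff_0)

lemma coeff_mult_1: "poly.coeff (p * q) 1 = poly.coeff p 0 * poly.coeff q 1 + poly.coeff p 1 * poly.coeff q 0"
  for p q :: "'a::comm_semiring_1 poly"
  by (simp add: coeff_mult)

text \<open>Taken as a coefficient on a line, so that the product rule is the multiplication of
  polynomials in one variable.\<close>

definition dir_deriv :: "(nat \<Rightarrow> 'a) \<Rightarrow> (nat, 'a) mpoly \<Rightarrow> (nat \<Rightarrow> 'a) \<Rightarrow> 'a::field" where
  "dir_deriv e P y = poly.coeff (line_subst e y P) 1"

lemma dir_deriv_linear:
  assumes "P \<in> Sym n m"
  shows "dir_deriv e P y = (\<Sum>i\<le>n. dir_deriv e P (\<lambda>j. if j = i then 1 else 0) * y i)"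
  using assms
proof (induction rule: mpoly_induct_forms)
  case (const c)
  then show ?case by (simp add: dir_deriv_def line_subst.minsert_mconst)
next
  case (var i)
  then show ?case
    by (simp add: dir_deriv_def line_subst.minsert_mvar if_distrib[of "\<lambda>c. c * _"] cong: if_cong)
next
  case (add P Q)
  then show ?case by (simp add: dir_deriv_def line_subst.minsert_add distrib_right sum.distrib)
next
  case (mult P Q)
  have "dir_deriv e (P * Q) z = meval e P * dir_deriv e Q z + dir_deriv e P z * meval e Q" for z
    by (simp add: dir_deriv_def line_subst.minsert_mult coeff_mult_1 coeff_line_subst_0 del: One_nat_def)
  then show ?case using mult by (simp add: sum_distrib_left sum_distrib_right sum.distrib algebra_simps)
qed

lemma coeff_linear_power: "poly.coeff ([:1, b:] ^ m) 0 = 1" "poly.coeff ([:1, b:] ^ m) 1 = of_nat m * (b::'a::field)"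
proof -
  show 0: "poly.coeff ([:1, b:] ^ m) 0 = 1" for m by (simp add: coeff_0_power)
  show "poly.coeff ([:1, b:] ^ m) 1 = of_nat m * b"
  proof (induction m)
    case (Suc m)
    then show ?case by (simp only: power_Suc coeff_mult_1 0) (simp add: algebra_simps)
  qed simp
qed

lemma order_power:
  fixes p :: "'a::idom poly"
  assumes "p \<noteq> 0" shows "order a (p ^ m) = m * order a p"
  by (induction m) (use assms in \<open>simp_all add: order_mult\<close>)

text \<open>Euler's formula: on the line from \<open>e\<close> in the direction \<open>e\<close> the
  form is (1 + t)^m times its value at \<open>e\<close>.\<close>

lemma dir_deriv_euler:
  assumes P: "P \<in> Sym n m"
  shows "dir_deriv e P (\<lambda>j. s * e j) = s * (of_nat m * meval e P)"
proof -
  have "line_subst e e P = minsert (\<lambda>c. [:c:]) (\<lambda>j. [:1, 1:] * [:e j, 0:]) P" by simp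
  also have "\<dots> = [:1, 1:] ^ m * line_subst e (\<lambda>_. 0) P"
    using line_subst.minsert_scaled[OF P, of "[:1, 1:]" "\<lambda>j. [:e j, 0:]"] by simp
  finally have "dir_deriv e P e = dir_deriv e P (\<lambda>_. 0) + of_nat m * meval e P"
    unfolding dir_deriv_def by (simp only: coeff_mult_1 coeff_linear_power coeff_line_subst_0 mult_1_left mult_1_right)
  moreover have "dir_deriv e P (\<lambda>_. 0) = 0" by (subst dir_deriv_linear[OF P]) simp
  moreover have "dir_deriv e P (\<lambda>j. s * e j) = s * dir_deriv e P e"
    by (subst (1 2) dir_deriv_linear[OF P]) (simp add: sum_distrib_left mult_ac)
  ultimately show ?thesis by simp
qed

section \<open>Linear maps preserving the Veronese variety\<close>

text \<open>A curve of degree at most \<open>d\<close> on the affine cone over the Veronese variety that avoids the origin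
  is the image of a line: where the coordinate of a pure power vanishes, another pure power does not, and
  comparing vanishing orders shows that it vanishes to order exactly \<open>d\<close>.\<close>

locale veronese_curve =
  fixes n d :: nat and G :: "(nat \<Rightarrow>\<^sub>0 nat) \<Rightarrow> 'a::alg_closed_field poly" and i0 :: nat
  assumes d: "d \<ge> 1" and i0: "i0 \<le> n" and d0: "(of_nat d :: 'a) \<noteq> 0"
    and deg: "\<alpha> \<in> Exps n d \<Longrightarrow> degree (G \<alpha>) \<le> d"
    and cone: "\<exists>c z. c \<noteq> 0 \<and> (\<exists>i\<le>n. z i \<noteq> 0) \<and> (\<forall>\<alpha>\<in>Exps n d. poly (G \<alpha>) t = c * mon z \<alpha>)"
    and G0: "poly.coeff (G (sgl i0 d)) 0 \<noteq> 0"
begin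

text \<open>On the cone these coordinates give the underlying point up to a common factor, without
  extracting roots.\<close>

definition g :: "nat \<Rightarrow> 'a poly" where
  "g j = G (sgl i0 (d - 1) + sgl j 1)"

abbreviation C :: 'a where
  "C \<equiv> poly.coeff (G (sgl i0 d)) 0"

lemma exps_g: "j \<le> n \<Longrightarrow> sgl i0 (d - 1) + sgl j 1 \<in> Exps n d"
  using exps_add[of "sgl i0 (d - 1)" "{..n}" "d - 1" "sgl j 1" 1] i0 d by simp

lemma exps_pure: "j \<le> n \<Longrightarrow> sgl j d \<in> Exps n d"
  by simp

text \<open>At each parameter both sides equal
  \<open>c ^ d * z i0 ^ (d * (d - 1)) * mon z \<alpha>\<close>.\<close>

lemma relation:
  assumes \<alpha>: "\<alpha> \<in> Exps n d"
  shows "G \<alpha> * G (sgl i0 d) ^ (d - 1) = mon g \<alpha>"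
proof (rule poly_eqI_infinite[OF infinite_UNIV_alg_closed])
  fix t
  obtain c z where cz: "\<And>\<alpha>. \<alpha> \<in> Exps n d \<Longrightarrow> poly (G \<alpha>) t = c * mon z \<alpha>" using cone by blast
  have "poly (mon g \<alpha>) t = mon (\<lambda>j. poly (g j) t) \<alpha>" by (simp add: mon_def poly_prod)
  also have "\<dots> = mon (\<lambda>j. c * z i0 ^ (d - 1) * z j) \<alpha>"
    by (rule mon_cong) (use \<alpha> in \<open>auto simp: g_def cz[OF exps_g] mon_add exps_iff subset_iff simp del: One_nat_def\<close>)
  also have "\<dots> = (c * z i0 ^ (d - 1)) ^ d * mon z \<alpha>" using \<alpha> by (simp add: mon_scaled exps_iff)
  also have "\<dots> = c * mon z \<alpha> * (c * z i0 ^ d) ^ (d - 1)"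
    using d by (cases d) (simp_all add: power_mult_distrib mult_ac flip: power_mult)
  finally show "poly (G \<alpha> * G (sgl i0 d) ^ (d - 1)) t = poly (mon g \<alpha>) t"
    by (simp add: cz[OF \<alpha>] cz[OF exps_pure[OF i0]])
qed

lemma relation_pure: "j \<le> n \<Longrightarrow> G (sgl j d) * G (sgl i0 d) ^ (d - 1) = g j ^ d"
  using relation[OF exps_pure] by simp

lemma pure_power: "\<exists>b. G (sgl i0 d) = [:C:] * [:1, b:] ^ d"
proof (cases "degree (G (sgl i0 d)) = 0")
  case True
  then obtain a where "G (sgl i0 d) = [:a:]" by (metis degree_eq_zeroE)
  then have "G (sgl i0 d) = [:C:] * [:1, 0:] ^ d" by (simp flip: one_pCons)
  then show ?thesis ..
next
  case False
  then obtain t where t: "poly (G (sgl i0 d)) t = 0" using alg_closed_imp_poly_has_root by blast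
  have nz: "G (sgl i0 d) \<noteq> 0" using G0 by auto
  \<comment> \<open>At a root of the chosen pure power the curve avoids the origin through another
    pure power, the \<open>i\<close>-th.\<close>
  obtain c z i where cz: "c \<noteq> 0" "i \<le> n" "z i \<noteq> 0" "\<And>\<alpha>. \<alpha> \<in> Exps n d \<Longrightarrow> poly (G \<alpha>) t = c * mon z \<alpha>"
    using cone by blast
  have Gi: "poly (G (sgl i d)) t \<noteq> 0" using cz(1,3) cz(4)[OF exps_pure[OF cz(2)]] by simp
  then have Gi0: "G (sgl i d) \<noteq> 0" by auto
  have "G (sgl i d) * G (sgl i0 d) ^ (d - 1) \<noteq> 0" using nz Gi0 by simp
  then have "order t (G (sgl i d) * G (sgl i0 d) ^ (d - 1)) = (d - 1) * order t (G (sgl i0 d))"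
    using nz Gi by (simp add: order_mult order_power order_0I)
  moreover have "order t (g i ^ d) = d * order t (g i)"
    using relation_pure[OF cz(2)] \<open>G (sgl i d) * _ \<noteq> 0\<close> d by (intro order_power) auto
  ultimately have "d * order t (g i) = (d - 1) * order t (G (sgl i0 d))"
    using relation_pure[OF cz(2)] by simp
  then have "d dvd (d - 1) * order t (G (sgl i0 d))" by (metis dvd_triv_left)
  \<comment> \<open>So d divides the order of the root; being positive, the order is at least the
    bound d on the degree, and no other root remains.\<close>
  moreover have "coprime d (d - 1)" using d coprime_diff_one_left_nat[of d] by (simp add: coprime_commute)
  ultimately have "d dvd order t (G (sgl i0 d))" by (simp add: coprime_dvd_mult_right_iff)
  moreover have "order t (G (sgl i0 d)) > 0" using t nz order_root by blast
  ultimately have "d \<le> order t (G (sgl i0 d))" by (simp add: dvd_imp_le)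
  then have "[:- t, 1:] ^ d dvd G (sgl i0 d)" using nz by (simp add: order_divides)
  then obtain u where u: "G (sgl i0 d) = [:- t, 1:] ^ d * u" by (elim dvdE)
  then have "degree (G (sgl i0 d)) = d + degree u"
    using nz by (subst u, subst degree_mult_eq) (auto simp: degree_linear_power)
  then have "degree u = 0" using deg[OF exps_pure[OF i0]] by simp
  then obtain v where v: "u = [:v:]" by (metis degree_eq_zeroE)
  have "C = poly (G (sgl i0 d)) 0" by (simp add: poly_0_coeff_0)
  also have "\<dots> = (- t) ^ d * v" unfolding u v by (simp add: poly_power)
  finally have C: "C = (- t) ^ d * v" .
  then have t0: "t \<noteq> 0" using G0 d by (auto simp: power_0_left)
  have "[:- t, 1:] = [:- t:] * [:1, - 1 / t:]" using t0 by simp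
  then have "G (sgl i0 d) = ([:- t:] * [:1, - 1 / t:]) ^ d * [:v:]" unfolding u v by simp
  also have "\<dots> = [:(- t) ^ d * v:] * [:1, - 1 / t:] ^ d"
    by (simp only: power_mult_distrib poly_const_pow) (simp add: mult.commute)
  finally show ?thesis unfolding C[symmetric] ..
qed

text \<open>With s = 1 + bt, each \<open>g j\<close> is s^(d-1) times a polynomial
  \<open>l j\<close> of degree at most 1, and cancelling powers of s shows that the curve is the
  image of the line \<open>l\<close> up to a constant. The right side is \<open>l j\<close> at 1,
  written with the coefficients of order 0 and 1 of the curve.\<close>

theorem value_at_1:
  assumes \<alpha>: "\<alpha> \<in> Exps n d"
  defines "b \<equiv> poly.coeff (G (sgl i0 d)) 1 / (C * of_nat d)"
  shows "C ^ (d - 1) * poly (G \<alpha>) 1 =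
    mon (\<lambda>j. poly.coeff (g j) 0 + poly.coeff (g j) 1 - of_nat (d - 1) * b * poly.coeff (g j) 0) \<alpha>"
proof -
  obtain b' where b': "G (sgl i0 d) = [:C:] * [:1, b':] ^ d" using pure_power by blast
  have "poly.coeff (G (sgl i0 d)) 1 = C * (of_nat d * b')"
    by (subst b') (simp add: coeff_linear_power(2)[unfolded One_nat_def])
  then have bb: "b' = b" using G0 d0 by (simp add: b_def)
  define s where "s = [:1, b:]"
  have s0: "s \<noteq> 0" by (simp add: s_def)
  define c where "c = C"
  have Gs: "G (sgl i0 d) = [:c:] * s ^ d" using b' by (simp add: bb s_def c_def)
  have "\<exists>l. g j = s ^ (d - 1) * l \<and> degree l \<le> 1" if j: "j \<le> n" for j
  \<comment> \<open>If b = 0 then s = 1 and only the degree of \<open>g j\<close> has to be bounded;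
    otherwise s has a root at which orders can be compared.\<close>
  proof (cases "g j = 0 \<or> b = 0")
    case True
    then show ?thesis
    proof (cases "g j = 0")
      case False
      with True have "s = 1" by (simp add: s_def)
      then have "g j ^ d = G (sgl j d) * [:c:] ^ (d - 1)" using relation_pure[OF j] Gs by simp
      moreover have "degree ([:c:] ^ (d - 1)) = 0" by (simp add: poly_const_pow)
      ultimately have "degree (g j ^ d) \<le> d"
        using degree_mult_le[of "G (sgl j d)" "[:c:] ^ (d - 1)"] deg[OF exps_pure[OF j]] by simp
      then have "degree (g j) \<le> 1" using False d by (simp add: degree_power_eq)
      then show ?thesis using \<open>s = 1\<close> by simp
    qed (auto intro: exI[of _ 0])
  next
    case False
    define t where "t = - 1 / b"
    have st: "s = [:b:] * [:- t, 1:]" using False by (simp add: s_def t_def)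
    have ord_s: "order t (s ^ m) = m" for m
    proof -
      have "order t s = order t [:b:] + order t [:- t, 1:]"
        unfolding st by (rule order_mult) (use False in auto)
      also have "\<dots> = 1" using order_power_n_n[of t 1] False by (simp add: order_0I)
      finally show ?thesis using s0 by (simp add: order_power)
    qed
    have "(s ^ d) ^ (d - 1) dvd g j ^ d"
      using relation_pure[OF j, symmetric] unfolding Gs power_mult_distrib by simp
    then have "s ^ (d * (d - 1)) dvd g j ^ d" by (simp add: power_mult)
    then have "order t (s ^ (d * (d - 1))) \<le> order t (g j ^ d)"
      using False by (intro dvd_imp_order_le) auto
    then have "d * (d - 1) \<le> d * order t (g j)" using False by (simp add: ord_s order_power)
    then have "d - 1 \<le> order t (g j)" using d by simp
    then have "[:- t, 1:] ^ (d - 1) dvd g j" using False by (simp add: order_divides)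
    then obtain l' where l': "g j = [:- t, 1:] ^ (d - 1) * l'" by (elim dvdE)
    define l where "l = [:1 / b ^ (d - 1):] * l'"
    have "s ^ (d - 1) * l = [:b ^ (d - 1):] * [:1 / b ^ (d - 1):] * ([:- t, 1:] ^ (d - 1) * l')"
      by (simp only: st power_mult_distrib poly_const_pow l_def mult_ac)
    also have "[:b ^ (d - 1):] * [:1 / b ^ (d - 1):] = 1" using False by (simp add: one_pCons)
    finally have gl: "g j = s ^ (d - 1) * l" using l' by simp
    then have "l \<noteq> 0" using False by auto
    have "degree s = 1" using False by (simp add: s_def)
    then have "degree (g j) = d - 1 + degree l"
      using \<open>l \<noteq> 0\<close> s0 by (subst gl, subst degree_mult_eq) (auto simp: degree_power_eq)
    then have "degree l \<le> 1" using deg[OF exps_g[OF j]] d by (simp add: g_def)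
    then show ?thesis using gl by blast
  qed
  then obtain l where l: "\<And>j. j \<le> n \<Longrightarrow> g j = s ^ (d - 1) * l j" "\<And>j. j \<le> n \<Longrightarrow> degree (l j) \<le> 1"
    by metis
  have \<alpha>n: "j \<le> n" if "j \<in> ks \<alpha>" for j using \<alpha> that by (auto simp: exps_iff)
  have "mon g \<alpha> = mon (\<lambda>j. s ^ (d - 1) * l j) \<alpha>" by (rule mon_cong) (use l(1) \<alpha>n in auto)
  also have "\<dots> = (s ^ (d - 1)) ^ d * mon l \<alpha>" using \<alpha> by (simp add: mon_scaled exps_iff)
  finally have "G \<alpha> * ([:c:] * s ^ d) ^ (d - 1) = (s ^ (d - 1)) ^ d * mon l \<alpha>"
    using relation[OF \<alpha>] by (simp only: Gs)
  then have "(s ^ (d - 1)) ^ d * ([:c:] ^ (d - 1) * G \<alpha>) = (s ^ (d - 1)) ^ d * mon l \<alpha>"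
    by (simp only: power_mult_distrib power_mult[symmetric] mult_ac)
  then have "[:c:] ^ (d - 1) * G \<alpha> = mon l \<alpha>" using s0 by simp
  from arg_cong[OF this, of "\<lambda>p. poly p 1"] have "C ^ (d - 1) * poly (G \<alpha>) 1 = poly (mon l \<alpha>) 1"
    by (simp add: c_def)
  also have "\<dots> = mon (\<lambda>j. poly (l j) 1) \<alpha>" by (simp add: mon_def poly_prod)
  also have "\<dots> = mon (\<lambda>j. poly.coeff (g j) 0 + poly.coeff (g j) 1 - of_nat (d - 1) * b * poly.coeff (g j) 0) \<alpha>"
  proof (rule mon_cong)
    fix j assume "j \<in> ks \<alpha>"
    note j = \<alpha>n[OF this]
    have "l j = [:poly.coeff (l j) 0, poly.coeff (l j) 1:]"
      by (rule poly_eqI) (use l(2)[OF j] in \<open>auto simp: coeff_pCons coeff_eq_0 split: nat.splits\<close>)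
    then have "poly (l j) 1 = poly.coeff (l j) 0 + poly.coeff (l j) 1" by (metis poly_pCons poly_0 mult_1 mult_zero_right add_0_right)
    moreover have "poly.coeff (g j) 0 = poly.coeff (l j) 0"
      unfolding l(1)[OF j] s_def by (simp add: coeff_mult coeff_linear_power)
    moreover have "poly.coeff (g j) 1 = poly.coeff (l j) 1 + of_nat (d - 1) * b * poly.coeff (l j) 0"
      unfolding l(1)[OF j] s_def by (simp only: coeff_mult_1 coeff_linear_power mult_1_left)
    ultimately show "poly (l j) 1 =
        poly.coeff (g j) 0 + poly.coeff (g j) 1 - of_nat (d - 1) * b * poly.coeff (g j) 0" by simp
  qed
  finally show ?thesis .
qed

end

text \<open>Each point is reached from a base point \<open>e\<close> along a line. The formula of
  \<open>value_at_1\<close> turns out linear in the end point, so its coefficients form a matrix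
  independent of the line. Lines through the origin leave the domain of \<open>cone\<close> and are
  settled by homogeneity.\<close>

theorem veronese_automorphism:
  fixes F :: "(nat \<Rightarrow>\<^sub>0 nat) \<Rightarrow> (nat, 'a::alg_closed_field) mpoly"
  assumes d: "d \<ge> 1" and d0: "(of_nat d :: 'a) \<noteq> 0"
    and F: "\<And>\<alpha>. \<alpha> \<in> Exps n d \<Longrightarrow> F \<alpha> \<in> Sym n d"
    and cone: "\<And>x. \<exists>i\<le>n. x i \<noteq> 0 \<Longrightarrow>
      \<exists>c z. c \<noteq> 0 \<and> (\<exists>i\<le>n. z i \<noteq> 0) \<and> (\<forall>\<alpha>\<in>Exps n d. meval x (F \<alpha>) = c * mon z \<alpha>)"
  obtains B a where "B \<in> carrier_mat (n + 1) (n + 1)" "det B \<noteq> 0" "a \<noteq> 0"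
    "\<And>\<alpha> x. \<alpha> \<in> Exps n d \<Longrightarrow> meval x (F \<alpha>) = a * mon (mat_pt n B x) \<alpha>"
proof -
  define e :: "nat \<Rightarrow> 'a" where "e i = (if i = 0 then 1 else 0)" for i
  have e0: "\<exists>i\<le>n. e i \<noteq> 0" by (auto simp: e_def)
  from cone[OF this] obtain c0 z0 i0 where i0: "c0 \<noteq> 0" "i0 \<le> n" "z0 i0 \<noteq> 0"
    "\<And>\<alpha>. \<alpha> \<in> Exps n d \<Longrightarrow> meval e (F \<alpha>) = c0 * mon z0 \<alpha>" by blast
  have pure: "sgl j d \<in> Exps n d" if "j \<le> n" for j using that by simp
  define C where "C = meval e (F (sgl i0 d))"
  have C0: "C \<noteq> 0" using i0(1,3) i0(4)[OF pure[OF i0(2)]] by (simp add: C_def)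
  define g where "g j = F (sgl i0 (d - 1) + sgl j 1)" for j
  have exg: "sgl i0 (d - 1) + sgl j 1 \<in> Exps n d" if "j \<le> n" for j
    using exps_add[of "sgl i0 (d - 1)" "{..n}" "d - 1" "sgl j 1" 1] i0(2) d that by simp
  \<comment> \<open>The part of \<open>value_at_1\<close> that depends on the direction. By Euler's
    formula its value at \<open>e\<close> is d - (d-1) = 1 times \<open>meval e (g j)\<close>, the
    missing constant term; so the whole expression is \<open>N j\<close> at
    \<open>e + y\<close>.\<close>
  define N where "N j x = dir_deriv e (g j) x -
      of_nat (d - 1) * (dir_deriv e (F (sgl i0 d)) x / (C * of_nat d)) * meval e (g j)" for j x
  have N_euler: "N j (\<lambda>i. s * e i) = s * meval e (g j)" if j: "j \<le> n" for j s
  proof -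
    have "(of_nat d :: 'a) = of_nat (d - 1) + 1" using d by (cases d) simp_all
    moreover have "N j (\<lambda>i. s * e i) = s * (of_nat d * meval e (g j)) - of_nat (d - 1) * s * meval e (g j)"
      unfolding N_def g_def dir_deriv_euler[OF F[OF exg[OF j]]] dir_deriv_euler[OF F[OF pure[OF i0(2)]]]
      using C0 d0 by (simp add: C_def)
    ultimately show ?thesis by (simp add: algebra_simps)
  qed
  have N_linear: "N j x = (\<Sum>i\<le>n. N j (\<lambda>l. if l = i then 1 else 0) * x i)" if j: "j \<le> n" for j x
  proof -
    have 1: "dir_deriv e (g j) x = (\<Sum>i\<le>n. dir_deriv e (g j) (\<lambda>l. if l = i then 1 else 0) * x i)"
      unfolding g_def by (rule dir_deriv_linear[OF F[OF exg[OF j]]])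
    have 2: "dir_deriv e (F (sgl i0 d)) x = (\<Sum>i\<le>n. dir_deriv e (F (sgl i0 d)) (\<lambda>l. if l = i then 1 else 0) * x i)"
      by (rule dir_deriv_linear[OF F[OF pure[OF i0(2)]]])
    have N: "N j z = dir_deriv e (g j) z -
        of_nat (d - 1) / (C * of_nat d) * meval e (g j) * dir_deriv e (F (sgl i0 d)) z" for z
      by (simp add: N_def)
    show ?thesis
      unfolding N by (subst 1, subst 2) (simp only: sum_distrib_left left_diff_distrib sum_subtractf mult.assoc)
  qed
  have N_add: "N j (\<lambda>i. x i + y i) = N j x + N j y" if j: "j \<le> n" for j x y
    by (subst (1 2 3) N_linear[OF j]) (simp add: distrib_left sum.distrib)
  have N_e: "N j e = meval e (g j)" if j: "j \<le> n" for j using N_euler[OF j, of 1] by simp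
  have N_cong: "N j x = N j y" if "j \<le> n" "\<And>i. i \<le> n \<Longrightarrow> x i = y i" for j x y
    using that by (subst (1 2) N_linear) auto
  have main: "C ^ (d - 1) * meval (\<lambda>i. e i + y i) (F \<alpha>) = mon (\<lambda>j. N j (\<lambda>i. e i + y i)) \<alpha>"
    if \<alpha>: "\<alpha> \<in> Exps n d" for \<alpha> y
  proof (cases "\<forall>t. \<exists>i\<le>n. e i + t * y i \<noteq> 0")
    case True
    define G where "G \<alpha> = line_subst e y (F \<alpha>)" for \<alpha>
    interpret vc: veronese_curve n d G i0
    proof
      show "degree (G \<alpha>) \<le> d" if "\<alpha> \<in> Exps n d" for \<alpha>
        unfolding G_def by (rule degree_line_subst[OF F[OF that]])
      show "\<exists>c z. c \<noteq> 0 \<and> (\<exists>i\<le>n. z i \<noteq> 0) \<and> (\<forall>\<alpha>\<in>Exps n d. poly (G \<alpha>) t = c * mon z \<alpha>)" for t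
        unfolding G_def poly_line_subst using True by (intro cone) blast
      show "poly.coeff (G (sgl i0 d)) 0 \<noteq> 0" using C0 by (simp add: G_def coeff_line_subst_0 C_def)
    qed (use d d0 i0(2) in auto)
    have coeffs: "poly.coeff (vc.g j) 0 = meval e (g j)" "poly.coeff (vc.g j) 1 = dir_deriv e (g j) y"
      "poly.coeff (G (sgl i0 d)) 0 = C" "poly.coeff (G (sgl i0 d)) 1 = dir_deriv e (F (sgl i0 d)) y" for j
      by (simp_all add: vc.g_def G_def g_def C_def coeff_line_subst_0 dir_deriv_def)
    have "C ^ (d - 1) * poly (G \<alpha>) 1 = mon (\<lambda>j. meval e (g j) + N j y) \<alpha>"
      using vc.value_at_1[OF \<alpha>] unfolding coeffs N_def add_diff_eq .
    also have "\<dots> = mon (\<lambda>j. N j (\<lambda>i. e i + y i)) \<alpha>"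
      by (rule mon_cong) (use \<alpha> N_add N_e in \<open>auto simp: exps_iff subset_iff\<close>)
    finally show ?thesis by (simp add: G_def poly_line_subst)
  next
    case False
    \<comment> \<open>The line meets the origin, so \<open>y\<close> is a multiple of
      \<open>e\<close>.\<close>
    then obtain t where t: "\<And>i. i \<le> n \<Longrightarrow> e i + t * y i = 0" by blast
    have "t \<noteq> 0" using t[of 0] by (auto simp: e_def)
    define s where "s = - 1 / t"
    have y: "y i = s * e i" if "i \<le> n" for i
      using t[OF that] \<open>t \<noteq> 0\<close> by (simp add: s_def field_simps eq_neg_iff_add_eq_0)
    have ey: "e i + y i = (1 + s) * e i" if "i \<le> n" for i using y[OF that] by (simp add: algebra_simps)
    have "meval (\<lambda>i. e i + y i) (F \<alpha>) = meval (\<lambda>i. (1 + s) * e i) (F \<alpha>)"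
      by (rule meval_Sym_cong[OF F[OF \<alpha>]]) (rule ey)
    also have "\<dots> = (1 + s) ^ d * meval e (F \<alpha>)" by (rule meval.minsert_scaled[OF F[OF \<alpha>]])
    finally have "C ^ (d - 1) * meval (\<lambda>i. e i + y i) (F \<alpha>) = (1 + s) ^ d * (C ^ (d - 1) * (c0 * mon z0 \<alpha>))"
      using i0(4)[OF \<alpha>] by simp
    also have "C ^ (d - 1) * (c0 * mon z0 \<alpha>) = (c0 * z0 i0 ^ (d - 1)) ^ d * mon z0 \<alpha>"
    proof -
      have "C = c0 * z0 i0 ^ d" unfolding C_def using i0(4)[OF pure[OF i0(2)]] by simp
      then show ?thesis using d by (cases d) (simp_all add: power_mult_distrib mult_ac flip: power_mult)
    qed
    also have "\<dots> = mon (\<lambda>j. c0 * z0 i0 ^ (d - 1) * z0 j) \<alpha>" using \<alpha> by (simp add: mon_scaled exps_iff)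
    also have "(1 + s) ^ d * \<dots> = mon (\<lambda>j. (1 + s) * (c0 * z0 i0 ^ (d - 1) * z0 j)) \<alpha>"
      using \<alpha> by (subst mon_scaled) (simp add: exps_iff)
    also have "\<dots> = mon (\<lambda>j. N j (\<lambda>i. e i + y i)) \<alpha>"
    proof (rule mon_cong)
      fix j assume "j \<in> ks \<alpha>"
      then have j: "j \<le> n" using \<alpha> by (auto simp: exps_iff)
      have "N j (\<lambda>i. e i + y i) = N j (\<lambda>i. (1 + s) * e i)" by (rule N_cong[OF j ey])
      also have "\<dots> = (1 + s) * meval e (g j)" by (rule N_euler[OF j])
      finally show "(1 + s) * (c0 * z0 i0 ^ (d - 1) * z0 j) = N j (\<lambda>i. e i + y i)"
        using i0(4)[OF exg[OF j]] by (simp add: g_def mon_add mult.assoc)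
    qed
    finally show ?thesis .
  qed
  define B where "B = mat (n + 1) (n + 1) (\<lambda>(j, i). N j (\<lambda>l. if l = i then 1 else 0))"
  have B: "B \<in> carrier_mat (n + 1) (n + 1)" by (simp add: B_def)
  have NB: "N j x = mat_pt n B x j" if "j \<le> n" for j x
    using that by (subst N_linear) (simp_all add: mat_pt_def B_def)
  define a where "a = 1 / C ^ (d - 1)"
  have a0: "a \<noteq> 0" using C0 by (simp add: a_def)
  have eq: "meval x (F \<alpha>) = a * mon (mat_pt n B x) \<alpha>" if \<alpha>: "\<alpha> \<in> Exps n d" for \<alpha> x
  proof -
    have "C ^ (d - 1) * meval x (F \<alpha>) = mon (\<lambda>j. N j x) \<alpha>"
      using main[OF \<alpha>, of "\<lambda>i. x i - e i"] by simp
    also have "\<dots> = mon (mat_pt n B x) \<alpha>"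
      by (rule mon_cong) (use \<alpha> NB in \<open>auto simp: exps_iff subset_iff\<close>)
    finally show ?thesis using C0 by (simp add: a_def field_simps)
  qed
  \<comment> \<open>All pure powers would vanish at a kernel vector, against
    \<open>cone\<close>.\<close>
  have "det B \<noteq> 0"
  proof
    assume "det B = 0"
    then obtain v where v: "v \<in> carrier_vec (n + 1)" "v \<noteq> 0\<^sub>v (n + 1)" "B *\<^sub>v v = 0\<^sub>v (n + 1)"
      using det_0_iff_vec_prod_zero_field[OF B] by blast
    have "\<exists>i\<le>n. v $ i \<noteq> 0"
    proof (rule ccontr)
      assume "\<not> ?thesis"
      then have "v = 0\<^sub>v (n + 1)" using v(1) by (intro eq_vecI) auto
      with v(2) show False by simp
    qed
    then obtain c z i where cz: "c \<noteq> 0" "i \<le> n" "z i \<noteq> 0"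
      "\<And>\<alpha>. \<alpha> \<in> Exps n d \<Longrightarrow> meval (\<lambda>i. v $ i) (F \<alpha>) = c * mon z \<alpha>"
      using cone[of "\<lambda>i. v $ i"] by blast
    have "mat_pt n B (\<lambda>i. v $ i) i = (B *\<^sub>v v) $ i"
      using cz(2) v(1) B by (simp add: mat_pt_def scalar_prod_def atLeast0LessThan lessThan_Suc_atMost)
    also have "\<dots> = 0" using v(3) cz(2) by simp
    finally have "meval (\<lambda>i. v $ i) (F (sgl i d)) = 0" using eq[OF pure[OF cz(2)]] d by simp
    then show False using cz(1,3) cz(4)[OF pure[OF cz(2)]] by simp
  qed
  then show ?thesis using that[OF B _ a0 eq] by blast
qed

section \<open>Recovering the form\<close>

lemma ftilde_forms: "ftilde n k d r q f \<in> forms {..r} k"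
  unfolding ftilde_def
proof (intro forms_sum forms_mscale)
  fix \<iota> :: "nat \<Rightarrow> nat" assume "\<iota> \<in> {1..k} \<rightarrow>\<^sub>E {..r}"
  then have "(\<Prod>t\<in>{1..k}. mvar (\<iota> t)) \<in> forms {..r} (\<Sum>t\<in>{1..k}. 1)"
    by (intro forms_prod forms_mvar) auto
  then show "(\<Prod>t\<in>{1..k}. mvar (\<iota> t)) \<in> forms {..r} k" by simp
qed

lemma inv_mat_inv_mat:
  fixes B :: "'a::field mat"
  assumes B: "B \<in> carrier_mat N N" "det B \<noteq> 0"
  shows "inv_mat (inv_mat B) = B"
proof -
  note i = inv_mat_props[OF B]
  have "det (inv_mat B) \<noteq> 0" using i(4) B(2) by simp
  note j = inv_mat_props[OF i(1) this]
  have "inv_mat (inv_mat B) = inv_mat (inv_mat B) * (inv_mat B * B)" using i(3) j(1) by simp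
  also have "\<dots> = (inv_mat (inv_mat B) * inv_mat B) * B"
    by (rule assoc_mult_mat[symmetric, OF j(1) i(1) B(1)])
  also have "\<dots> = B" using j(3) B(1) by simp
  finally show ?thesis .
qed

lemma equivalent_of_same_data:
  fixes q q' :: "nat \<Rightarrow> (nat, 'a::alg_closed_field) mpoly \<Rightarrow> (nat, 'a) mpoly"
  assumes q: "covariant_family n k d r q" and q': "covariant_family n k d r q'" and d: "d \<ge> 1"
    and f: "f \<in> Sym n (k * d)" "lin_indep_at r q f"
    and f': "f' \<in> Sym n (k * d)" "lin_indep_at r q' f'"
    and image: "phi r q f ` proj_space n = phi r q' f' ` proj_space n"
    and ft: "ftilde n k d r q f = ftilde n k d r q' f'"
  shows "GL_equivalent n (k * d) f f'"
proof -
  interpret q: covariant_family n k d r q by fact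
  interpret q': covariant_family n k d r q' by fact
  note inf = q.inf
  have qf: "q i f \<in> Sym n d" and qf': "q' i f' \<in> Sym n d" if "i \<le> r" for i
    using q.q_forms[OF that f(1)] q'.q_forms[OF that f'(1)] by auto
  have d0: "(of_nat d :: 'a) \<noteq> 0"
  proof
    assume "(of_nat d :: 'a) = 0"
    moreover have "fact d = d * (fact (d - 1) :: nat)" using d fact_reduce[of d, where 'a = nat] by simp
    ultimately show False using q.fd by simp
  qed
  obtain L where L: "\<And>P Q. L (P + Q) = L P + L Q" "\<And>c P. L (mscale c P) = mscale c (L P)"
    "\<And>i. i \<in> {..<dimS n d} \<Longrightarrow> L (q i f) = q' i f'"
    using linear_extension[OF mpoly.vector_space_axioms lin_indep_atD[OF f(2) q.r], of "\<lambda>i. q' i f'"] by blast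
  have Lq: "L (q i f) = q' i f'" if "i \<le> r" for i using L(3)[of i] that q.r by simp
  have L0: "L 0 = 0" using L(2)[of 0 0] by (simp add: mscale_def mconst_def)
  have Lsum: "L (\<Sum>x\<in>A. h x) = (\<Sum>x\<in>A. L (h x))" for A and h :: "(nat \<Rightarrow>\<^sub>0 nat) \<Rightarrow> _"
    by (induction A rule: infinite_finite_induct) (simp_all add: L0 L(1))
  let ?q = "(\<lambda>i. q i f) ` {..<dimS n d}"
  have L_forms: "L P \<in> Sym n d" if "P \<in> mpoly.span ?q" for P
    using that
  proof (induction rule: mpoly.span_induct_alt)
    case (step c p P)
    then obtain i where "p = q i f" "i \<le> r" using q.r by auto
    with step qf' show ?case by (simp add: L Lq forms_add forms_mscale)
  qed (simp add: L0)
  define F where "F \<alpha> = L (sgl \<alpha> 1)" for \<alpha>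
  have span: "sgl \<alpha> 1 \<in> mpoly.span ?q" if "\<alpha> \<in> Exps n d" for \<alpha>
    using q.q_span[OF f] that by auto
  \<comment> \<open>Equality of the images yields a point \<open>Z\<close> whose value under the
    first map is that of \<open>x\<close> under the second; then evaluation at \<open>x\<close>
    after \<open>L\<close> is a multiple of evaluation at \<open>Z\<close>.\<close>
  have cone: "\<exists>c z. c \<noteq> 0 \<and> (\<exists>i\<le>n. z i \<noteq> 0) \<and> (\<forall>\<alpha>\<in>Exps n d. meval x (F \<alpha>) = c * mon z \<alpha>)"
    if x: "\<exists>i\<le>n. x i \<noteq> 0" for x
  proof -
    define X where "X = vec (n + 1) x"
    have X: "X \<in> carrier_vec (n + 1)" by (simp add: X_def)
    obtain i where "i \<le> n" "x i \<noteq> 0" using x by blast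
    then have "X $ i \<noteq> 0\<^sub>v (n + 1) $ i" by (simp add: X_def)
    then have "X \<noteq> 0\<^sub>v (n + 1)" by metis
    then have "phi r q' f' (proj_point X) \<in> phi r q f ` proj_space n"
      unfolding image using X by (auto simp: proj_space_def)
    then obtain Z where Z: "Z \<in> carrier_vec (n + 1)" "Z \<noteq> 0\<^sub>v (n + 1)"
      "phi r q' f' (proj_point X) = phi r q f (proj_point Z)" by (auto simp: proj_space_def)
    have "proj_point (uvec r q' f' X) = proj_point (uvec r q f Z)"
      using Z(3) phi_proj_point[where r = r and q = q and f = f, OF qf Z(1)]
        phi_proj_point[where r = r and q = q' and f = f', OF qf' X] by metis
    then obtain c where c: "c \<noteq> 0" "uvec r q' f' X = c \<cdot>\<^sub>v uvec r q f Z"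
      using mem_proj_point[of "uvec r q' f' X"] by (auto simp: proj_point_def)
    have ev: "meval x (q' i f') = c * meval (\<lambda>j. Z $ j) (q i f)" if i: "i \<le> r" for i
    proof -
      have "meval x (q' i f') = meval (\<lambda>j. X $ j) (q' i f')"
        by (rule meval_Sym_cong[OF qf'[OF i]]) (simp add: X_def)
      also have "\<dots> = uvec r q' f' X $ i" using i by (simp add: uvec_def)
      also have "\<dots> = c * meval (\<lambda>j. Z $ j) (q i f)" unfolding c(2) using i by (simp add: uvec_def)
      finally show ?thesis .
    qed
    have evL: "meval x (L P) = c * meval (\<lambda>j. Z $ j) P" if "P \<in> mpoly.span ?q" for P
      using that
    proof (induction rule: mpoly.span_induct_alt)
      case (step a p P)
      then obtain i where "p = q i f" "i \<le> r" using q.r by auto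
      with step ev show ?case
        by (simp add: L Lq meval.minsert_add meval.minsert_mscale algebra_simps)
    qed (simp add: L0 meval.minsert_0)
    have "meval x (F \<alpha>) = c * mon (\<lambda>j. Z $ j) \<alpha>" if "\<alpha> \<in> Exps n d" for \<alpha>
      unfolding F_def using evL[OF span[OF that]] by (simp add: meval.minsert_single)
    moreover have "\<exists>i\<le>n. Z $ i \<noteq> 0"
    proof (rule ccontr)
      assume "\<not> ?thesis"
      then have "Z = 0\<^sub>v (n + 1)" using Z(1) by (intro eq_vecI) auto
      with Z(2) show False by simp
    qed
    ultimately show ?thesis using c(1) by blast
  qed
  have FS: "F \<alpha> \<in> Sym n d" if "\<alpha> \<in> Exps n d" for \<alpha>
    unfolding F_def by (rule L_forms[OF span[OF that]])
  obtain B a where B: "B \<in> carrier_mat (n + 1) (n + 1)" "det B \<noteq> 0" "a \<noteq> 0"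
    "\<And>\<alpha> x. \<alpha> \<in> Exps n d \<Longrightarrow> meval x (F \<alpha>) = a * mon (mat_pt n B x) \<alpha>"
    using veronese_automorphism[OF d d0 FS cone] by blast
  have qB: "meval x (q' i f') = a * meval (mat_pt n B x) (q i f)" if i: "i \<le> r" for i x
  proof -
    have "q i f = (\<Sum>\<alpha>\<in>Exps n d. mscale (lk (q i f) \<alpha>) (sgl \<alpha> 1))"
      by (subst forms_sum_single[OF _ qf[OF i]]) (simp_all add: mscale_def mconst_def mult_single)
    from arg_cong[OF this, of L] have "q' i f' = (\<Sum>\<alpha>\<in>Exps n d. mscale (lk (q i f) \<alpha>) (F \<alpha>))"
      by (simp add: Lq[OF i] Lsum L(2) F_def)
    then have "meval x (q' i f') = (\<Sum>\<alpha>\<in>Exps n d. lk (q i f) \<alpha> * (a * mon (mat_pt n B x) \<alpha>))"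
      by (simp add: meval.minsert_sum meval.minsert_mscale B(4))
    then show ?thesis by (simp add: meval.minsert_forms[OF _ qf[OF i]] sum_distrib_left mult_ac)
  qed
  define c where "c = of_nat (fact (k * d)) / (of_nat (fact d) ^ k :: 'a)"
  have c: "c \<noteq> 0" using q.fm q.fd by (simp add: c_def)
  define \<Delta> where "\<Delta> = det (q.S f) ^ k"
  define \<Delta>' where "\<Delta>' = det (q'.S f') ^ k"
  have \<Delta>: "\<Delta> \<noteq> 0" "\<Delta>' \<noteq> 0"
    using q.det_S_nonzero[OF f] q'.det_S_nonzero[OF f'] by (simp_all add: \<Delta>_def \<Delta>'_def)
  \<comment> \<open>Both sides compute the common \<open>ftilde\<close> at the same vector, by
    \<open>meval_ftilde\<close> for each family; \<open>a ^ k\<close> comes from its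
    homogeneity.\<close>
  have ff': "\<Delta>' * c * meval x f' = a ^ k * (\<Delta> * c * meval (mat_pt n B x) f)" for x
  proof -
    have "\<Delta>' * c * meval x f' = meval (\<lambda>i. meval x (q' i f')) (ftilde n k d r q' f')"
      using q'.meval_ftilde[OF f'(1), of x] by (simp add: \<Delta>'_def c_def)
    also have "\<dots> = meval (\<lambda>i. a * meval (mat_pt n B x) (q i f)) (ftilde n k d r q' f')"
      by (rule minsert_forms_cong[OF ftilde_forms]) (simp add: qB)
    also have "\<dots> = a ^ k * meval (\<lambda>i. meval (mat_pt n B x) (q i f)) (ftilde n k d r q f)"
      unfolding ft by (rule meval.minsert_scaled[OF ftilde_forms])
    also have "\<dots> = a ^ k * (\<Delta> * c * meval (mat_pt n B x) f)"
      using q.meval_ftilde[OF f(1), of "mat_pt n B x"] by (simp add: \<Delta>_def c_def)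
    finally show ?thesis .
  qed
  define b where "b = a ^ k * \<Delta> / \<Delta>'"
  have b: "b \<noteq> 0" using B(3) \<Delta> by (simp add: b_def)
  have fb: "meval x f' = b * meval (mat_pt n B x) f" for x
    using ff'[of x] c \<Delta> by (simp add: b_def field_simps)
  have kd: "k * d > 0" using q.k d by simp
  obtain w where w: "w ^ (k * d) = b" using nth_root_exists[OF kd] by blast
  then have w0: "w \<noteq> 0" using b kd by (metis power_0_left less_irrefl)
  define B' where "B' = w \<cdot>\<^sub>m B"
  have B': "B' \<in> carrier_mat (n + 1) (n + 1)" using B(1) by (simp add: B'_def)
  have det: "det B' \<noteq> 0" using B(1,2) w0 by (simp add: B'_def)
  have pt: "mat_pt n B' x i = w * mat_pt n B x i" if "i \<le> n" for x i
    using that B(1) by (simp add: mat_pt_def B'_def sum_distrib_left mult.assoc)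
  have "mat_subst n B' f = f'"
  proof (rule forms_eqI_meval[OF inf mat_subst_forms[OF f(1)] f'(1)])
    fix x
    have "meval x (mat_subst n B' f) = meval (\<lambda>i. w * mat_pt n B x i) f"
      unfolding meval_mat_subst by (rule meval_Sym_cong[OF f(1)]) (rule pt)
    also have "\<dots> = w ^ (k * d) * meval (mat_pt n B x) f" by (rule meval.minsert_scaled[OF f(1)])
    finally show "meval x (mat_subst n B' f) = meval x f'" using fb w by simp
  qed
  \<comment> \<open>\<open>act_dual\<close> substitutes the inverse matrix, so the group element is
    the inverse of \<open>B'\<close>.\<close>
  moreover have "inv_mat B' \<in> GL n"
    using inv_mat_props[OF B' det] det by (intro GL_I) simp_all
  ultimately show ?thesis
    using f(1) f'(1) inv_mat_inv_mat[OF B' det] unfolding GL_equivalent_def act_dual_eq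
    by (intro conjI bexI[of _ "inv_mat B'"]) simp_all
qed

theorem theorem2p5p1:
  fixes k d n r :: nat
  assumes "k \<ge> 1" "d \<ge> 1" "n \<ge> 1"
    and "CHAR('a::alg_closed_field) = 0 \<or> CHAR('a) > k * d"
    and "r = mpoly.dim (Sym n d :: (nat, 'a) mpoly set) - 1"
  shows
    "(\<forall>q :: nat \<Rightarrow> (nat, 'a) mpoly \<Rightarrow> (nat, 'a) mpoly.
        (\<forall>i\<le>r. covariant n (k * d) d (q i)) \<and> (\<exists>f\<in>Sym n (k * d). lin_indep_at r q f) \<longrightarrow>
        (\<forall>\<alpha>. invariant n (k * d) (\<lambda>f. Poly_Mapping.lookup (ftilde n k d r q f) \<alpha>)) \<and>
        (\<exists>s Q. (\<forall>l\<le>s. \<forall>\<alpha>. polynomial_in_invariants n (k * d)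
                             (\<lambda>f. Poly_Mapping.lookup (Q l f) \<alpha>)) \<and>
               (\<forall>f\<in>Sym n (k * d). lin_indep_at r q f \<longrightarrow>
                  quadrics_defining_image n r q f s (\<lambda>l. Q l f)))) \<and>
     (\<exists>R :: (nat, 'a) mpoly \<Rightarrow> (nat, 'a) mpoly set \<Rightarrow> (nat, 'a) mpoly.
        \<forall>q f s Q.
          (\<forall>i\<le>r. covariant n (k * d) d (q i)) \<and> f \<in> Sym n (k * d) \<and> lin_indep_at r q f \<and>
          quadrics_defining_image n r q f s Q \<longrightarrow>
          GL_equivalent n (k * d) f (R (ftilde n k d r q f) (Q ` {..s})))"
proof -
  \<comment> \<open>\<open>r\<close> is a truncated difference, hence the appeal to positive
    dimension.\<close>
  have r: "r + 1 = dimS n d" using assms(5) dimS_pos[of n d] by (simp add: dim_Sym)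
  have family: "covariant_family n k d r q" if "\<forall>i\<le>r. covariant n (k * d) d (q i)"
    for q :: "nat \<Rightarrow> (nat, 'a) mpoly \<Rightarrow> (nat, 'a) mpoly"
    by unfold_locales
      (use that assms(1) r infinite_UNIV_alg_closed fact_nonzero_CHAR[OF assms(4)] in auto)
  show ?thesis
  proof (intro conjI, goal_cases)
    case 1
    show ?case
      using covariant_family.ftilde_invariant[OF family] covariant_family.quadrics_exist[OF family assms(2)]
      by blast
  next
    case 2
    define data where "data q f s Q t E \<longleftrightarrow>
      (\<forall>i\<le>r. covariant n (k * d) d (q i)) \<and> f \<in> Sym n (k * d) \<and> lin_indep_at r q f \<and>
      quadrics_defining_image n r q f s Q \<and> t = ftilde n k d r q f \<and> E = Q ` {..s}"
      for q f s and Q :: "nat \<Rightarrow> (nat, 'a) mpoly" and t E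
    \<comment> \<open>The chosen form may come with other covariants and another numbering of the
      quadrics; only \<open>t\<close> and the set \<open>E\<close> are shared.\<close>
    define R where "R t E = (SOME f. \<exists>q s Q. data q f s Q t E)" for t E
    have "GL_equivalent n (k * d) f (R (ftilde n k d r q f) (Q ` {..s}))"
      if *: "(\<forall>i\<le>r. covariant n (k * d) d (q i)) \<and> f \<in> Sym n (k * d) \<and> lin_indep_at r q f \<and>
          quadrics_defining_image n r q f s Q" for q f s Q
    proof -
      let ?t = "ftilde n k d r q f" and ?E = "Q ` {..s}"
      have "\<exists>f q s Q. data q f s Q ?t ?E" using * unfolding data_def by blast
      then have "\<exists>q s Q. data q (R ?t ?E) s Q ?t ?E" unfolding R_def by (rule someI_ex)
      then obtain q' s' Q' where **: "data q' (R ?t ?E) s' Q' ?t ?E" by blast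
      \<comment> \<open>Both images are the zero locus of the same set of quadrics.\<close>
      have "phi r q f ` proj_space n = phi r q' (R ?t ?E) ` proj_space n"
        using * ** unfolding data_def quadrics_defining_image_def by metis
      with * ** show ?thesis
        unfolding data_def by (intro equivalent_of_same_data[OF family family assms(2)]) auto
    qed
    then show ?case by blast
  qed
qed

end
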